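(* Let $T$ be an arbitrary index set and let $X=(X_t)_{t\in T}$ be a QID process such that there exist two ID processes generating $X$, one of them having finite Lévy measure. Then there exists a unique triplet $(\Sigma,\nu,b)$, where $\Sigma$ is a non-negative definite function on $T\times T$, $\nu$ is a quasi-Lévy type measure on $(\mathbb{R}^T,\mathcal{B}^T)$ and $b\in\mathbb{R}^T$, such that for every non-empty finite $I\subset T$ and $\theta\in\mathbb{R}^I$ $$\mathbb{E}\big[e^{i\langle\theta,X_I\rangle}\big]=\exp\Big(i\langle\theta,b_I\rangle-\tfrac12\langle\theta,\Sigma_I\theta\rangle+\int_{\mathbb{R}^T}\big(e^{i\langle\theta,x_I\rangle}-1-i\langle\theta,[[x_I]]\rangle\big)\nu(dx)\Big),$$ where $\Sigma_I$ is the restriction of $\Sigma$ to $I\times I$.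
   Context: $\mathbb{R}^T$ is the space of all functions $x:T\to\mathbb{R}$, $\mathcal{B}^T$ its cylindrical (product) $\sigma$-algebra, $0_T$ its origin (also the one-point set), $x_I$ the restriction of $x$ to $I$, $X_I=(X_t)_{t\in I}$. Fix a bounded measurable $\chi:\mathbb{R}\to\mathbb{R}$ with $\chi(v)=1+o(|v|)$ as $v\to0$ and $\chi(v)=O(|v|^{-1})$ as $|v|\to\infty$; the truncation is $[[v]]=(v_j\chi(|v_j|))_j$. Non-negative definite functions are symmetric. A process is ID if all its finite-dimensional distributions are infinitely divisible. A process is QID if all its finite-dimensional distributions are QID, where a distribution on $\mathbb{R}^d$ is QID if its characteristic function has a Lévy–Khintchine representation $\exp(i\langle\theta,\gamma\rangle-\frac12\langle\theta,A\theta\rangle+\int(e^{i\langle\theta,x\rangle}-1-i\langle\theta,[[x]]\rangle)\nu(dx))$ with $\gamma\in\mathbb{R}^d$, $A$ symmetric, and $\nu$ a quasi-Lévy type measure on $\mathbb{R}^d$, i.e. the difference, on Borel sets bounded away from $0$, of two Lévy measures. ID processes $Y,Z$ generate $X$ if $X+Y\stackrel{d}{=}Z$ (finite-dimensional distributions) with $Y$ independent of $X$. A Lévy measure on $(\mathbb{R}^T,\mathcal{B}^T)$ is a measure $\nu$ with $\int_{\mathbb{R}^T}(|x(t)|^2\wedge1)\nu(dx)<\infty$ for every $t\in T$ and $\nu(A)=\nu_*(A\setminus0_T)$ for every $A\in\mathcal{B}^T$, where $\nu_*$ is the inner measure. Every ID process has a unique generating triplet $(\Sigma,\nu,b)$ with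 $\nu$ a Lévy measure on $(\mathbb{R}^T,\mathcal{B}^T)$ such that the displayed formula of the claim holds; this $\nu$ is its Lévy measure. A signed measure $\nu$ on $(\mathbb{R}^T,\mathcal{B}^T)$, with Jordan decomposition $\nu=\nu^+-\nu^-$ and total variation $|\nu|$, is a quasi-Lévy type measure if (QL1) $\int_{\mathbb{R}^T}(|x(t)|^2\wedge1)|\nu|(dx)<\infty$ for every $t\in T$, and (QL2) $|\nu|(A)=\nu^+_*(A\setminus0_T)+\nu^-_*(A\setminus0_T)$ for every $A\in\mathcal{B}^T$, where $\nu^+_*,\nu^-_*$ are the inner measures of $\nu^+,\nu^-$. Integrals against $\nu$ are $\int g\,d\nu^+-\int g\,d\nu^-$. *)

theory Defs
  imports "HOL-Probability.Probability" "HOL-Library.Landau_Symbols"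
begin

section \<open>The space of functions on an index set\<close>

text \<open>
  A function on \<open>T\<close> is represented by a function on the ambient type that is \<^term>\<open>undefined\<close>
  outside \<open>T\<close>. In particular \<open>\<real>\<^sup>I\<close> for a finite subset \<open>I\<close> of \<open>T\<close> is \<open>path_space I\<close>.
\<close>

abbreviation path_space :: "'t set \<Rightarrow> ('t \<Rightarrow> real) measure" where
  "path_space T \<equiv> PiM T (\<lambda>_. borel)"

definition origin :: "'t set \<Rightarrow> 't \<Rightarrow> real" where
  "origin T = (\<lambda>t\<in>T. 0)"

definition inner_measure :: "'a measure \<Rightarrow> 'a set \<Rightarrow> ennreal" where
  "inner_measure M E = (SUP B\<in>{B \<in> sets M. B \<subseteq> E}. emeasure M B)"

definition inner_prod_on :: "'t set \<Rightarrow> ('t \<Rightarrow> real) \<Rightarrow> ('t \<Rightarrow> real) \<Rightarrow> real" where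
  "inner_prod_on I \<theta> x = (\<Sum>t\<in>I. \<theta> t * x t)"

definition quad_form_on :: "'t set \<Rightarrow> ('t \<Rightarrow> real) \<Rightarrow> ('t \<times> 't \<Rightarrow> real) \<Rightarrow> real" where
  "quad_form_on I \<theta> S = (\<Sum>s\<in>I. \<Sum>t\<in>I. \<theta> s * S (s, t) * \<theta> t)"

definition symmetric_on :: "'t set \<Rightarrow> ('t \<times> 't \<Rightarrow> real) \<Rightarrow> bool" where
  "symmetric_on T S \<longleftrightarrow> (\<forall>s\<in>T. \<forall>t\<in>T. S (s, t) = S (t, s))"

definition nonneg_definite_on :: "'t set \<Rightarrow> ('t \<times> 't \<Rightarrow> real) \<Rightarrow> bool" where
  "nonneg_definite_on T S \<longleftrightarrow>
     symmetric_on T S \<and> (\<forall>I \<theta>. finite I \<longrightarrow> I \<subseteq> T \<longrightarrow> quad_form_on I \<theta> S \<ge> 0)"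


section \<open>Truncation and the Levy--Khintchine exponent\<close>

definition truncation_factor :: "(real \<Rightarrow> real) \<Rightarrow> bool" where
  "truncation_factor chi \<longleftrightarrow>
     chi \<in> borel_measurable borel \<and> bounded (range chi) \<and>
     (\<lambda>v. chi v - 1) \<in> o[at 0](\<lambda>v. \<bar>v\<bar>) \<and>
     chi \<in> O[at_infinity](\<lambda>v. inverse \<bar>v\<bar>)"

definition truncate :: "(real \<Rightarrow> real) \<Rightarrow> ('t \<Rightarrow> real) \<Rightarrow> 't \<Rightarrow> real" where
  "truncate chi x = (\<lambda>t. x t * chi \<bar>x t\<bar>)"

definition lk_integrand ::
  "(real \<Rightarrow> real) \<Rightarrow> 't set \<Rightarrow> ('t \<Rightarrow> real) \<Rightarrow> ('t \<Rightarrow> real) \<Rightarrow> complex" where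
  "lk_integrand chi I \<theta> x =
     iexp (inner_prod_on I \<theta> x) - 1 - \<i> * complex_of_real (inner_prod_on I \<theta> (truncate chi x))"

text \<open>
  The argument \<open>J\<close> is the integral with respect to the (signed) Levy measure. Only the values of
  \<open>\<theta>\<close>, \<open>b\<close> and \<open>S\<close> on \<open>I\<close> and \<open>I \<times> I\<close> matter, so no explicit restriction is needed.
\<close>

definition lk_exponent ::
  "(real \<Rightarrow> real) \<Rightarrow> 't set \<Rightarrow> ('t \<times> 't \<Rightarrow> real) \<Rightarrow> ((('t \<Rightarrow> real) \<Rightarrow> complex) \<Rightarrow> complex) \<Rightarrow>
     ('t \<Rightarrow> real) \<Rightarrow> ('t \<Rightarrow> real) \<Rightarrow> complex" where
  "lk_exponent chi I S J b \<theta> =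
     \<i> * complex_of_real (inner_prod_on I \<theta> b)
     - complex_of_real (quad_form_on I \<theta> S) / 2
     + J (lk_integrand chi I \<theta>)"


section \<open>Infinitely divisible and quasi-infinitely divisible distributions\<close>

definition infinitely_divisible_on :: "'t set \<Rightarrow> ('t \<Rightarrow> real) measure \<Rightarrow> bool" where
  "infinitely_divisible_on I \<mu> \<longleftrightarrow>
     (\<forall>n\<ge>1. \<exists>\<rho>. prob_space \<rho> \<and> sets \<rho> = sets (path_space I) \<and>
        \<mu> = distr (PiM {..<n::nat} (\<lambda>_. \<rho>)) (path_space I) (\<lambda>x. \<lambda>t\<in>I. \<Sum>k<n. x k t))"

text \<open>Levy measures on the finite-dimensional space \<open>\<real>\<^sup>I\<close>.\<close>

definition levy_measure_fin :: "'t set \<Rightarrow> ('t \<Rightarrow> real) measure \<Rightarrow> bool" where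
  "levy_measure_fin I \<nu> \<longleftrightarrow>
     sets \<nu> = sets (path_space I) \<and> emeasure \<nu> {origin I} = 0 \<and>
     (\<integral>\<^sup>+x. ennreal (min (\<Sum>t\<in>I. \<bar>x t\<bar>\<^sup>2) 1) \<partial>\<nu>) < \<infinity>"

text \<open>
  A quasi-Levy type measure on \<open>\<real>\<^sup>I\<close> is a set function defined only on the Borel sets bounded away
  from the origin, equal there to the difference of two Levy measures \<open>\<nu>1\<close> and \<open>\<nu>2\<close>. It is
  represented by such a pair; the integral against it is the difference of the integrals and does
  not depend on the representing pair.
\<close>

definition qid_on :: "(real \<Rightarrow> real) \<Rightarrow> 't set \<Rightarrow> ('t \<Rightarrow> real) measure \<Rightarrow> bool" where
  "qid_on chi I \<mu> \<longleftrightarrow>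
     (\<exists>\<gamma> A \<nu>1 \<nu>2. symmetric_on I A \<and> levy_measure_fin I \<nu>1 \<and> levy_measure_fin I \<nu>2 \<and>
        (\<forall>\<theta>. (CLINT x|\<mu>. iexp (inner_prod_on I \<theta> x)) =
           exp (lk_exponent chi I A (\<lambda>g. (CLINT x|\<nu>1. g x) - (CLINT x|\<nu>2. g x)) \<gamma> \<theta>)))"


section \<open>Processes\<close>

definition process :: "'t set \<Rightarrow> 'w measure \<Rightarrow> ('t \<Rightarrow> 'w \<Rightarrow> real) \<Rightarrow> bool" where
  "process T M X \<longleftrightarrow> prob_space M \<and> (\<forall>t\<in>T. X t \<in> borel_measurable M)"

definition path_map :: "'t set \<Rightarrow> ('t \<Rightarrow> 'w \<Rightarrow> real) \<Rightarrow> 'w \<Rightarrow> 't \<Rightarrow> real" where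
  "path_map T X = (\<lambda>\<omega>. \<lambda>t\<in>T. X t \<omega>)"

definition fin_dim_distr ::
  "'w measure \<Rightarrow> ('t \<Rightarrow> 'w \<Rightarrow> real) \<Rightarrow> 't set \<Rightarrow> ('t \<Rightarrow> real) measure" where
  "fin_dim_distr M X I = distr M (path_space I) (path_map I X)"

definition id_process :: "'t set \<Rightarrow> 'w measure \<Rightarrow> ('t \<Rightarrow> 'w \<Rightarrow> real) \<Rightarrow> bool" where
  "id_process T M X \<longleftrightarrow> process T M X \<and>
     (\<forall>I. finite I \<longrightarrow> I \<noteq> {} \<longrightarrow> I \<subseteq> T \<longrightarrow> infinitely_divisible_on I (fin_dim_distr M X I))"

definition qid_process ::
  "(real \<Rightarrow> real) \<Rightarrow> 't set \<Rightarrow> 'w measure \<Rightarrow> ('t \<Rightarrow> 'w \<Rightarrow> real) \<Rightarrow> bool" where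
  "qid_process chi T M X \<longleftrightarrow> process T M X \<and>
     (\<forall>I. finite I \<longrightarrow> I \<noteq> {} \<longrightarrow> I \<subseteq> T \<longrightarrow> qid_on chi I (fin_dim_distr M X I))"

text \<open>
  The ID processes \<open>Y\<close> (independent of \<open>X\<close>, hence on the same probability space) and \<open>Z\<close> (on a
  possibly different one) generate \<open>X\<close>.
\<close>

definition generate ::
  "'t set \<Rightarrow> 'w measure \<Rightarrow> ('t \<Rightarrow> 'w \<Rightarrow> real) \<Rightarrow> ('t \<Rightarrow> 'w \<Rightarrow> real) \<Rightarrow>
     'v measure \<Rightarrow> ('t \<Rightarrow> 'v \<Rightarrow> real) \<Rightarrow> bool" where
  "generate T M X Y N Z \<longleftrightarrow>
     id_process T M Y \<and> id_process T N Z \<and>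
     prob_space.indep_var M (path_space T) (path_map T X) (path_space T) (path_map T Y) \<and>
     (\<forall>I. finite I \<longrightarrow> I \<noteq> {} \<longrightarrow> I \<subseteq> T \<longrightarrow>
        fin_dim_distr M (\<lambda>t \<omega>. X t \<omega> + Y t \<omega>) I = fin_dim_distr N Z I)"


section \<open>Levy measures on the path space\<close>

definition levy_measure :: "'t set \<Rightarrow> ('t \<Rightarrow> real) measure \<Rightarrow> bool" where
  "levy_measure T \<nu> \<longleftrightarrow>
     sets \<nu> = sets (path_space T) \<and>
     (\<forall>t\<in>T. (\<integral>\<^sup>+x. ennreal (min (\<bar>x t\<bar>\<^sup>2) 1) \<partial>\<nu>) < \<infinity>) \<and>
     (\<forall>A\<in>sets (path_space T). emeasure \<nu> A = inner_measure \<nu> (A - {origin T}))"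

definition id_generating_triplet ::
  "(real \<Rightarrow> real) \<Rightarrow> 't set \<Rightarrow> 'w measure \<Rightarrow> ('t \<Rightarrow> 'w \<Rightarrow> real) \<Rightarrow>
     ('t \<times> 't \<Rightarrow> real) \<Rightarrow> ('t \<Rightarrow> real) measure \<Rightarrow> ('t \<Rightarrow> real) \<Rightarrow> bool" where
  "id_generating_triplet chi T M X S \<nu> b \<longleftrightarrow>
     nonneg_definite_on T S \<and> levy_measure T \<nu> \<and>
     (\<forall>I \<theta>. finite I \<longrightarrow> I \<noteq> {} \<longrightarrow> I \<subseteq> T \<longrightarrow>
        (CLINT \<omega>|M. iexp (inner_prod_on I \<theta> (\<lambda>t. X t \<omega>))) =
          exp (lk_exponent chi I S (\<lambda>g. CLINT x|\<nu>. g x) b \<theta>))"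

definition has_finite_levy_measure ::
  "(real \<Rightarrow> real) \<Rightarrow> 't set \<Rightarrow> 'w measure \<Rightarrow> ('t \<Rightarrow> 'w \<Rightarrow> real) \<Rightarrow> bool" where
  "has_finite_levy_measure chi T M X \<longleftrightarrow>
     (\<exists>S \<nu> b. id_generating_triplet chi T M X S \<nu> b \<and> emeasure \<nu> (space \<nu>) < \<infinity>)"


section \<open>Signed measures and quasi-Levy type measures on the path space\<close>

text \<open>
  Signed measures are extended real valued and attain at most one of the two infinite values. They
  are set to zero outside the sigma-algebra, so that equality of signed measures on the
  sigma-algebra is equality of functions.
\<close>

definition signed_measure :: "'a measure \<Rightarrow> ('a set \<Rightarrow> ereal) \<Rightarrow> bool" where
  "signed_measure M \<nu> \<longleftrightarrow>
     \<nu> {} = 0 \<and> (\<forall>A. A \<notin> sets M \<longrightarrow> \<nu> A = 0) \<and>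
     ((\<forall>A\<in>sets M. \<nu> A \<noteq> \<infinity>) \<or> (\<forall>A\<in>sets M. \<nu> A \<noteq> -\<infinity>)) \<and>
     (\<forall>A :: nat \<Rightarrow> 'a set. range A \<subseteq> sets M \<longrightarrow> disjoint_family A \<longrightarrow>
        (\<lambda>n. \<nu> (A n)) sums \<nu> (\<Union>n. A n))"

definition jordan_decomposition ::
  "'a measure \<Rightarrow> ('a set \<Rightarrow> ereal) \<Rightarrow> 'a measure \<Rightarrow> 'a measure \<Rightarrow> bool" where
  "jordan_decomposition M \<nu> p n \<longleftrightarrow>
     sets p = sets M \<and> sets n = sets M \<and> (finite_measure p \<or> finite_measure n) \<and>
     (\<exists>P\<in>sets M. emeasure n P = 0 \<and> emeasure p (space M - P) = 0) \<and>
     (\<forall>A\<in>sets M. \<nu> A = enn2ereal (emeasure p A) - enn2ereal (emeasure n A))"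

definition jordan_pos :: "'a measure \<Rightarrow> ('a set \<Rightarrow> ereal) \<Rightarrow> 'a measure" where
  "jordan_pos M \<nu> = (THE p. \<exists>n. jordan_decomposition M \<nu> p n)"

definition jordan_neg :: "'a measure \<Rightarrow> ('a set \<Rightarrow> ereal) \<Rightarrow> 'a measure" where
  "jordan_neg M \<nu> = (THE n. \<exists>p. jordan_decomposition M \<nu> p n)"

text \<open>The following lemmas show that the two definite descriptions are well defined.\<close>

lemma jordan_decomposition_pos_SUP:
  assumes J: "jordan_decomposition M \<nu> p n" and A: "A \<in> sets M"
  shows "emeasure p A = (SUP B\<in>{B \<in> sets M. B \<subseteq> A}. e2ennreal (\<nu> B))"
proof -
  have sp: "sets p = sets M" and sn: "sets n = sets M"
    and eq: "\<And>B. B \<in> sets M \<Longrightarrow> \<nu> B = enn2ereal (emeasure p B) - enn2ereal (emeasure n B)"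
    using J by (auto simp: jordan_decomposition_def)
  obtain P where P: "P \<in> sets M" "emeasure n P = 0" "emeasure p (space M - P) = 0"
    using J by (auto simp: jordan_decomposition_def)
  show ?thesis
  proof (rule antisym)
    have "emeasure p A \<le> emeasure p ((A \<inter> P) \<union> (space M - P))"
      using A P(1) sets.sets_into_space[OF A] by (intro emeasure_mono) (auto simp: sp)
    also have "\<dots> \<le> emeasure p (A \<inter> P) + emeasure p (space M - P)"
      using A P(1) by (intro emeasure_subadditive) (auto simp: sp)
    finally have 1: "emeasure p A \<le> emeasure p (A \<inter> P)"
      using P(3) by simp
    have "emeasure n (A \<inter> P) \<le> emeasure n P"
      using A P(1) by (intro emeasure_mono) (auto simp: sn)
    hence "emeasure n (A \<inter> P) = 0"
      using P(2) by simp
    hence "e2ennreal (\<nu> (A \<inter> P)) = emeasure p (A \<inter> P)"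
      using A P(1) by (simp add: eq zero_ennreal.rep_eq)
    moreover have "e2ennreal (\<nu> (A \<inter> P)) \<le> (SUP B\<in>{B \<in> sets M. B \<subseteq> A}. e2ennreal (\<nu> B))"
      using A P(1) by (intro SUP_upper) auto
    ultimately show "emeasure p A \<le> (SUP B\<in>{B \<in> sets M. B \<subseteq> A}. e2ennreal (\<nu> B))"
      using 1 by simp
  next
    show "(SUP B\<in>{B \<in> sets M. B \<subseteq> A}. e2ennreal (\<nu> B)) \<le> emeasure p A"
    proof (rule SUP_least)
      fix B assume B: "B \<in> {B \<in> sets M. B \<subseteq> A}"
      have "\<nu> B \<le> enn2ereal (emeasure p B)"
        using B by (simp add: eq ereal_diff_le_self)
      hence "e2ennreal (\<nu> B) \<le> emeasure p B"
        using e2ennreal_mono by fastforce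
      also have "\<dots> \<le> emeasure p A"
        using A B by (intro emeasure_mono) (auto simp: sp)
      finally show "e2ennreal (\<nu> B) \<le> emeasure p A" .
    qed
  qed
qed

lemma jordan_decomposition_uminus:
  assumes J: "jordan_decomposition M \<nu> p n"
  shows "jordan_decomposition M (\<lambda>A. - \<nu> A) n p"
proof -
  obtain P where P: "P \<in> sets M" "emeasure n P = 0" "emeasure p (space M - P) = 0"
    using J by (auto simp: jordan_decomposition_def)
  have "space M - (space M - P) = P"
    using sets.sets_into_space[OF P(1)] by blast
  hence ex: "\<exists>Q\<in>sets M. emeasure p Q = 0 \<and> emeasure n (space M - Q) = 0"
    using P by (intro bexI[of _ "space M - P"]) auto
  have "- \<nu> A = enn2ereal (emeasure n A) - enn2ereal (emeasure p A)" if A: "A \<in> sets M" for A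
  proof -
    have eq: "\<nu> A = enn2ereal (emeasure p A) - enn2ereal (emeasure n A)"
      using J A by (auto simp: jordan_decomposition_def)
    have "emeasure p A \<noteq> \<infinity> \<or> emeasure n A \<noteq> \<infinity>"
      using J by (auto simp: jordan_decomposition_def dest: finite_measure.emeasure_finite)
    thus ?thesis
      unfolding eq by (cases "emeasure p A"; cases "emeasure n A") auto
  qed
  with ex J show ?thesis
    by (auto simp: jordan_decomposition_def)
qed

lemma jordan_decomposition_unique:
  assumes "jordan_decomposition M \<nu> p n" and "jordan_decomposition M \<nu> p' n'"
  shows "p = p'" and "n = n'"
proof -
  have pos: "q = q'" if "jordan_decomposition M \<mu> q m" and "jordan_decomposition M \<mu> q' m'"
    for \<mu> q m q' m'
  proof (rule measure_eqI)
    show "sets q = sets q'"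
      using that by (simp add: jordan_decomposition_def)
    fix A assume "A \<in> sets q"
    hence "A \<in> sets M"
      using that by (simp add: jordan_decomposition_def)
    thus "emeasure q A = emeasure q' A"
      using that[THEN jordan_decomposition_pos_SUP] by simp
  qed
  show "p = p'"
    using pos assms by blast
  show "n = n'"
    using pos assms[THEN jordan_decomposition_uminus] by blast
qed

lemma jordan_decomposition_imp_eq:
  assumes "jordan_decomposition M \<nu> p n"
  shows "jordan_pos M \<nu> = p" and "jordan_neg M \<nu> = n"
  unfolding jordan_pos_def jordan_neg_def
  using assms jordan_decomposition_unique by (blast intro: the_equality)+

definition total_variation :: "'a measure \<Rightarrow> ('a set \<Rightarrow> ereal) \<Rightarrow> 'a measure" where
  "total_variation M \<nu> = measure_of (space M) (sets M)
     (\<lambda>A. emeasure (jordan_pos M \<nu>) A + emeasure (jordan_neg M \<nu>) A)"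

definition signed_integral ::
  "'a measure \<Rightarrow> ('a set \<Rightarrow> ereal) \<Rightarrow> ('a \<Rightarrow> complex) \<Rightarrow> complex" where
  "signed_integral M \<nu> g =
     (CLINT x|jordan_pos M \<nu>. g x) - (CLINT x|jordan_neg M \<nu>. g x)"

text \<open>
  The existence of the Jordan decomposition, which holds for every signed measure, is made an
  explicit conjunct so that \<^const>\<open>jordan_pos\<close> and \<^const>\<open>jordan_neg\<close> are visibly meaningful.
\<close>

definition quasi_levy_type_measure :: "'t set \<Rightarrow> (('t \<Rightarrow> real) set \<Rightarrow> ereal) \<Rightarrow> bool" where
  "quasi_levy_type_measure T \<nu> \<longleftrightarrow>
     signed_measure (path_space T) \<nu> \<and>
     (\<exists>p n. jordan_decomposition (path_space T) \<nu> p n) \<and>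
     (\<forall>t\<in>T. (\<integral>\<^sup>+x. ennreal (min (\<bar>x t\<bar>\<^sup>2) 1) \<partial>(total_variation (path_space T) \<nu>)) < \<infinity>) \<and>
     (\<forall>A\<in>sets (path_space T).
        emeasure (total_variation (path_space T) \<nu>) A =
          inner_measure (jordan_pos (path_space T) \<nu>) (A - {origin T}) +
          inner_measure (jordan_neg (path_space T) \<nu>) (A - {origin T}))"

end

theory Submission
  imports Defs
begin

text \<open>
  Everything rests on one positivity principle: trigonometric polynomials \<open>q\<close> are dense in \<open>L\<^sup>2\<close> of a finite
  measure, and \<open>\<integral> \<bar>q\<bar>\<^sup>2 \<partial>\<mu>\<close> is a finite combination of values of the characteristic function, so an
  inequality between these quadratic forms is an inequality between measures. Writing
  \<open>D\<^sub>h \<psi> \<theta> = 2 \<psi> \<theta> - \<psi> (\<theta> + h) - \<psi> (\<theta> - h)\<close>, the function \<open>D\<^sub>h (D\<^sub>h \<psi>)\<close> of a Levy--Khintchine exponent \<open>\<psi>\<close> no longer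
  contains drift and Gaussian part and is the characteristic function of the finite signed measure
  \<open>4 (1 - cos \<langle>h, x\<rangle>)\<^sup>2 \<nu>(dx)\<close>. This gives uniqueness of \<open>\<nu>\<close> off the origin, and, since \<open>D\<^sub>h (D\<^sub>h \<psi>)\<close> is a limit
  of positive definite functions when \<open>exp \<psi>\<close> is infinitely divisible, nonnegativity of \<open>\<nu>\<close> in that case.

  Of the two generating processes one has a finite Levy measure by assumption. The finite-dimensional
  exponents of the other one are differences or sums of known exponents, hence come from Levy measures by
  nonnegativity. Weighted by \<open>\<Sum>t\<in>I. min (x\<^sub>t\<^sup>2) 1\<close> these become consistent families of finite measures, to which
  Kolmogorov's theorem applies; the supremum of the unweighted extensions over finite \<open>I\<close> is a Levy measure
  on path space. The required \<open>\<nu>\<close> is the difference of the two Levy measures. The finite one is carried by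
  the paths not vanishing on some countable set \<open>C\<close>, where the other one is \<open>\<sigma>\<close>-finite, so that the
  Radon--Nikodym theorem yields the Jordan decomposition.
\<close>

section \<open>Sums of measures and mutually singular parts\<close>

text \<open>Two obstacles shape the proof. For uncountable \<open>T\<close> the set
  \<open>{origin T}\<close> is not measurable and a Levy measure on path space need not be
  \<sigma>-finite. The complement of the origin is therefore replaced by the sets of paths that do
  not vanish identically on a countable set of coordinates, where \<sigma>-finiteness holds.
  Moreover all measures may be infinite, so an equality of differences is kept in the additive form
  \<open>p + n' = p' + n\<close>; finiteness of one generating Levy measure is what excludes
  infinity minus infinity when a signed measure is finally formed. Second differences are natural
  because characters are their eigenvectors. A single one leaves a constant from the Gaussian part,
  indistinguishable from a point mass at the origin; hence the iteration. The weight vanishes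
  wherever \<langle>h, x\<rangle> is a multiple of 2\<pi>, so many \<open>h\<close> are used to
  reach every nonzero point. Exponents are recovered from characteristic functions by continuity
  along rays. The Gaussian part of \<open>X\<close> is a difference of nonnegative definite
  functions; that it is nonnegative definite itself comes from the characteristic function of
  \<open>X\<close> being bounded by 1.\<close>

definition add_measure :: "'a measure \<Rightarrow> 'a measure \<Rightarrow> 'a measure" where
  "add_measure M N = measure_of (space M) (sets M) (\<lambda>A. emeasure M A + emeasure N A)"

lemma sets_add_measure [simp, measurable_cong]: "sets (add_measure M N) = sets M"
  by (simp add: add_measure_def)

lemma space_add_measure [simp]: "space (add_measure M N) = space M"
  by (simp add: add_measure_def)

lemma emeasure_add_measure:
  assumes "sets N = sets M"
  shows "emeasure (add_measure M N) A = emeasure M A + emeasure N A"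
proof (cases "A \<in> sets M")
  case True
  show ?thesis
    unfolding add_measure_def
  proof (rule emeasure_measure_of_sigma)
    show "sigma_algebra (space M) (sets M)" ..
    show "positive (sets M) (\<lambda>A. emeasure M A + emeasure N A)"
      by (simp add: positive_def)
    show "countably_additive (sets M) (\<lambda>A. emeasure M A + emeasure N A)"
    proof (rule countably_additiveI)
      fix A :: "nat \<Rightarrow> _"
      assume "range A \<subseteq> sets M" and "disjoint_family A"
      then show "(\<Sum>i. emeasure M (A i) + emeasure N (A i)) = emeasure M (\<Union>i. A i) + emeasure N (\<Union>i. A i)"
        using assms by (simp add: suminf_add[symmetric] suminf_emeasure)
    qed
  qed (fact True)
next
  case False
  then show ?thesis
    using assms by (simp add: emeasure_notin_sets)
qed

lemma nn_integral_add_measure: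
  assumes sets: "sets N = sets M" and f: "f \<in> borel_measurable M"
  shows "(\<integral>\<^sup>+x. f x \<partial>add_measure M N) = (\<integral>\<^sup>+x. f x \<partial>M) + (\<integral>\<^sup>+x. f x \<partial>N)"
proof -
  note sp = sets_eq_imp_space_eq[OF sets]
  have *: "g \<in> borel_measurable N \<longleftrightarrow> g \<in> borel_measurable M"
      "g \<in> borel_measurable (add_measure M N) \<longleftrightarrow> g \<in> borel_measurable M"
    for g :: "_ \<Rightarrow> ennreal"
    using sets by (auto cong: measurable_cong_sets)
  show ?thesis
    using f
  proof induct
    case (cong f g)
    then show ?case
      using sp by (metis (no_types, lifting) nn_integral_cong space_add_measure)
  next
    case (set A)
    then show ?case
      using sets by (simp add: emeasure_add_measure)
  next
    case (mult u c)
    then show ?case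
      by (simp add: * nn_integral_cmult distrib_left)
  next
    case (add u v)
    then show ?case
      by (simp add: * nn_integral_add algebra_simps)
  next
    case (seq U)
    from seq have U: "\<And>i. U i \<in> borel_measurable M" by simp
    have "(\<integral>\<^sup>+x. (SUP i. U i) x \<partial>add_measure M N) = (SUP i. \<integral>\<^sup>+x. U i x \<partial>add_measure M N)"
      unfolding SUP_apply using seq by (intro nn_integral_monotone_convergence_SUP) (auto simp: *)
    also have "\<dots> = (SUP i. integral\<^sup>N M (U i) + integral\<^sup>N N (U i))"
      using seq by simp
    also have "\<dots> = (SUP i. integral\<^sup>N M (U i)) + (SUP i. integral\<^sup>N N (U i))"
      using seq(4) by (intro ennreal_SUP_add) (auto simp: incseq_def le_fun_def intro!: nn_integral_mono)
    also have "\<dots> = (\<integral>\<^sup>+x. (SUP i. U i) x \<partial>M) + (\<integral>\<^sup>+x. (SUP i. U i) x \<partial>N)"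
      unfolding SUP_apply using seq U
      by (subst (1 2) nn_integral_monotone_convergence_SUP) (auto simp: *)
    finally show ?case by simp
  qed
qed

lemma integrable_add_measure_iff:
  fixes f :: "'a \<Rightarrow> 'b :: {banach, second_countable_topology}"
  assumes sets: "sets N = sets M"
  shows "integrable (add_measure M N) f \<longleftrightarrow> integrable M f \<and> integrable N f"
proof -
  have *: "f \<in> borel_measurable N \<longleftrightarrow> f \<in> borel_measurable M"
      "f \<in> borel_measurable (add_measure M N) \<longleftrightarrow> f \<in> borel_measurable M"
    using sets by (auto cong: measurable_cong_sets)
  show ?thesis
    by (auto simp: integrable_iff_bounded * nn_integral_add_measure[OF sets])
qed

lemma integral_add_measure_real:
  fixes f :: "'a \<Rightarrow> real"
  assumes sets: "sets N = sets M" and M: "integrable M f" and N: "integrable N f"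
  shows "(\<integral>x. f x \<partial>add_measure M N) = (\<integral>x. f x \<partial>M) + (\<integral>x. f x \<partial>N)"
proof -
  have "integrable (add_measure M N) f"
    using assms by (simp add: integrable_add_measure_iff)
  moreover have "f \<in> borel_measurable M"
    using M by simp
  moreover have "(\<integral>\<^sup>+x. ennreal (f x) \<partial>M) < \<infinity>" "(\<integral>\<^sup>+x. ennreal (f x) \<partial>N) < \<infinity>"
    "(\<integral>\<^sup>+x. ennreal (- f x) \<partial>M) < \<infinity>" "(\<integral>\<^sup>+x. ennreal (- f x) \<partial>N) < \<infinity>"
    using real_integrable_def M N by (auto simp: real_integrable_def top.not_eq_extremum)
  ultimately show ?thesis
    using M N by (simp add: real_lebesgue_integral_def nn_integral_add_measure[OF sets] enn2real_plus)
qed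

lemma integral_add_measure:
  fixes f :: "'a \<Rightarrow> complex"
  assumes sets: "sets N = sets M" and M: "integrable M f" and N: "integrable N f"
  shows "(\<integral>x. f x \<partial>add_measure M N) = (\<integral>x. f x \<partial>M) + (\<integral>x. f x \<partial>N)"
proof -
  have "integrable (add_measure M N) f"
    using assms by (simp add: integrable_add_measure_iff)
  then show ?thesis
    using M N integral_add_measure_real[OF sets, of "\<lambda>x. Re (f x)"] 
      integral_add_measure_real[OF sets, of "\<lambda>x. Im (f x)"]
    by (intro complex_eqI) (simp_all flip: integral_Re integral_Im)
qed

lemma finite_measure_add_measure:
  assumes "sets N = sets M" "finite_measure M" "finite_measure N"
  shows "finite_measure (add_measure M N)"
proof -
  have "space N = space M"
    using assms(1) by (rule sets_eq_imp_space_eq)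
  moreover have "emeasure M (space M) \<noteq> \<infinity>" "emeasure N (space N) \<noteq> \<infinity>"
    using assms by (auto dest: finite_measure.emeasure_finite)
  ultimately show ?thesis
    by (intro finite_measureI) (auto simp: emeasure_add_measure[OF assms(1)])
qed

text \<open>The shape of the Lebesgue decomposition that yields the Jordan decomposition of \<open>\<mu>\<^sub>1 - \<mu>\<^sub>2\<close>
  on \<open>E\<close>, stated additively because both measures may be infinite there.\<close>

lemma mutually_singular_decomposition:
  fixes E :: "nat \<Rightarrow> 'a set"
  assumes sets [measurable_cong]: "sets \<mu>2 = sets \<mu>1"
    and E [measurable]: "\<And>k. E k \<in> sets \<mu>1"
    and fin: "\<And>k. emeasure \<mu>1 (E k) < \<infinity>" "\<And>k. emeasure \<mu>2 (E k) < \<infinity>"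
  obtains p n P where "sets p = sets \<mu>1" "sets n = sets \<mu>1" "P \<in> sets \<mu>1" "P \<subseteq> (\<Union>k. E k)"
    "emeasure n P = 0" "emeasure p (space \<mu>1 - P) = 0" "emeasure n (space \<mu>1 - (\<Union>k. E k)) = 0"
    "\<And>A. A \<in> sets \<mu>1 \<Longrightarrow>
       emeasure \<mu>1 (A \<inter> (\<Union>k. E k)) + emeasure n A = emeasure \<mu>2 (A \<inter> (\<Union>k. E k)) + emeasure p A"
    "\<And>A. A \<in> sets \<mu>1 \<Longrightarrow> emeasure p A \<le> emeasure \<mu>1 (A \<inter> (\<Union>k. E k))"
    "\<And>A. A \<in> sets \<mu>1 \<Longrightarrow> emeasure n A \<le> emeasure \<mu>2 (A \<inter> (\<Union>k. E k))"
proof -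
  define U where "U = (\<Union>k. E k)"
  have U [measurable]: "U \<in> sets \<mu>1" by (auto simp: U_def)
  have U2 [measurable]: "U \<in> sets \<mu>2" using U sets by simp
  note sp = sets_eq_imp_space_eq[OF sets]
  \<comment> \<open>Off \<open>U\<close> neither measure has to be \<sigma>-finite, so both are cut
    down to \<open>U\<close>. Their sum \<open>\<mu>\<close> is \<sigma>-finite and dominates
    both.\<close>
  define m1 where "m1 = density \<mu>1 (indicator U)"
  define m2 where "m2 = density \<mu>2 (indicator U)"
  define \<mu> where "\<mu> = add_measure m1 m2"
  have s12: "sets m2 = sets m1" and s1 [measurable_cong]: "sets m1 = sets \<mu>1"
    and s [measurable_cong]: "sets \<mu> = sets \<mu>1"
    by (auto simp: m1_def m2_def sets \<mu>_def)
  have e1: "emeasure m1 A = emeasure \<mu>1 (A \<inter> U)" if "A \<in> sets \<mu>1" for A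
    using that U by (simp add: m1_def emeasure_density flip: indicator_inter_arith)
      (simp add: Int_commute)
  have e2: "emeasure m2 A = emeasure \<mu>2 (A \<inter> U)" if "A \<in> sets \<mu>1" for A
    using that U2 sets by (simp add: m2_def emeasure_density flip: indicator_inter_arith)
      (simp add: Int_commute)
  have e: "emeasure \<mu> A = emeasure m1 A + emeasure m2 A" for A
    unfolding \<mu>_def by (rule emeasure_add_measure[OF s12])
  interpret \<mu>: sigma_finite_measure \<mu>
  proof
    \<comment> \<open>The sets \<open>E k\<close> are supplemented by the complement of
      \<open>U\<close>, a null set for both cut-down measures.\<close>
    show "\<exists>A. countable A \<and> A \<subseteq> sets \<mu> \<and> \<Union> A = space \<mu> \<and> (\<forall>a\<in>A. emeasure \<mu> a \<noteq> \<infinity>)"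
    proof (intro exI[of _ "insert (space \<mu>1 - U) (range E)"] conjI ballI)
      show "\<Union> (insert (space \<mu>1 - U) (range E)) = space \<mu>"
        using sets.sets_into_space[OF E] sets_eq_imp_space_eq[OF s] by (auto simp: U_def)
      fix a assume a: "a \<in> insert (space \<mu>1 - U) (range E)"
      then consider "a = space \<mu>1 - U" | k where "a = E k" by auto
      then show "emeasure \<mu> a \<noteq> \<infinity>"
      proof cases
        case 1
        then have "a \<inter> U = {}" by auto
        then show ?thesis using 1 by (simp add: e e1 e2)
      next
        case 2
        then have "a \<inter> U = E k" by (auto simp: U_def)
        then show ?thesis using 2 fin[of k] by (simp add: e e1 e2 less_top)
      qed
    qed (auto simp: s)
  qed
  have "absolutely_continuous \<mu> m1" "absolutely_continuous \<mu> m2"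
    using s s1 s12 by (auto simp: absolutely_continuous_def null_sets_def e)
  then obtain f g where f [measurable]: "f \<in> borel_measurable \<mu>" "density \<mu> f = m1"
    and g [measurable]: "g \<in> borel_measurable \<mu>" "density \<mu> g = m2"
    using \<mu>.Radon_Nikodym[of m1] \<mu>.Radon_Nikodym[of m2] s s1 s12 by metis
  \<comment> \<open>Positive and negative part of \<open>f - g\<close> as densities; the strict
    inequalities make them live on disjoint sets.\<close>
  define p where "p = density \<mu> (\<lambda>x. if g x < f x then f x - g x else 0)"
  define n where "n = density \<mu> (\<lambda>x. if f x < g x then g x - f x else 0)"
  \<comment> \<open>The intersection with \<open>U\<close> enforces \<open>P \<subseteq> U\<close>
    and loses no mass, because \<open>\<mu>\<close> is null outside \<open>U\<close>.\<close>
  define P where "P = {x\<in>space \<mu>. g x < f x} \<inter> U"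
  have "{x\<in>space \<mu>. g x < f x} \<in> sets \<mu>" by measurable
  then have "{x\<in>space \<mu>. g x < f x} \<in> sets \<mu>1" unfolding s .
  then have P [measurable]: "P \<in> sets \<mu>1" unfolding P_def by (rule sets.Int[OF _ U])
  have sp\<mu>: "space \<mu> = space \<mu>1" using s by (rule sets_eq_imp_space_eq)
  have d1: "emeasure m1 A = (\<integral>\<^sup>+x. f x * indicator A x \<partial>\<mu>)" if "A \<in> sets \<mu>1" for A
    using that by (simp flip: f(2) add: emeasure_density)
  have d2: "emeasure m2 A = (\<integral>\<^sup>+x. g x * indicator A x \<partial>\<mu>)" if "A \<in> sets \<mu>1" for A
    using that by (simp flip: g(2) add: emeasure_density)
  have dp: "emeasure p A = (\<integral>\<^sup>+x. (if g x < f x then f x - g x else 0) * indicator A x \<partial>\<mu>)" if "A \<in> sets \<mu>1" for A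
    using that by (simp add: p_def emeasure_density)
  have dn: "emeasure n A = (\<integral>\<^sup>+x. (if f x < g x then g x - f x else 0) * indicator A x \<partial>\<mu>)" if "A \<in> sets \<mu>1" for A
    using that by (simp add: n_def emeasure_density)
  have leU: "emeasure p A \<le> emeasure \<mu>1 (A \<inter> U)" "emeasure n A \<le> emeasure \<mu>2 (A \<inter> U)"
    if A: "A \<in> sets \<mu>1" for A
    using A by (auto simp: dp dn e1[symmetric] e2[symmetric] d1 d2 intro!: nn_integral_mono mult_right_mono 
      diff_le_self_ennreal)
  have \<mu>U: "emeasure \<mu> (space \<mu>1 - U) = 0"
    by (simp add: e e1 e2 Int_Diff) (simp add: Diff_Int_distrib2 flip: Int_Diff)
  show ?thesis
  proof (rule that[of p n P, folded U_def])
    show "P \<in> sets \<mu>1" by (fact P)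
    show "sets p = sets \<mu>1" "sets n = sets \<mu>1" "P \<subseteq> U"
      by (auto simp: p_def n_def s P_def)
    have "emeasure n P = (\<integral>\<^sup>+x. 0 \<partial>\<mu>)"
      unfolding dn[OF P] by (intro nn_integral_cong) (auto simp: P_def indicator_def)
    then show "emeasure n P = 0" by simp
    have "emeasure p (space \<mu>1 - P) = (\<integral>\<^sup>+x. 0 \<partial>\<mu>)"
      unfolding dp[OF sets.compl_sets[OF P]]
    proof (rule nn_integral_cong_AE)
      have "AE x in \<mu>. x \<in> U"
        using \<mu>U by (intro AE_I[of _ _ "space \<mu>1 - U"]) (auto simp: sp\<mu> s)
      then show "AE x in \<mu>. (if g x < f x then f x - g x else 0) * indicator (space \<mu>1 - P) x = 0"
        by eventually_elim (auto simp: P_def sp\<mu> indicator_def)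
    qed
    then show "emeasure p (space \<mu>1 - P) = 0" by simp
    show "emeasure n (space \<mu>1 - U) = 0"
      using leU(2)[of "space \<mu>1 - U"] by (simp add: Int_Diff) (simp add: Diff_Int_distrib2 flip: Int_Diff)
    show "emeasure \<mu>1 (A \<inter> U) + emeasure n A = emeasure \<mu>2 (A \<inter> U) + emeasure p A"
      if A [measurable]: "A \<in> sets \<mu>1" for A
    proof -
      \<comment> \<open>Both sides equal \<open>max a b\<close>. In this additive form the identity
        survives infinite values.\<close>
      have *: "a + (if a < b then b - a else 0) = b + (if b < a then a - b else 0)" for a b :: ennreal
      proof (cases a b rule: linorder_cases)
        case less
        then have "\<not> b < a" and "a + (b - a) = b"
          by (auto intro: add_diff_inverse_ennreal)
        with less show ?thesis by (simp only: if_True if_False add_0_right)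
      next
        case greater
        then have "\<not> a < b" and "b + (a - b) = a"
          by (auto intro: add_diff_inverse_ennreal)
        with greater show ?thesis by (simp only: if_True if_False add_0_right)
      qed simp
      have "emeasure \<mu>1 (A \<inter> U) + emeasure n A = (\<integral>\<^sup>+x. (f x + (if f x < g x then g x - f x else 0)) * indicator A x \<partial>\<mu>)"
        by (simp add: e1[symmetric] d1 dn distrib_right nn_integral_add A)
      also have "\<dots> = (\<integral>\<^sup>+x. (g x + (if g x < f x then f x - g x else 0)) * indicator A x \<partial>\<mu>)"
        by (simp add: *)
      also have "\<dots> = emeasure \<mu>2 (A \<inter> U) + emeasure p A"
        by (simp add: e2[symmetric] d2 dp distrib_right nn_integral_add A)
      finally show ?thesis .
    qed
  qed (auto simp: leU)
qed

text \<open>Disjointing the cover cuts \<open>A\<close> into countably many pieces, each inside a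
  single \<open>E k\<close>; countable additivity sums the equal masses.\<close>

lemma emeasure_eq_on_cover:
  fixes E :: "nat \<Rightarrow> 'a set"
  assumes sets: "sets \<mu>2 = sets \<mu>1"
    and E: "\<And>k. E k \<in> sets \<mu>1"
    and eq: "\<And>A k. A \<in> sets \<mu>1 \<Longrightarrow> A \<subseteq> E k \<Longrightarrow> emeasure \<mu>1 A = emeasure \<mu>2 A"
    and A: "A \<in> sets \<mu>1" "A \<subseteq> (\<Union>k. E k)"
  shows "emeasure \<mu>1 A = emeasure \<mu>2 A"
proof -
  have ran: "range (\<lambda>k. A \<inter> disjointed E k) \<subseteq> sets \<mu>1"
  proof safe
    fix k
    show "A \<inter> disjointed E k \<in> sets \<mu>1"
      using sets.range_disjointed_sets[of E \<mu>1] E A(1) by blast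
  qed
  have dis: "disjoint_family (\<lambda>k. A \<inter> disjointed E k)"
    using disjoint_family_disjointed[of E] by (auto simp: disjoint_family_on_def)
  have un: "(\<Union>k. A \<inter> disjointed E k) = A"
    using A by (simp only: Int_UN_distrib[symmetric] UN_disjointed_eq) auto
  have "emeasure \<mu>1 (A \<inter> disjointed E k) = emeasure \<mu>2 (A \<inter> disjointed E k)" for k
    using ran disjointed_subset[of E k] by (intro eq[of _ k]) auto
  then have "(\<Sum>k. emeasure \<mu>1 (A \<inter> disjointed E k)) = (\<Sum>k. emeasure \<mu>2 (A \<inter> disjointed E k))"
    by simp
  then show ?thesis
    using suminf_emeasure[OF ran dis] suminf_emeasure[OF ran[folded sets] dis] unfolding un by simp
qed

section \<open>Trigonometric polynomials\<close>

lemma inner_prod_on_measurable [measurable]: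
  "I \<subseteq> T \<Longrightarrow> inner_prod_on I \<theta> \<in> borel_measurable (path_space T)"
  unfolding inner_prod_on_def
  by (intro borel_measurable_sum borel_measurable_times borel_measurable_const measurable_component_singleton) auto

text \<open>A list of coefficient-frequency pairs avoids merging equal frequencies: addition is
  \<open>@\<close>, and multiplication by a character is a \<open>map\<close> that shifts the
  frequencies.\<close>

definition trig :: "'t set \<Rightarrow> (complex \<times> ('t \<Rightarrow> real)) list \<Rightarrow> ('t \<Rightarrow> real) \<Rightarrow> complex" where
  "trig I cs x = (\<Sum>(c, \<theta>)\<leftarrow>cs. c * iexp (inner_prod_on I \<theta> x))"

lemma trig_simps [simp]:
  "trig I [] x = 0"
  "trig I ((c, \<theta>) # cs) x = c * iexp (inner_prod_on I \<theta> x) + trig I cs x"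
  "trig I (cs @ ds) x = trig I cs x + trig I ds x"
  by (simp_all add: trig_def)

lemma trig_measurable:
  assumes "I \<subseteq> T"
  shows "trig I cs \<in> borel_measurable (path_space T)"
proof (induction cs)
  case Nil
  then show ?case by simp
next
  case (Cons a cs)
  then show ?case
    using inner_prod_on_measurable[OF assms] by (cases a) simp
qed

lemma trig_bounded: "norm (trig I cs x) \<le> (\<Sum>(c, \<theta>)\<leftarrow>cs. norm c)"
proof (induction cs)
  case (Cons a cs)
  obtain c \<theta> where a: "a = (c, \<theta>)" by (cases a)
  have "norm (c * iexp (inner_prod_on I \<theta> x) + trig I cs x) \<le> norm c + norm (trig I cs x)"
    by (rule order_trans[OF norm_triangle_ineq]) (simp add: norm_mult)
  with Cons show ?case by (simp add: a)
qed simp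

lemma power2_norm_add_le:
  fixes a b :: "'a :: real_normed_vector"
  shows "(norm (a + b))\<^sup>2 \<le> 2 * (norm a)\<^sup>2 + 2 * (norm b)\<^sup>2"
proof -
  have "(norm (a + b))\<^sup>2 \<le> (norm a + norm b)\<^sup>2"
    by (intro power_mono norm_triangle_ineq) simp
  also have "\<dots> \<le> 2 * (norm a)\<^sup>2 + 2 * (norm b)\<^sup>2"
    using zero_le_power2[of "norm a - norm b"] by (simp add: power2_eq_square algebra_simps)
  finally show ?thesis .
qed

text \<open>Squared errors are doubled when two functions are added, so two errors below
  \<open>e\<close> give one below \<open>4 * e\<close>. This is the origin of the tolerances
  \<open>e / 4\<close> below.\<close>

lemma nn_integral_power2_norm_add_le:
  fixes a b :: "'a \<Rightarrow> complex"
  assumes [measurable]: "a \<in> borel_measurable M" "b \<in> borel_measurable M"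
    and a: "(\<integral>\<^sup>+x. ennreal ((norm (a x))\<^sup>2) \<partial>M) < ennreal e"
    and b: "(\<integral>\<^sup>+x. ennreal ((norm (b x))\<^sup>2) \<partial>M) < ennreal e"
    and e: "e > 0"
  shows "(\<integral>\<^sup>+x. ennreal ((norm (a x + b x))\<^sup>2) \<partial>M) < ennreal (4 * e)"
proof -
  have "(\<integral>\<^sup>+x. ennreal ((norm (a x + b x))\<^sup>2) \<partial>M) \<le>
      (\<integral>\<^sup>+x. 2 * ennreal ((norm (a x))\<^sup>2) + 2 * ennreal ((norm (b x))\<^sup>2) \<partial>M)"
  proof (intro nn_integral_mono)
    fix x
    have "ennreal ((norm (a x + b x))\<^sup>2) \<le> ennreal (2 * (norm (a x))\<^sup>2 + 2 * (norm (b x))\<^sup>2)"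
      by (intro ennreal_leI power2_norm_add_le)
    then show "ennreal ((norm (a x + b x))\<^sup>2) \<le> 2 * ennreal ((norm (a x))\<^sup>2) + 2 * ennreal ((norm (b x))\<^sup>2)"
      by (simp add: ennreal_mult)
  qed
  also have "\<dots> = 2 * (\<integral>\<^sup>+x. ennreal ((norm (a x))\<^sup>2) \<partial>M) + 2 * (\<integral>\<^sup>+x. ennreal ((norm (b x))\<^sup>2) \<partial>M)"
    by (simp add: nn_integral_add nn_integral_cmult)
  also have "\<dots> < 2 * ennreal e + 2 * ennreal e"
    using a b by (intro add_strict_mono ennreal_mult_strict_left_mono) auto
  also have "\<dots> = ennreal (4 * e)"
    using e by (simp add: ennreal_mult flip: distrib_right)
  finally show ?thesis .
qed

section \<open>Density of trigonometric polynomials in L2 of a finite measure\<close>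

locale trig_approximation = finite_measure \<mu> for \<mu> :: "('t \<Rightarrow> real) measure" +
  fixes I :: "'t set"
  assumes sets_\<mu> [measurable_cong]: "sets \<mu> = sets (path_space I)" and finite_I: "finite I"
begin

lemma trig_meas [measurable]: "trig I cs \<in> borel_measurable \<mu>"
  using trig_measurable[of I I cs] by (simp cong: measurable_cong_sets[OF sets_\<mu> refl])

lemma iexp_meas [measurable]: "(\<lambda>x. iexp (inner_prod_on I \<theta> x)) \<in> borel_measurable \<mu>"
proof -
  have "trig I [(1, \<theta>)] = (\<lambda>x. iexp (inner_prod_on I \<theta> x))"
    by (auto simp: fun_eq_iff)
  then show ?thesis
    using trig_meas[of "[(1, \<theta>)]"] by simp
qed

text \<open>The bounded functions in the \<open>L\<^sup>2\<close> closure of the trigonometric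
  polynomials. Boundedness is built in because it makes the class closed under products.\<close>

definition approx :: "(('t \<Rightarrow> real) \<Rightarrow> complex) \<Rightarrow> bool" where
  "approx f \<longleftrightarrow> f \<in> borel_measurable \<mu> \<and> (\<exists>K. \<forall>x. norm (f x) \<le> K) \<and>
     (\<forall>e>0. \<exists>cs. (\<integral>\<^sup>+x. ennreal ((norm (f x - trig I cs x))\<^sup>2) \<partial>\<mu>) < ennreal e)"

lemma approx_measurable: "approx f \<Longrightarrow> f \<in> borel_measurable \<mu>"
  by (simp add: approx_def)

lemma approx_bounded:
  assumes "approx f"
  obtains K where "K \<ge> 0" "\<And>x. norm (f x) \<le> K"
proof -
  obtain K where K: "norm (f x) \<le> K" for x
    using assms unfolding approx_def by auto
  with norm_ge_zero[of "f undefined"] have "K \<ge> 0"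
    by (rule order_trans)
  with K show ?thesis by (rule that[rotated])
qed

lemma approx_error:
  assumes "approx f" "e > 0"
  obtains cs where "(\<integral>\<^sup>+x. ennreal ((norm (f x - trig I cs x))\<^sup>2) \<partial>\<mu>) < ennreal e"
  using assms unfolding approx_def by blast

lemma approxI:
  assumes "f \<in> borel_measurable \<mu>" "\<And>x. norm (f x) \<le> K"
    and "\<And>e. e > 0 \<Longrightarrow> \<exists>cs. (\<integral>\<^sup>+x. ennreal ((norm (f x - trig I cs x))\<^sup>2) \<partial>\<mu>) < ennreal e"
  shows "approx f"
  using assms unfolding approx_def by blast

lemma approx_trig: "approx (trig I cs)"
  by (rule approxI[OF trig_meas trig_bounded]) (auto intro!: exI[of _ cs])

lemma approx_add:
  assumes f: "approx f" and g: "approx g"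
  shows "approx (\<lambda>x. f x + g x)"
proof -
  note [measurable] = f[THEN approx_measurable] g[THEN approx_measurable]
  obtain K L where K: "\<And>x. norm (f x) \<le> K" and L: "\<And>x. norm (g x) \<le> L"
    using approx_bounded f g by metis
  show ?thesis
  proof (rule approxI[where K = "K + L"])
    show "norm (f x + g x) \<le> K + L" for x
      using K[of x] L[of x] norm_triangle_ineq[of "f x" "g x"] by linarith
    fix e :: real assume "e > 0"
    then have e: "e / 4 > 0" by simp
    obtain cs where cs: "(\<integral>\<^sup>+x. ennreal ((norm (f x - trig I cs x))\<^sup>2) \<partial>\<mu>) < ennreal (e / 4)"
      by (rule approx_error[OF f e])
    obtain ds where ds: "(\<integral>\<^sup>+x. ennreal ((norm (g x - trig I ds x))\<^sup>2) \<partial>\<mu>) < ennreal (e / 4)"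
      by (rule approx_error[OF g e])
    have "(\<integral>\<^sup>+x. ennreal ((norm ((f x - trig I cs x) + (g x - trig I ds x)))\<^sup>2) \<partial>\<mu>) < ennreal (4 * (e / 4))"
      by (rule nn_integral_power2_norm_add_le[OF _ _ cs ds e]) measurable
    then show "\<exists>cs. (\<integral>\<^sup>+x. ennreal ((norm (f x + g x - trig I cs x))\<^sup>2) \<partial>\<mu>) < ennreal e"
      by (intro exI[of _ "cs @ ds"]) (simp add: add_diff_add)
  qed simp
qed

lemma approx_mult_iexp:
  assumes f: "approx f"
  shows "approx (\<lambda>x. c * iexp (inner_prod_on I \<theta> x) * f x)"
proof -
  note [measurable] = f[THEN approx_measurable]
  obtain K where K: "K \<ge> 0" "\<And>x. norm (f x) \<le> K"
    using approx_bounded[OF f] by metis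
  show ?thesis
  proof (rule approxI[where K = "norm c * K"])
    show "norm (c * iexp (inner_prod_on I \<theta> x) * f x) \<le> norm c * K" for x
      using K by (simp add: norm_mult mult_left_mono)
    fix e :: real assume e: "e > 0"
    \<comment> \<open>The summand 1 keeps the division by \<open>N\<close> meaningful for
      \<open>c = 0\<close>.\<close>
    define N where "N = (norm c)\<^sup>2 + 1"
    have N: "N > 0" by (simp add: N_def add_nonneg_pos)
    then obtain cs where cs: "(\<integral>\<^sup>+x. ennreal ((norm (f x - trig I cs x))\<^sup>2) \<partial>\<mu>) < ennreal (e / N)"
      using approx_error[OF f, of "e / N"] e by auto
    define ds where "ds = map (\<lambda>(d, \<eta>). (c * d, \<lambda>t. \<theta> t + \<eta> t)) cs"
    have ds: "trig I ds x = c * iexp (inner_prod_on I \<theta> x) * trig I cs x" for x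
    proof -
      have "inner_prod_on I (\<lambda>t. \<theta> t + \<eta> t) x = inner_prod_on I \<theta> x + inner_prod_on I \<eta> x" for \<eta>
        by (simp add: inner_prod_on_def distrib_right sum.distrib)
      then show ?thesis
        unfolding ds_def by (induction cs) (auto simp: algebra_simps exp_add)
    qed
    have "(\<integral>\<^sup>+x. ennreal ((norm (c * iexp (inner_prod_on I \<theta> x) * f x - trig I ds x))\<^sup>2) \<partial>\<mu>)
        \<le> (\<integral>\<^sup>+x. ennreal N * ennreal ((norm (f x - trig I cs x))\<^sup>2) \<partial>\<mu>)"
    proof (intro nn_integral_mono)
      fix x
      have "(norm (c * iexp (inner_prod_on I \<theta> x) * f x - trig I ds x))\<^sup>2 = (norm c)\<^sup>2 * (norm (f x - trig I cs x))\<^sup>2"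
        by (simp add: ds norm_mult power_mult_distrib flip: right_diff_distrib)
      also have "\<dots> \<le> N * (norm (f x - trig I cs x))\<^sup>2"
        by (intro mult_right_mono) (auto simp: N_def)
      finally show "ennreal ((norm (c * iexp (inner_prod_on I \<theta> x) * f x - trig I ds x))\<^sup>2)
          \<le> ennreal N * ennreal ((norm (f x - trig I cs x))\<^sup>2)"
        using N by (simp flip: ennreal_mult)
    qed
    also have "\<dots> = ennreal N * (\<integral>\<^sup>+x. ennreal ((norm (f x - trig I cs x))\<^sup>2) \<partial>\<mu>)"
      by (rule nn_integral_cmult) simp
    also have "\<dots> < ennreal N * ennreal (e / N)"
      using cs N by (intro ennreal_mult_strict_left_mono) auto
    also have "\<dots> = ennreal e"
      using N e by (simp flip: ennreal_mult)
    finally show "\<exists>cs. (\<integral>\<^sup>+x. ennreal ((norm (c * iexp (inner_prod_on I \<theta> x) * f x - trig I cs x))\<^sup>2) \<partial>\<mu>) < ennreal e"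
      by blast
  qed simp
qed

lemma approx_const: "approx (\<lambda>x. c)"
proof -
  have "trig I [(c, \<lambda>_. 0)] = (\<lambda>_. c)"
    by (auto simp: inner_prod_on_def)
  then show ?thesis
    using approx_trig[of "[(c, \<lambda>_. 0)]"] by simp
qed

lemma approx_cmult: "approx f \<Longrightarrow> approx (\<lambda>x. c * f x)"
  using approx_mult_iexp[of f c "\<lambda>_. 0"] by (simp add: inner_prod_on_def)

lemma approx_diff: "approx f \<Longrightarrow> approx g \<Longrightarrow> approx (\<lambda>x. f x - g x)"
  using approx_add[of f "\<lambda>x. - 1 * g x"] approx_cmult[of g "- 1"] by simp

lemma approx_trig_mult: "approx f \<Longrightarrow> approx (\<lambda>x. trig I cs x * f x)"
proof (induction cs)
  case Nil
  then show ?case by (simp add: approx_const)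
next
  case (Cons a cs)
  then show ?case
    using approx_add[OF approx_mult_iexp[OF Cons.prems, of "fst a" "snd a"] Cons.IH]
    by (cases a) (simp add: algebra_simps)
qed

text \<open>A product of two \<open>L\<^sup>2\<close> approximants need not be close to the product.
  Therefore \<open>f\<close> is replaced by a polynomial with an error measured against the bound of
  \<open>g\<close>, and only afterwards the product of this fixed polynomial with \<open>g\<close>
  is approximated.\<close>

lemma approx_mult:
  assumes f: "approx f" and g: "approx g"
  shows "approx (\<lambda>x. f x * g x)"
proof -
  note [measurable] = f[THEN approx_measurable] g[THEN approx_measurable]
  obtain K L where K: "K \<ge> 0" "\<And>x. norm (f x) \<le> K" and L: "L \<ge> 0" "\<And>x. norm (g x) \<le> L"
    using approx_bounded f g by metis
  show ?thesis
  proof (rule approxI[where K = "K * L"])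
    show "norm (f x * g x) \<le> K * L" for x
      using K L by (simp add: norm_mult mult_mono)
    fix e :: real assume e: "e > 0"
    define N where "N = L\<^sup>2 + 1"
    have N: "N > 0" by (simp add: N_def add_nonneg_pos)
    have e4: "e / 4 > 0" using e by simp
    obtain cs where cs: "(\<integral>\<^sup>+x. ennreal ((norm (f x - trig I cs x))\<^sup>2) \<partial>\<mu>) < ennreal (e / 4 / N)"
      using approx_error[OF f, of "e / 4 / N"] N e4 by auto
    obtain ds where ds: "(\<integral>\<^sup>+x. ennreal ((norm (trig I cs x * g x - trig I ds x))\<^sup>2) \<partial>\<mu>) < ennreal (e / 4)"
      using approx_error[OF approx_trig_mult[OF g] e4, of cs] by auto
    have "(\<integral>\<^sup>+x. ennreal ((norm ((f x - trig I cs x) * g x))\<^sup>2) \<partial>\<mu>)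
        \<le> (\<integral>\<^sup>+x. ennreal N * ennreal ((norm (f x - trig I cs x))\<^sup>2) \<partial>\<mu>)"
    proof (intro nn_integral_mono)
      fix x
      have "(norm (g x))\<^sup>2 \<le> L\<^sup>2"
        using L by (intro power_mono) auto
      then have "(norm ((f x - trig I cs x) * g x))\<^sup>2 \<le> N * (norm (f x - trig I cs x))\<^sup>2"
        by (simp add: norm_mult power_mult_distrib N_def mult.commute mult_right_mono)
      then show "ennreal ((norm ((f x - trig I cs x) * g x))\<^sup>2)
          \<le> ennreal N * ennreal ((norm (f x - trig I cs x))\<^sup>2)"
        using N by (simp flip: ennreal_mult)
    qed
    also have "\<dots> = ennreal N * (\<integral>\<^sup>+x. ennreal ((norm (f x - trig I cs x))\<^sup>2) \<partial>\<mu>)"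
      by (rule nn_integral_cmult) simp
    also have "\<dots> < ennreal N * ennreal (e / 4 / N)"
      using cs N by (intro ennreal_mult_strict_left_mono) auto
    also have "\<dots> = ennreal (e / 4)"
      using N e by (simp flip: ennreal_mult)
    finally have 1: "(\<integral>\<^sup>+x. ennreal ((norm ((f x - trig I cs x) * g x))\<^sup>2) \<partial>\<mu>) < ennreal (e / 4)" .
    have "(\<integral>\<^sup>+x. ennreal ((norm ((f x - trig I cs x) * g x + (trig I cs x * g x - trig I ds x)))\<^sup>2) \<partial>\<mu>)
        < ennreal (4 * (e / 4))"
      by (rule nn_integral_power2_norm_add_le[OF _ _ 1 ds e4]) measurable
    then show "\<exists>cs. (\<integral>\<^sup>+x. ennreal ((norm (f x * g x - trig I cs x))\<^sup>2) \<partial>\<mu>) < ennreal e"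
      by (intro exI[of _ ds]) (simp add: left_diff_distrib)
  qed simp
qed

lemma approx_power: "approx f \<Longrightarrow> approx (\<lambda>x. f x ^ n)"
  by (induction n) (auto intro: approx_const approx_mult)

text \<open>Bounded pointwise convergence implies convergence in \<open>L\<^sup>2\<close> because
  \<open>\<mu>\<close> is finite. This is the passage from an algebra of functions to a class closed
  under countable operations.\<close>

lemma approx_limit:
  assumes f: "\<And>n. approx (f n)" and bd: "\<And>n x. x \<in> space \<mu> \<Longrightarrow> norm (f n x) \<le> K"
    and lim: "\<And>x. x \<in> space \<mu> \<Longrightarrow> (\<lambda>n. f n x) \<longlonglongrightarrow> g x" and g: "\<And>x. norm (g x) \<le> L"
  shows "approx g"
proof -
  note [measurable] = f[THEN approx_measurable]
  have [measurable]: "g \<in> borel_measurable \<mu>"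
    by (rule borel_measurable_LIMSEQ_metric[OF _ lim]) simp_all
  have lim0: "(\<lambda>n. \<integral>\<^sup>+x. ennreal ((norm (g x - f n x))\<^sup>2) \<partial>\<mu>) \<longlonglongrightarrow> (\<integral>\<^sup>+x. 0 \<partial>\<mu>)"
  proof (rule nn_integral_dominated_convergence)
    show "AE x in \<mu>. ennreal ((norm (g x - f n x))\<^sup>2) \<le> ennreal ((L + K)\<^sup>2)" for n
    proof (rule AE_I2)
      fix x assume x: "x \<in> space \<mu>"
      have "norm (g x - f n x) \<le> L + K"
        using g[of x] bd[OF x, of n] norm_triangle_ineq4[of "g x" "f n x"] by linarith
      then show "ennreal ((norm (g x - f n x))\<^sup>2) \<le> ennreal ((L + K)\<^sup>2)"
        by (intro ennreal_leI power_mono) auto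
    qed
    show "(\<integral>\<^sup>+x. ennreal ((L + K)\<^sup>2) \<partial>\<mu>) < \<infinity>"
      using emeasure_finite[of "space \<mu>"] by (simp add: ennreal_mult_less_top less_top del: emeasure_finite)
    show "AE x in \<mu>. (\<lambda>n. ennreal ((norm (g x - f n x))\<^sup>2)) \<longlonglongrightarrow> 0"
    proof (rule AE_I2)
      fix x assume "x \<in> space \<mu>"
      from tendsto_power[OF tendsto_norm[OF tendsto_diff[OF tendsto_const[of "g x"] lim[OF this]]], of 2]
      show "(\<lambda>n. ennreal ((norm (g x - f n x))\<^sup>2)) \<longlonglongrightarrow> 0"
        by (simp flip: ennreal_0)
    qed
  qed simp_all
  show ?thesis
  proof (rule approxI[where K = L])
    fix e :: real assume e: "e > 0"
    then have e4: "e / 4 > 0" by simp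
    then obtain n where n: "(\<integral>\<^sup>+x. ennreal ((norm (g x - f n x))\<^sup>2) \<partial>\<mu>) < ennreal (e / 4)"
      using order_tendstoD(2)[OF lim0, of "ennreal (e / 4)"] by (auto simp: eventually_sequentially)
    obtain cs where cs: "(\<integral>\<^sup>+x. ennreal ((norm (f n x - trig I cs x))\<^sup>2) \<partial>\<mu>) < ennreal (e / 4)"
      using approx_error[OF f e4] by auto
    have "(\<integral>\<^sup>+x. ennreal ((norm ((g x - f n x) + (f n x - trig I cs x)))\<^sup>2) \<partial>\<mu>)
        < ennreal (4 * (e / 4))"
      by (rule nn_integral_power2_norm_add_le[OF _ _ n cs e4]) measurable
    then show "\<exists>cs. (\<integral>\<^sup>+x. ennreal ((norm (g x - trig I cs x))\<^sup>2) \<partial>\<mu>) < ennreal e"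
      by (intro exI[of _ cs]) simp
  qed (use g in simp_all)
qed

end

text \<open>The exponents \<open>n\<close> and \<open>n 2\<^sup>n\<close> make the limit the exact indicator, also at \<open>y = 1/2\<close>.\<close>

lemma tendsto_threshold:
  fixes y :: real
  assumes y: "0 \<le> y" "y \<le> 1"
  shows "(\<lambda>n. (1 - y ^ n) ^ (n * 2 ^ n)) \<longlonglongrightarrow> (if y < 1 / 2 then 1 else 0)"
proof (cases "y < 1 / 2")
  case True
  have yn: "y ^ n \<le> 1" for n
    using y by (simp add: power_le_one)
  \<comment> \<open>Bernoulli's inequality. The factor \<open>2 ^ n\<close> in the exponent turns
    \<open>y ^ n\<close> into \<open>(2 * y) ^ n\<close>, which places the threshold at
    \<open>1 / 2\<close>.\<close>
  have low: "1 - real n * (2 * y) ^ n \<le> (1 - y ^ n) ^ (n * 2 ^ n)" for n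
    using Bernoulli_inequality[of "- (y ^ n)" "n * 2 ^ n"] yn[of n]
    by (simp add: power_mult_distrib mult.assoc)
  have "(\<lambda>n. real n * (2 * y) ^ n) \<longlonglongrightarrow> 0"
    using True y by (intro powser_times_n_limit_0) auto
  from tendsto_diff[OF tendsto_const[of 1] this]
  have lim: "(\<lambda>n. 1 - real n * (2 * y) ^ n) \<longlonglongrightarrow> 1"
    by simp
  have "(\<lambda>n. (1 - y ^ n) ^ (n * 2 ^ n)) \<longlonglongrightarrow> 1"
  proof (rule tendsto_sandwich[OF _ _ lim tendsto_const])
    show "\<forall>\<^sub>F n in sequentially. (1 - y ^ n) ^ (n * 2 ^ n) \<le> 1"
      using yn y by (intro always_eventually allI power_le_one) auto
  qed (use low in auto)
  with True show ?thesis by simp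
next
  case False
  have yn: "y ^ n \<le> 1" "0 \<le> y ^ n" for n
    using y by (simp_all add: power_le_one)
  \<comment> \<open>The power is multiplied by \<open>(1 + y ^ n) ^ (n * 2 ^ n)\<close>: the product
    is at most 1, while the new factor is at least \<open>1 + n\<close> by Bernoulli, as
    \<open>2 * y\<close> is at least 1. The leading \<open>n\<close> in the exponent forces decay
    even for \<open>y = 1 / 2\<close>.\<close>
  have up: "(1 - y ^ n) ^ (n * 2 ^ n) \<le> 1 / real (Suc n)" for n
  proof -
    have "1 + real n \<le> 1 + real n * (2 * y) ^ n"
      using False mult_left_mono[OF one_le_power[of "2 * y" n], of "real n"] by simp
    also have "\<dots> \<le> (1 + y ^ n) ^ (n * 2 ^ n)"
      using Bernoulli_inequality[of "y ^ n" "n * 2 ^ n"] yn(2)[of n]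
      by (simp add: power_mult_distrib mult.assoc)
    finally have low: "1 + real n \<le> (1 + y ^ n) ^ (n * 2 ^ n)" .
    have "(1 - y ^ n) ^ (n * 2 ^ n) * (1 + y ^ n) ^ (n * 2 ^ n) = (1 - (y ^ n)\<^sup>2) ^ (n * 2 ^ n)"
    proof -
      have "(1 - z) * (1 + z) = 1 - z\<^sup>2" for z :: real
        by (simp add: power2_eq_square algebra_simps)
      then show ?thesis
        unfolding power_mult_distrib[symmetric] by (simp only:)
    qed
    also have "\<dots> \<le> 1"
    proof (rule power_le_one)
      show "0 \<le> 1 - (y ^ n)\<^sup>2"
        using power_le_one[OF yn(2)[of n] yn(1)[of n], of 2] by linarith
      show "1 - (y ^ n)\<^sup>2 \<le> 1"
        using zero_le_power2[of "y ^ n"] by linarith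
    qed
    finally have "(1 - y ^ n) ^ (n * 2 ^ n) * (1 + y ^ n) ^ (n * 2 ^ n) \<le> 1" .
    moreover have "(1 - y ^ n) ^ (n * 2 ^ n) * (1 + real n) \<le> (1 - y ^ n) ^ (n * 2 ^ n) * (1 + y ^ n) ^ (n * 2 ^ n)"
      using low yn by (intro mult_left_mono zero_le_power) auto
    ultimately show ?thesis
      by (simp add: field_simps)
  qed
  have "(\<lambda>n. (1 - y ^ n) ^ (n * 2 ^ n)) \<longlonglongrightarrow> 0"
  proof (rule tendsto_sandwich[OF _ _ tendsto_const LIMSEQ_Suc[OF lim_1_over_n]])
    show "\<forall>\<^sub>F n in sequentially. 0 \<le> (1 - y ^ n) ^ (n * 2 ^ n)"
      using yn by (intro always_eventually allI zero_le_power) auto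
  qed (use up in auto)
  with False show ?thesis by simp
qed

context trig_approximation
begin

text \<open>The constant sequence \<open>f\<close> converges to \<open>g\<close> on the space of
  \<open>\<mu>\<close>; off the space \<open>g\<close> only has to stay bounded.\<close>

lemma approx_cong:
  assumes "approx f" "\<And>x. x \<in> space \<mu> \<Longrightarrow> f x = g x" "\<And>x. norm (g x) \<le> L"
  shows "approx g"
proof -
  obtain K where K: "\<And>x. norm (f x) \<le> K"
    using approx_bounded[OF assms(1)] by metis
  show ?thesis
  proof (rule approx_limit[of "\<lambda>_. f" K g L])
    show "(\<lambda>n. f x) \<longlonglongrightarrow> g x" if "x \<in> space \<mu>" for x
      using assms(2)[OF that] by simp
  qed (use assms(1,3) K in auto)
qed

lemma norm_indicator_le: "norm (indicator A x :: complex) \<le> 1"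
  by (simp add: indicator_def)

definition approx_sets :: "('t \<Rightarrow> real) set set" where
  "approx_sets = {A \<in> sets \<mu>. approx (indicator A)}"

text \<open>Complements and finite unions come from the algebra structure, where inclusion-exclusion
  needs products of indicators; countable unions come from bounded limits.\<close>

lemma sigma_algebra_approx_sets: "sigma_algebra (space \<mu>) approx_sets"
  unfolding sigma_algebra_iff2
proof (intro conjI ballI allI impI)
  show "approx_sets \<subseteq> Pow (space \<mu>)"
    using sets.space_closed by (auto simp: approx_sets_def)
  have "indicator {} = (\<lambda>_ :: 't \<Rightarrow> real. 0 :: complex)" by auto
  then show "{} \<in> approx_sets"
    using approx_const[of 0] by (simp add: approx_sets_def)
next
  fix A assume A: "A \<in> approx_sets"
  then have "approx (\<lambda>x. 1 - indicator A x)"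
    by (intro approx_diff approx_const) (simp add: approx_sets_def)
  then have "approx (indicator (space \<mu> - A))"
    by (rule approx_cong[OF _ _ norm_indicator_le]) (auto simp: indicator_def)
  then show "space \<mu> - A \<in> approx_sets"
    using A by (auto simp: approx_sets_def)
next
  fix A :: "nat \<Rightarrow> _" assume "range A \<subseteq> approx_sets"
  then have A: "A i \<in> sets \<mu>" "approx (indicator (A i))" for i
    by (auto simp: approx_sets_def)
  have un: "approx (indicator (\<Union>i<n. A i))" for n
  proof (induction n)
    case 0
    have "indicator {} = (\<lambda>_ :: 't \<Rightarrow> real. 0 :: complex)" by auto
    then show ?case using approx_const[of 0] by simp
  next
    case (Suc n)
    have "indicator (\<Union>i<Suc n. A i) =
        (\<lambda>x. indicator (A n) x + indicator (\<Union>i<n. A i) x - indicator (A n) x * indicator (\<Union>i<n. A i) x :: complex)"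
      by (auto simp: fun_eq_iff lessThan_Suc indicator_def)
    then show ?case
      using approx_diff[OF approx_add[OF A(2)[of n] Suc] approx_mult[OF A(2)[of n] Suc]] by simp
  qed
  have "approx (indicator (\<Union>i. A i))"
    by (rule approx_limit[OF un norm_indicator_le LIMSEQ_indicator_UN norm_indicator_le])
  then show "(\<Union>i. A i) \<in> approx_sets"
    using A by (auto simp: approx_sets_def)
qed

text \<open>The function \<open>(1 - sin u) / 2\<close> is a trigonometric polynomial in
  \<open>x\<close> with values between 0 and 1, and it is below \<open>1 / 2\<close> exactly where
  the sine is positive. The threshold sequence applied to it converges to the indicator.\<close>

lemma sin_pos_approx_sets: "{x \<in> space \<mu>. 0 < sin (inner_prod_on I \<theta> x - a)} \<in> approx_sets"
proof -
  \<comment> \<open>Euler's formula for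
    \<open>(1 - sin (inner_prod_on I \<theta> x - a)) / 2\<close>, with the phase \<open>a\<close>
    absorbed in the coefficients.\<close>
  define cs where "cs = [(1 / 2 :: complex, \<lambda>_. 0), (\<i> / 4 * exp (- (\<i> * complex_of_real a)), \<theta>),
    (- \<i> / 4 * exp (\<i> * complex_of_real a), \<lambda>t. - \<theta> t)]"
  define g where "g x = (1 - sin (inner_prod_on I \<theta> x - a)) / 2" for x
  have "trig I cs x = complex_of_real (g x)" for x
  proof -
    have neg: "inner_prod_on I (\<lambda>t. - \<theta> t) x = - inner_prod_on I \<theta> x"
      by (simp add: inner_prod_on_def sum_negf)
    have zero: "inner_prod_on I (\<lambda>t. 0) x = 0"
      by (simp add: inner_prod_on_def)
    define u where "u = complex_of_real (inner_prod_on I \<theta> x - a)"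
    have 1: "exp (- (\<i> * complex_of_real a)) * iexp (inner_prod_on I \<theta> x) = exp (\<i> * u)"
      by (simp add: u_def right_diff_distrib flip: exp_add)
    have 2: "exp (\<i> * complex_of_real a) * iexp (- inner_prod_on I \<theta> x) = exp (- (\<i> * u))"
      by (simp add: u_def right_diff_distrib flip: exp_add)
    have "trig I cs x = 1 / 2 + \<i> / 4 * exp (\<i> * u) - \<i> / 4 * exp (- (\<i> * u))"
      unfolding 1[symmetric] 2[symmetric] by (simp add: cs_def neg zero mult.assoc)
    also have "\<dots> = (1 - sin u) / 2"
      by (simp add: sin_exp_eq field_simps)
    also have "\<dots> = complex_of_real (g x)"
      unfolding g_def u_def sin_of_real by simp
    finally show ?thesis .
  qed
  then have "trig I cs = (\<lambda>x. complex_of_real (g x))"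
    by auto
  then have g: "approx (\<lambda>x. complex_of_real (g x))"
    using approx_trig[of cs] by simp
  have g01: "0 \<le> g x" "g x \<le> 1" for x
    using sin_le_one[of "inner_prod_on I \<theta> x - a"] sin_ge_minus_one[of "inner_prod_on I \<theta> x - a"]
    by (simp_all add: g_def del: sin_le_one sin_ge_minus_one)
  let ?A = "{x \<in> space \<mu>. 0 < sin (inner_prod_on I \<theta> x - a)}"
  have "approx (indicator ?A)"
  proof (rule approx_limit[where f = "\<lambda>n x. (1 - complex_of_real (g x) ^ n) ^ (n * 2 ^ n)" and K = 1 and L = 1])
    show "approx (\<lambda>x. (1 - complex_of_real (g x) ^ n) ^ (n * 2 ^ n))" for n
      by (intro approx_power approx_diff approx_const g)
    have eq: "(1 - complex_of_real (g x) ^ n) ^ (n * 2 ^ n) = complex_of_real ((1 - g x ^ n) ^ (n * 2 ^ n))" for n x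
      by simp
    show "norm ((1 - complex_of_real (g x) ^ n) ^ (n * 2 ^ n)) \<le> 1" for n x
      unfolding eq norm_of_real using g01[of x] by (simp add: power_le_one power_abs[symmetric])
    fix x assume x: "x \<in> space \<mu>"
    have "(\<lambda>n. complex_of_real ((1 - g x ^ n) ^ (n * 2 ^ n))) \<longlonglongrightarrow> complex_of_real (if g x < 1 / 2 then 1 else 0)"
      by (intro tendsto_of_real tendsto_threshold g01)
    moreover have "complex_of_real (if g x < 1 / 2 then 1 else 0) = indicator ?A x"
      using x by (auto simp: g_def indicator_def)
    ultimately show "(\<lambda>n. (1 - complex_of_real (g x) ^ n) ^ (n * 2 ^ n)) \<longlonglongrightarrow> indicator ?A x"
      unfolding eq by simp
  qed (rule norm_indicator_le)
  moreover have "(\<lambda>x. inner_prod_on I \<theta> x) \<in> borel_measurable \<mu>"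
    using inner_prod_on_measurable[of I I \<theta>] by (simp cong: measurable_cong_sets[OF sets_\<mu> refl])
  then have "?A \<in> sets \<mu>"
    by measurable
  ultimately show ?thesis
    by (simp add: approx_sets_def)
qed

text \<open>Sine has the sign of its argument between -1 and 1. Division by a large number brings
  \<open>x t - a\<close> into that range, so the half-space is the limit inferior of the sine sets
  at scale \<open>Suc n\<close>.\<close>

lemma component_gt_approx_sets:
  assumes t: "t \<in> I"
  shows "{x \<in> space \<mu>. a < x t} \<in> approx_sets"
proof -
  interpret D: sigma_algebra "space \<mu>" approx_sets by (rule sigma_algebra_approx_sets)
  define S where "S n = {x \<in> space \<mu>. 0 < sin (x t / real (Suc n) - a / real (Suc n))}" for n
  have "inner_prod_on I (\<lambda>s. if s = t then 1 / real (Suc n) else 0) x = x t / real (Suc n)" for n x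
    using t finite_I by (simp add: inner_prod_on_def if_distrib[of "\<lambda>u. u * _"] cong: if_cong)
  then have S: "S n \<in> approx_sets" for n
    using sin_pos_approx_sets[of "\<lambda>s. if s = t then 1 / real (Suc n) else 0" "a / real (Suc n)"]
    by (simp add: S_def)
  have "{x \<in> space \<mu>. a < x t} = (\<Union>N. \<Inter>n. S (N + n))"
  proof (intro set_eqI iffI)
    fix x assume x: "x \<in> {x \<in> space \<mu>. a < x t}"
    obtain N :: nat where N: "x t - a < real N"
      using reals_Archimedean2 by blast
    have "x \<in> S (N + n)" for n
    proof -
      have "0 < x t / real (Suc (N + n)) - a / real (Suc (N + n))"
        using x by (simp add: diff_divide_distrib[symmetric])
      moreover have "x t / real (Suc (N + n)) - a / real (Suc (N + n)) < 1"
        using N by (simp add: diff_divide_distrib[symmetric])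
      ultimately show ?thesis
        using x pi_gt3 by (auto simp: S_def intro!: sin_gt_zero)
    qed
    then show "x \<in> (\<Union>N. \<Inter>n. S (N + n))" by blast
  next
    fix x assume "x \<in> (\<Union>N. \<Inter>n. S (N + n))"
    then obtain N where N: "\<And>n. x \<in> S (N + n)" by blast
    have "a < x t"
    proof (rule ccontr)
      assume "\<not> a < x t"
      obtain n :: nat where n: "a - x t < real n"
        using reals_Archimedean2 by blast
      let ?k = "real (Suc (N + n))"
      have "0 \<le> a / ?k - x t / ?k"
        using \<open>\<not> a < x t\<close> by (simp add: diff_divide_distrib[symmetric])
      moreover have "a / ?k - x t / ?k < 1"
        using n by (simp add: diff_divide_distrib[symmetric])
      ultimately have "0 \<le> sin (a / ?k - x t / ?k)"
        using pi_gt3 by (intro sin_ge_zero) auto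
      also have "\<dots> = - sin (x t / ?k - a / ?k)"
        by (metis minus_diff_eq sin_minus)
      finally show False
        using N[of n] by (simp add: S_def)
    qed
    with N[of 0] show "x \<in> {x \<in> space \<mu>. a < x t}"
      by (simp add: S_def)
  qed
  also have "\<dots> \<in> approx_sets"
    using S by (intro D.countable_UN D.countable_INT) auto
  finally show ?thesis .
qed

text \<open>All coordinate maps are measurable for the \<sigma>-algebra of approximable sets, hence
  so is the identity into the product \<sigma>-algebra.\<close>

lemma approx_indicator:
  assumes A: "A \<in> sets \<mu>"
  shows "approx (indicator A)"
proof -
  interpret D: sigma_algebra "space \<mu>" approx_sets by (rule sigma_algebra_approx_sets)
  define N where "N = sigma (space \<mu>) approx_sets"
  have N: "sets N = approx_sets" "space N = space \<mu>"
    by (simp_all add: N_def D.space_closed)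
  have sp: "space \<mu> = space (path_space I)"
    by (rule sets_eq_imp_space_eq[OF sets_\<mu>])
  have "(\<lambda>x. x t) \<in> borel_measurable N" if "t \<in> I" for t
    using component_gt_approx_sets[OF that] by (simp add: borel_measurable_iff_greater N)
  then have "(\<lambda>x t. x t) \<in> measurable N (path_space I)"
    by (intro measurable_PiM_single') (auto simp: N sp space_PiM)
  then have "(\<lambda>x t. x t) -` A \<inter> space N \<in> sets N"
    using A sets_\<mu> by (auto intro: measurable_sets)
  then have "A \<in> approx_sets"
    using sets.sets_into_space[OF A] by (simp add: N Int_absorb2)
  then show ?thesis
    by (simp add: approx_sets_def)
qed

end

section \<open>From inequalities between quadratic forms to inequalities between measures\<close>

text \<open>The mixed term is split with weight \<open>e\<close>. A leading constant
  \<open>1 + e\<close> arbitrarily close to 1 is essential here: with a fixed constant above 1 the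
  comparison of two measures would lose a factor.\<close>

lemma power2_norm_le_weighted:
  fixes a b :: "'a :: real_normed_vector"
  assumes e: "e > 0"
  shows "(norm a)\<^sup>2 \<le> (1 + e) * (norm b)\<^sup>2 + (1 + 1 / e) * (norm (a - b))\<^sup>2"
proof -
  have "(norm a)\<^sup>2 \<le> (norm b + norm (a - b))\<^sup>2"
    using norm_triangle_ineq[of b "a - b"] by (intro power_mono) auto
  also have "\<dots> = (norm b)\<^sup>2 + (norm (a - b))\<^sup>2 + 2 * norm b * norm (a - b)"
    by (simp add: power2_eq_square algebra_simps)
  also have "2 * norm b * norm (a - b) \<le> e * (norm b)\<^sup>2 + (norm (a - b))\<^sup>2 / e"
  proof -
    have "0 \<le> (e * norm b - norm (a - b))\<^sup>2 / e"
      using e by simp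
    also have "\<dots> = e * (norm b)\<^sup>2 + (norm (a - b))\<^sup>2 / e - 2 * norm b * norm (a - b)"
      using e by (simp add: power2_eq_square field_simps)
    finally show ?thesis by simp
  qed
  finally show ?thesis
    by (simp add: algebra_simps)
qed

lemma integral_power2_norm_le_weighted:
  fixes f g :: "'a \<Rightarrow> complex"
  assumes f: "f \<in> borel_measurable M" "integrable M (\<lambda>x. (norm (f x))\<^sup>2)"
    and g: "g \<in> borel_measurable M" "integrable M (\<lambda>x. (norm (g x))\<^sup>2)"
    and d: "(\<integral>\<^sup>+x. ennreal ((norm (f x - g x))\<^sup>2) \<partial>M) \<le> ennreal d" "d \<ge> 0" and e: "e > 0"
  shows "(\<integral>x. (norm (f x))\<^sup>2 \<partial>M) \<le> (1 + e) * (\<integral>x. (norm (g x))\<^sup>2 \<partial>M) + (1 + 1 / e) * d"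
proof -
  note [measurable] = f(1) g(1)
  have i: "integrable M (\<lambda>x. (norm (f x - g x))\<^sup>2)"
    using d(1) by (auto simp: integrable_iff_bounded top.not_eq_extremum[symmetric] top_unique)
  have "(\<integral>x. (norm (f x - g x))\<^sup>2 \<partial>M) \<le> d"
    using d nn_integral_eq_integral[OF i] by simp
  moreover have "(\<integral>x. (norm (f x))\<^sup>2 \<partial>M) \<le> (\<integral>x. (1 + e) * (norm (g x))\<^sup>2 + (1 + 1 / e) * (norm (f x - g x))\<^sup>2 \<partial>M)"
    using f g i e by (intro integral_mono power2_norm_le_weighted) auto
  ultimately show ?thesis
    using g i e by (simp add: add_nonneg_nonneg mult_left_mono order_trans)
qed

text \<open>Positivity is tested on \<open>\<bar>q\<bar>\<^sup>2\<close> for trigonometric polynomials \<open>q\<close>, whose integrals are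
  determined by characteristic functions; indicators are \<open>L\<^sup>2\<close> limits of such \<open>q\<close>.\<close>

lemma measure_le_if_trig_le:
  assumes F: "finite_measure F" "sets F = sets (path_space I)"
    and G: "finite_measure G" "sets G = sets (path_space I)" and I: "finite I"
    and le: "\<And>cs. (\<integral>x. (norm (trig I cs x))\<^sup>2 \<partial>G) \<le> (\<integral>x. (norm (trig I cs x))\<^sup>2 \<partial>F)"
  shows "emeasure G A \<le> emeasure F A"
proof (cases "A \<in> sets F")
  case A: True
  interpret F: finite_measure F by fact
  interpret G: finite_measure G by fact
  have sGF: "sets G = sets F" using F G by simp
  \<comment> \<open>One polynomial has to approximate the indicator for both measures at once, so
    the approximation takes place in \<open>L\<^sup>2\<close> of their sum.\<close>
  define \<mu> where "\<mu> = add_measure F G"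
  have s\<mu>: "sets \<mu> = sets F" by (simp add: \<mu>_def)
  interpret trig_approximation \<mu> I
  proof (intro trig_approximation.intro trig_approximation_axioms.intro)
    show "finite_measure \<mu>"
      unfolding \<mu>_def by (rule finite_measure_add_measure[OF sGF F(1) G(1)])
  qed (use F I s\<mu> in simp_all)
  have mF: "trig I cs \<in> borel_measurable F" "trig I cs \<in> borel_measurable G" for cs
    unfolding measurable_cong_sets[OF F(2) refl] measurable_cong_sets[OF G(2) refl]
    by (rule trig_measurable, simp)+
  have bd: "(norm (trig I cs x))\<^sup>2 \<le> (\<Sum>(c, \<theta>)\<leftarrow>cs. norm c)\<^sup>2" for cs x
    by (intro power_mono trig_bounded) simp
  have iF: "integrable F (\<lambda>x. (norm (trig I cs x))\<^sup>2)" for cs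
    using bd[of cs] mF by (intro F.integrable_const_bound[where B = "(\<Sum>(c, \<theta>)\<leftarrow>cs. norm c)\<^sup>2"]) auto
  have iG: "integrable G (\<lambda>x. (norm (trig I cs x))\<^sup>2)" for cs
    using bd[of cs] mF by (intro G.integrable_const_bound[where B = "(\<Sum>(c, \<theta>)\<leftarrow>cs. norm c)\<^sup>2"]) auto
  have ind2: "(norm (indicator A x :: complex))\<^sup>2 = indicator A x" for x
    by (simp add: indicator_def)
  have "measure G A \<le> measure F A + e * (3 * measure F A + 1)" if e: "0 < e" "e < 1" for e
  proof -
    \<comment> \<open>Chosen so that \<open>(1 + 1 / e) * d = e / 3\<close>; this error enters
      twice, once for each measure.\<close>
    define d where "d = e / 3 / (1 + 1 / e)"
    have e1: "1 + 1 / e > 0" using e by (simp add: add_pos_pos)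
    then have d: "d > 0" using e by (simp add: d_def)
    obtain cs where cs: "(\<integral>\<^sup>+x. ennreal ((norm (indicator A x - trig I cs x))\<^sup>2) \<partial>\<mu>) < ennreal d"
      using approx_error[OF approx_indicator d] A s\<mu> by auto
    have "(\<lambda>x. ennreal ((norm (indicator A x - trig I cs x))\<^sup>2)) \<in> borel_measurable F"
      using A mF by measurable
    note split = nn_integral_add_measure[OF sGF this, folded \<mu>_def]
    have dF: "(\<integral>\<^sup>+x. ennreal ((norm (indicator A x - trig I cs x))\<^sup>2) \<partial>F) \<le> ennreal d"
      using cs unfolding split by (intro order_trans[OF _ less_imp_le[OF cs]]) (simp add: split)
    have dG: "(\<integral>\<^sup>+x. ennreal ((norm (indicator A x - trig I cs x))\<^sup>2) \<partial>G) \<le> ennreal d"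
      using cs unfolding split by (intro order_trans[OF _ less_imp_le[OF cs]]) (simp add: split)
    have dF': "(\<integral>\<^sup>+x. ennreal ((norm (trig I cs x - indicator A x))\<^sup>2) \<partial>F) \<le> ennreal d"
      using dF by (simp add: norm_minus_commute)
    have "measure G A = (\<integral>x. (norm (indicator A x :: complex))\<^sup>2 \<partial>G)"
      using A by (simp add: ind2 sGF)
    also have "\<dots> \<le> (1 + e) * (\<integral>x. (norm (trig I cs x))\<^sup>2 \<partial>G) + (1 + 1 / e) * d"
      using A dG d e mF iG sGF
      by (intro integral_power2_norm_le_weighted) (auto simp: ind2 G.emeasure_finite less_top[symmetric])
    also have "(\<integral>x. (norm (trig I cs x))\<^sup>2 \<partial>G) \<le> (\<integral>x. (norm (trig I cs x))\<^sup>2 \<partial>F)"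
      by (rule le)
    also have "\<dots> \<le> (1 + e) * (\<integral>x. (norm (indicator A x :: complex))\<^sup>2 \<partial>F) + (1 + 1 / e) * d"
      using A dF' d e mF iF
      by (intro integral_power2_norm_le_weighted) (auto simp: ind2 F.emeasure_finite less_top[symmetric])
    also have "(\<integral>x. (norm (indicator A x :: complex))\<^sup>2 \<partial>F) = measure F A"
      using A by (simp add: ind2)
    also have "(1 + 1 / e) * d = e / 3"
      using e1 unfolding d_def by (metis less_irrefl nonzero_mult_div_cancel_left times_divide_eq_right)
    finally have "measure G A \<le> (1 + e) * ((1 + e) * measure F A + e / 3) + e / 3"
      using e by simp
    also have "\<dots> = measure F A + e * (2 * measure F A + e * measure F A + e / 3 + 2 / 3)"
      by (simp add: field_simps)
    also have "\<dots> \<le> measure F A + e * (3 * measure F A + 1)"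
    proof -
      have "e * measure F A \<le> 1 * measure F A"
        using e by (intro mult_right_mono) auto
      then show ?thesis using e by (intro add_left_mono mult_left_mono) auto
    qed
    finally show ?thesis .
  qed
  \<comment> \<open>As \<open>e\<close> tends to 0 the leading factor \<open>(1 + e) ^ 2\<close>
    tends to 1 and the errors vanish.\<close>
  then have ev: "\<forall>\<^sub>F e in at_right 0. measure G A \<le> measure F A + e * (3 * measure F A + 1)"
    unfolding eventually_at_right_field by (intro exI[of _ 1]) auto
  have "((\<lambda>e. measure F A + e * (3 * measure F A + 1)) \<longlongrightarrow> measure F A + 0 * (3 * measure F A + 1)) (at_right 0)"
    by (intro tendsto_intros)
  from tendsto_lowerbound[OF this ev] have "measure G A \<le> measure F A"
    by simp
  then show ?thesis
    by (simp add: F.emeasure_eq_measure G.emeasure_eq_measure)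
next
  case False
  then show ?thesis
    using F G by (simp add: emeasure_notin_sets)
qed

section \<open>Positive definiteness and weighted characteristic functions\<close>

text \<open>The sesquilinear form of Bochner's theorem. On the diagonal, for a characteristic
  function, it is the integral of the squared modulus of the polynomial with data
  \<open>cs\<close>.\<close>

definition pd_form ::
  "(complex \<times> ('t \<Rightarrow> real)) list \<Rightarrow> (complex \<times> ('t \<Rightarrow> real)) list \<Rightarrow> (('t \<Rightarrow> real) \<Rightarrow> complex) \<Rightarrow> complex" where
  "pd_form cs ds \<phi> = (\<Sum>p\<leftarrow>cs. \<Sum>q\<leftarrow>ds. fst p * cnj (fst q) * \<phi> (\<lambda>t. snd p t - snd q t))"

lemma inner_prod_on_linear:
  "inner_prod_on I (\<lambda>t. \<theta> t + \<eta> t) x = inner_prod_on I \<theta> x + inner_prod_on I \<eta> x"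
  "inner_prod_on I (\<lambda>t. \<theta> t - \<eta> t) x = inner_prod_on I \<theta> x - inner_prod_on I \<eta> x"
  "inner_prod_on I (\<lambda>t. r * \<theta> t) x = r * inner_prod_on I \<theta> x"
  "inner_prod_on I (\<lambda>t. 0) x = 0"
  by (simp_all add: inner_prod_on_def distrib_right left_diff_distrib sum.distrib sum_subtractf
    sum_distrib_left mult.assoc)

lemma pd_form_trig:
  "trig I cs x * cnj (trig I ds x) = pd_form cs ds (\<lambda>\<theta>. iexp (inner_prod_on I \<theta> x))"
proof -
  have 1: "a * cnj (trig I ds x) = (\<Sum>q\<leftarrow>ds. a * cnj (fst q) * iexp (- inner_prod_on I (snd q) x))" for a
    by (induction ds) (auto simp: algebra_simps exp_cnj)
  have 2: "trig I cs x * b = (\<Sum>p\<leftarrow>cs. fst p * iexp (inner_prod_on I (snd p) x) * b)" for b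
    by (induction cs) (auto simp: algebra_simps)
  have 3: "iexp (inner_prod_on I (\<lambda>t. \<theta> t - \<eta> t) x) = iexp (inner_prod_on I \<theta> x) * iexp (- inner_prod_on I \<eta> x)" for \<theta> \<eta>
    by (simp add: inner_prod_on_linear right_diff_distrib flip: exp_add)
  show ?thesis
    unfolding pd_form_def 2 unfolding 1 3 by (simp only: mult_ac)
qed

lemma tendsto_sum_list:
  fixes f :: "'a \<Rightarrow> 'b \<Rightarrow> 'c :: topological_monoid_add"
  assumes "\<And>x. x \<in> set xs \<Longrightarrow> (f x \<longlongrightarrow> l x) F"
  shows "((\<lambda>n. \<Sum>x\<leftarrow>xs. f x n) \<longlongrightarrow> (\<Sum>x\<leftarrow>xs. l x)) F"
  using assms by (induction xs) (auto intro!: tendsto_add)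

lemma pd_form_tendsto:
  assumes "\<And>\<theta>. ((\<lambda>n. \<phi> n \<theta>) \<longlongrightarrow> \<psi> \<theta>) F"
  shows "((\<lambda>n. pd_form cs ds (\<phi> n)) \<longlongrightarrow> pd_form cs ds \<psi>) F"
  unfolding pd_form_def by (intro tendsto_sum_list tendsto_mult tendsto_const assms)

lemma pd_form_diff: "pd_form cs ds (\<lambda>\<theta>. f \<theta> - g \<theta>) = pd_form cs ds f - pd_form cs ds g"
  by (simp add: pd_form_def right_diff_distrib sum_list_subtractf)

lemma pd_form_cmult: "pd_form cs ds (\<lambda>\<theta>. a * f \<theta>) = a * pd_form cs ds f"
  by (simp add: pd_form_def sum_list_const_mult[symmetric] mult_ac)

lemma has_bochner_integral_sum_list:
  fixes f :: "'a \<Rightarrow> 'b \<Rightarrow> complex"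
  assumes "\<And>x. x \<in> set xs \<Longrightarrow> has_bochner_integral M (f x) (l x)"
  shows "has_bochner_integral M (\<lambda>\<omega>. \<Sum>x\<leftarrow>xs. f x \<omega>) (\<Sum>x\<leftarrow>xs. l x)"
  using assms by (induction xs) (auto intro!: has_bochner_integral_add has_bochner_integral_zero)

lemma integrable_iexp_mult:
  assumes s: "sets \<nu> = sets (path_space T)" and I: "I \<subseteq> T" and k: "integrable \<nu> k"
  shows "integrable \<nu> (\<lambda>x. iexp (inner_prod_on I \<theta> x) * complex_of_real (k x))"
proof (rule Bochner_Integration.integrable_bound[OF k])
  have "inner_prod_on I \<theta> \<in> borel_measurable \<nu>"
    unfolding measurable_cong_sets[OF s refl] by (rule inner_prod_on_measurable[OF I])
  moreover have "k \<in> borel_measurable \<nu>"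
    using k by simp
  ultimately show "(\<lambda>x. iexp (inner_prod_on I \<theta> x) * complex_of_real (k x)) \<in> borel_measurable \<nu>"
    by measurable
qed (simp add: norm_mult)

text \<open>The characteristic function of the measure with density \<open>k\<close>. Keeping
  \<open>k\<close> inside the integral allows \<open>\<nu>\<close> to be infinite as long as
  \<open>k\<close> is integrable.\<close>

definition weighted_char ::
  "'t set \<Rightarrow> ('t \<Rightarrow> real) measure \<Rightarrow> (('t \<Rightarrow> real) \<Rightarrow> real) \<Rightarrow> ('t \<Rightarrow> real) \<Rightarrow> complex" where
  "weighted_char I \<nu> k \<theta> = (CLINT x|\<nu>. iexp (inner_prod_on I \<theta> x) * complex_of_real (k x))"

lemma pd_form_weighted_char:
  assumes s: "sets \<nu> = sets (path_space T)" and I: "I \<subseteq> T" and k: "integrable \<nu> k"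
  shows "pd_form cs cs (weighted_char I \<nu> k) = complex_of_real (\<integral>x. (norm (trig I cs x))\<^sup>2 * k x \<partial>\<nu>)"
proof -
  have "has_bochner_integral \<nu>
      (\<lambda>x. pd_form cs cs (\<lambda>\<theta>. iexp (inner_prod_on I \<theta> x) * complex_of_real (k x))) 
      (pd_form cs cs (weighted_char I \<nu> k))"
    unfolding pd_form_def weighted_char_def
    by (intro has_bochner_integral_sum_list has_bochner_integral_mult_right
        has_bochner_integral_integrable integrable_iexp_mult[OF s I k])
  moreover have "pd_form cs cs (\<lambda>\<theta>. iexp (inner_prod_on I \<theta> x) * complex_of_real (k x)) =
      complex_of_real ((norm (trig I cs x))\<^sup>2 * k x)" for x
  proof -
    have "pd_form cs cs (\<lambda>\<theta>. iexp (inner_prod_on I \<theta> x) * complex_of_real (k x)) =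
        complex_of_real (k x) * pd_form cs cs (\<lambda>\<theta>. iexp (inner_prod_on I \<theta> x))"
      by (subst pd_form_cmult[symmetric]) (simp add: mult.commute)
    then show ?thesis
      by (simp add: pd_form_trig[symmetric] complex_norm_square del: of_real_power)
  qed
  ultimately have "(CLINT x|\<nu>. complex_of_real ((norm (trig I cs x))\<^sup>2 * k x)) = pd_form cs cs (weighted_char I \<nu> k)"
    by (simp only: has_bochner_integral_integral_eq)
  then show ?thesis
    by (simp only: integral_complex_of_real)
qed

text \<open>The form of a weighted characteristic function is the integral of the squared polynomial
  against the weighted measure, which is finite. Positive definiteness of the difference is thus the
  inequality tested on all polynomials.\<close>

lemma density_le_if_pd:
  assumes I: "finite I" and s1: "sets \<nu>1 = sets (path_space I)" and s2: "sets \<nu>2 = sets (path_space I)"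
    and k1: "integrable \<nu>1 k1" "\<And>x. k1 x \<ge> 0" and k2: "integrable \<nu>2 k2" "\<And>x. k2 x \<ge> 0"
    and pd: "\<And>cs. 0 \<le> Re (pd_form cs cs (\<lambda>\<theta>. weighted_char I \<nu>1 k1 \<theta> - weighted_char I \<nu>2 k2 \<theta>))"
  shows "emeasure (density \<nu>2 k2) A \<le> emeasure (density \<nu>1 k1) A"
proof (rule measure_le_if_trig_le[OF _ _ _ _ I])
  show "sets (density \<nu>1 k1) = sets (path_space I)" "sets (density \<nu>2 k2) = sets (path_space I)"
    by (simp_all add: s1 s2)
  have "emeasure (density \<nu>1 k1) (space \<nu>1) < \<infinity>" "emeasure (density \<nu>2 k2) (space \<nu>2) < \<infinity>"
    using k1 k2 by (auto simp: emeasure_density nn_integral_eq_integral cong: nn_integral_cong)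
  then show "finite_measure (density \<nu>1 k1)" "finite_measure (density \<nu>2 k2)"
    by (auto intro!: finite_measureI)
  fix cs
  have "trig I cs \<in> borel_measurable \<nu>1" "trig I cs \<in> borel_measurable \<nu>2"
    unfolding measurable_cong_sets[OF s1 refl] measurable_cong_sets[OF s2 refl] by (simp_all add: trig_measurable)
  moreover have "(\<integral>x. (norm (trig I cs x))\<^sup>2 * k2 x \<partial>\<nu>2) \<le> (\<integral>x. (norm (trig I cs x))\<^sup>2 * k1 x \<partial>\<nu>1)"
    using pd[of cs] k1 k2 s1 s2 by (simp add: pd_form_diff pd_form_weighted_char[where T = I])
  ultimately show "(\<integral>x. (norm (trig I cs x))\<^sup>2 \<partial>density \<nu>2 k2) \<le> (\<integral>x. (norm (trig I cs x))\<^sup>2 \<partial>density \<nu>1 k1)"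
    using k1 k2 by (simp add: integral_density mult.commute)
qed

text \<open>Uniqueness of characteristic functions: the form of the difference vanishes, so the
  comparison holds in both directions.\<close>

lemma density_eq_if_weighted_char_eq:
  assumes I: "finite I" and s1: "sets \<nu>1 = sets (path_space I)" and s2: "sets \<nu>2 = sets (path_space I)"
    and k: "integrable \<nu>1 k1" "\<And>x. k1 x \<ge> 0" "integrable \<nu>2 k2" "\<And>x. k2 x \<ge> 0"
    and eq: "\<And>\<theta>. weighted_char I \<nu>1 k1 \<theta> = weighted_char I \<nu>2 k2 \<theta>"
  shows "density \<nu>1 k1 = density \<nu>2 k2"
proof (rule measure_eqI)
  fix A
  have z: "pd_form cs cs (\<lambda>_. 0) = 0" for cs :: "(complex \<times> ('a \<Rightarrow> real)) list"
    using pd_form_cmult[of cs cs 0 "\<lambda>_. 0"] by simp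
  show "emeasure (density \<nu>1 k1) A = emeasure (density \<nu>2 k2) A"
    by (intro antisym density_le_if_pd[OF I] s1 s2 k) (simp_all add: eq z)
qed (simp add: s1 s2)

section \<open>Second differences and cosine weights\<close>

text \<open>The sign gives characters the nonnegative eigenvalue \<open>cos_weight\<close>. Affine
  functions are annihilated and quadratic forms become constant.\<close>

definition second_diff :: "('t \<Rightarrow> real) \<Rightarrow> (('t \<Rightarrow> real) \<Rightarrow> complex) \<Rightarrow> ('t \<Rightarrow> real) \<Rightarrow> complex" where
  "second_diff h f \<theta> = 2 * f \<theta> - f (\<lambda>t. \<theta> t + h t) - f (\<lambda>t. \<theta> t - h t)"

definition cos_weight :: "'t set \<Rightarrow> ('t \<Rightarrow> real) \<Rightarrow> ('t \<Rightarrow> real) \<Rightarrow> real" where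
  "cos_weight I h x = 2 * (1 - cos (inner_prod_on I h x))"

lemma cos_weight_nonneg: "0 \<le> cos_weight I h x"
  by (simp add: cos_weight_def)

lemma cos_weight_le: "cos_weight I h x \<le> 4"
proof -
  have "cos_weight I h x \<le> 2 * (1 - (- 1))"
    unfolding cos_weight_def by (intro mult_left_mono diff_left_mono cos_ge_minus_one) simp
  then show ?thesis by simp
qed

lemma cos_weight_measurable:
  assumes "sets \<nu> = sets (path_space T)" "I \<subseteq> T"
  shows "cos_weight I h \<in> borel_measurable \<nu>"
  unfolding measurable_cong_sets[OF assms(1) refl] cos_weight_def
  using inner_prod_on_measurable[OF assms(2)] by measurable

lemma second_diff_iexp:
  "second_diff h (\<lambda>\<theta>. iexp (inner_prod_on I \<theta> x)) \<theta> = iexp (inner_prod_on I \<theta> x) * complex_of_real (cos_weight I h x)"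
proof -
  define u where "u = complex_of_real (inner_prod_on I h x)"
  have 1: "complex_of_real (cos (inner_prod_on I h x)) = (exp (\<i> * u) + exp (- (\<i> * u))) / 2"
    by (simp only: u_def cos_of_real[symmetric] cos_exp_eq)
  have 2: "iexp (inner_prod_on I (\<lambda>t. \<theta> t + h t) x) = iexp (inner_prod_on I \<theta> x) * exp (\<i> * u)"
    "iexp (inner_prod_on I (\<lambda>t. \<theta> t - h t) x) = iexp (inner_prod_on I \<theta> x) * exp (- (\<i> * u))"
    by (simp_all add: inner_prod_on_linear u_def distrib_left right_diff_distrib flip: exp_add)
  show ?thesis
    unfolding second_diff_def 2 by (simp add: cos_weight_def 1 algebra_simps)
qed

lemma second_diff_weighted_char:
  assumes s: "sets \<nu> = sets (path_space T)" and I: "I \<subseteq> T" and k: "integrable \<nu> k"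
  shows "second_diff h (weighted_char I \<nu> k) = weighted_char I \<nu> (\<lambda>x. k x * cos_weight I h x)"
proof
  fix \<theta>
  note i = integrable_iexp_mult[OF s I k]
  have 1: "second_diff h (weighted_char I \<nu> k) \<theta> =
      (CLINT x|\<nu>. second_diff h (\<lambda>\<theta>. iexp (inner_prod_on I \<theta> x) * complex_of_real (k x)) \<theta>)"
    unfolding weighted_char_def second_diff_def
    by (simp add: i Bochner_Integration.integral_diff Bochner_Integration.integrable_diff)
  have 2: "second_diff h (\<lambda>\<theta>. iexp (inner_prod_on I \<theta> x) * complex_of_real (k x)) \<theta> =
      iexp (inner_prod_on I \<theta> x) * complex_of_real (k x * cos_weight I h x)" for x
    using arg_cong[OF second_diff_iexp[of h I x \<theta>], of "\<lambda>z. complex_of_real (k x) * z"]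
    unfolding second_diff_def by (simp add: algebra_simps)
  show "second_diff h (weighted_char I \<nu> k) \<theta> = weighted_char I \<nu> (\<lambda>x. k x * cos_weight I h x) \<theta>"
    unfolding 1 2 weighted_char_def ..
qed

lemma integrable_mult_cos_weight:
  assumes s: "sets \<nu> = sets (path_space T)" and I: "I \<subseteq> T" and k: "integrable \<nu> k"
  shows "integrable \<nu> (\<lambda>x. k x * cos_weight I h x)"
proof (rule Bochner_Integration.integrable_bound)
  show "integrable \<nu> (\<lambda>x. 4 * k x)" using k by simp
  have "k \<in> borel_measurable \<nu>" using k by simp
  with cos_weight_measurable[OF s I] show "(\<lambda>x. k x * cos_weight I h x) \<in> borel_measurable \<nu>"
    by measurable
  show "AE x in \<nu>. norm (k x * cos_weight I h x) \<le> norm (4 * k x)"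
  proof (rule AE_I2)
    fix x
    have "\<bar>k x\<bar> * \<bar>cos_weight I h x\<bar> \<le> \<bar>k x\<bar> * 4"
      using cos_weight_nonneg[of I h x] cos_weight_le[of I h x] by (intro mult_left_mono) auto
    then show "norm (k x * cos_weight I h x) \<le> norm (4 * k x)"
      by (simp add: abs_mult)
  qed
qed

text \<open>Levy measures up to their mass at the origin, on which the exponent does not depend.\<close>

definition levy_integrable :: "'t set \<Rightarrow> ('t \<Rightarrow> real) measure \<Rightarrow> bool" where
  "levy_integrable T \<nu> \<longleftrightarrow> sets \<nu> = sets (path_space T) \<and>
     (\<forall>t\<in>T. (\<integral>\<^sup>+x. ennreal (min (\<bar>x t\<bar>\<^sup>2) 1) \<partial>\<nu>) < \<infinity>)"

text \<open>A sum of truncated squares instead of the truncated sum of squares: integrability can be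
  checked coordinatewise, and the zero set is the set of paths vanishing on
  \<open>I\<close>.\<close>

definition levy_weight :: "'t set \<Rightarrow> ('t \<Rightarrow> real) \<Rightarrow> real" where
  "levy_weight I x = (\<Sum>t\<in>I. min (\<bar>x t\<bar>\<^sup>2) 1)"

lemma levy_weight_nonneg: "0 \<le> levy_weight I x"
  by (simp add: levy_weight_def sum_nonneg)

lemma levy_weight_measurable [measurable]:
  "I \<subseteq> T \<Longrightarrow> levy_weight I \<in> borel_measurable (path_space T)"
  unfolding levy_weight_def
  by (intro borel_measurable_sum borel_measurable_min borel_measurable_const borel_measurable_power borel_measurable_abs measurable_component_singleton) auto

lemma integrable_levy_weight:
  assumes \<nu>: "levy_integrable T \<nu>" and I: "I \<subseteq> T"
  shows "integrable \<nu> (levy_weight I)"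
  unfolding levy_weight_def
proof (rule Bochner_Integration.integrable_sum)
  fix t assume t: "t \<in> I"
  have s: "sets \<nu> = sets (path_space T)" using \<nu> by (simp add: levy_integrable_def)
  have "(\<lambda>x. x t) \<in> borel_measurable \<nu>"
    unfolding measurable_cong_sets[OF s refl] using I t by (intro measurable_component_singleton) auto
  then have "(\<lambda>x. min (\<bar>x t\<bar>\<^sup>2) 1) \<in> borel_measurable \<nu>" by measurable
  then show "integrable \<nu> (\<lambda>x. min (\<bar>x t\<bar>\<^sup>2) 1)"
    using \<nu> I t by (intro integrableI_bounded) (auto simp: levy_integrable_def min_def)
qed

section \<open>Bounds for the truncation and the Levy--Khintchine integrand\<close>

text \<open>These estimates are all that is later used of the size of \<open>chi\<close>. The
  behaviour at 0 gives the quadratic error, the decay at infinity the bounded truncation, and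
  boundedness of \<open>chi\<close> fills the ranges in between.\<close>

lemma truncation_bounds:
  assumes chi: "truncation_factor chi"
  obtains K where "K \<ge> 0" "\<And>v. \<bar>v * chi \<bar>v\<bar>\<bar> \<le> K" "\<And>v. \<bar>v\<bar> \<le> 1 \<Longrightarrow> \<bar>v - v * chi \<bar>v\<bar>\<bar> \<le> K * v\<^sup>2"
proof -
  obtain B where B: "\<And>v. \<bar>chi v\<bar> \<le> B"
    using chi by (auto simp: truncation_factor_def bounded_iff)
  have B0: "B \<ge> 0" using B[of 0] by linarith
  have "\<forall>\<^sub>F v in at 0. norm (chi v - 1) \<le> 1 * norm \<bar>v\<bar>"
    using chi unfolding truncation_factor_def by (intro landau_o.smallD) auto
  then obtain d where d: "d > 0" "\<And>v. v \<noteq> 0 \<Longrightarrow> \<bar>v\<bar> < d \<Longrightarrow> \<bar>chi v - 1\<bar> \<le> \<bar>v\<bar>"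
    by (auto simp: eventually_at dist_real_def)
  obtain c where c: "c > 0" "\<forall>\<^sub>F v in at_infinity. norm (chi v) \<le> c * norm (inverse \<bar>v\<bar>)"
    using chi unfolding truncation_factor_def by (auto elim: landau_o.bigE)
  then obtain R where R: "\<And>v. R \<le> \<bar>v\<bar> \<Longrightarrow> \<bar>chi v\<bar> \<le> c / \<bar>v\<bar>"
    by (auto simp: eventually_at_infinity divide_inverse)
  \<comment> \<open>Four regimes: \<open>c\<close> for large arguments,
    \<open>\<bar>R\<bar> * B\<close> for the remaining ones in the first bound; 1 for arguments
    below \<open>d\<close> and \<open>(1 + B) / d\<close> for those between \<open>d\<close> and 1
    in the second.\<close>
  define K where "K = \<bar>R\<bar> * B + c + 1 + (1 + B) / d"
  have "0 \<le> (1 + B) / d" "0 \<le> \<bar>R\<bar> * B"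
    using B0 d(1) by simp_all
  then have K: "K \<ge> 1" "K \<ge> (1 + B) / d" "K \<ge> c" "K \<ge> \<bar>R\<bar> * B"
    using c(1) by (simp_all add: K_def)
  show ?thesis
  proof (rule that[of K])
    show "K \<ge> 0" using K by simp
    show "\<bar>v * chi \<bar>v\<bar>\<bar> \<le> K" for v
    proof (cases "v \<noteq> 0 \<and> R \<le> \<bar>v\<bar>")
      case True
      then have "\<bar>v\<bar> * \<bar>chi \<bar>v\<bar>\<bar> \<le> \<bar>v\<bar> * (c / \<bar>v\<bar>)"
        using R[of "\<bar>v\<bar>"] by (intro mult_left_mono) auto
      with True K show ?thesis by (simp add: abs_mult)
    next
      case False
      then have "\<bar>v\<bar> \<le> \<bar>R\<bar>" by auto
      then have "\<bar>v\<bar> * \<bar>chi \<bar>v\<bar>\<bar> \<le> \<bar>R\<bar> * B"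
        using B by (intro mult_mono) auto
      with K show ?thesis by (simp add: abs_mult)
    qed
    show "\<bar>v - v * chi \<bar>v\<bar>\<bar> \<le> K * v\<^sup>2" if "\<bar>v\<bar> \<le> 1" for v
    proof (cases "\<bar>v\<bar> < d")
      case True
      have "\<bar>v - v * chi \<bar>v\<bar>\<bar> = \<bar>v\<bar> * \<bar>chi \<bar>v\<bar> - 1\<bar>"
        by (metis abs_minus_commute abs_mult mult.right_neutral right_diff_distrib)
      also have "\<dots> \<le> \<bar>v\<bar> * \<bar>v\<bar>"
        using True d(2)[of "\<bar>v\<bar>"] by (cases "v = 0") (simp_all only: abs_zero mult_zero_left order_refl, intro mult_left_mono, simp_all)
      also have "\<dots> \<le> K * v\<^sup>2"
        using K(1) by (simp add: power2_eq_square mult_le_cancel_right1 flip: abs_mult)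
      finally show ?thesis .
    next
      case False
      have "\<bar>v - v * chi \<bar>v\<bar>\<bar> = \<bar>v\<bar> * \<bar>chi \<bar>v\<bar> - 1\<bar>"
        by (metis abs_minus_commute abs_mult mult.right_neutral right_diff_distrib)
      also have "\<dots> \<le> \<bar>v\<bar> * (1 + B)"
        using B[of "\<bar>v\<bar>"] by (intro mult_left_mono) auto
      also have "\<dots> \<le> \<bar>v\<bar> * (\<bar>v\<bar> * ((1 + B) / d))"
        using False B0 d(1) mult_right_mono[of d "\<bar>v\<bar>" "1 + B"]
        by (intro mult_left_mono) (auto simp: pos_le_divide_eq mult.commute)
      also have "\<dots> \<le> \<bar>v\<bar> * (\<bar>v\<bar> * K)"
        using K by (intro mult_left_mono) auto
      also have "\<dots> = K * v\<^sup>2"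
        by (simp add: power2_eq_square flip: abs_mult)
      finally show ?thesis .
    qed
  qed
qed

lemma abs_inner_prod_on_le:
  fixes \<theta> y :: "'t \<Rightarrow> real"
  assumes "\<And>t. t \<in> I \<Longrightarrow> \<bar>y t\<bar> \<le> c"
  shows "\<bar>inner_prod_on I \<theta> y\<bar> \<le> (\<Sum>t\<in>I. \<bar>\<theta> t\<bar>) * c"
proof -
  have "\<bar>inner_prod_on I \<theta> y\<bar> \<le> (\<Sum>t\<in>I. \<bar>\<theta> t\<bar> * \<bar>y t\<bar>)"
    unfolding inner_prod_on_def by (rule order_trans[OF sum_abs]) (simp add: abs_mult)
  also have "\<dots> \<le> (\<Sum>t\<in>I. \<bar>\<theta> t\<bar> * c)"
    using assms by (intro sum_mono mult_left_mono) auto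
  finally show ?thesis by (simp add: sum_distrib_right)
qed

text \<open>The growth in \<open>\<theta>\<close> is kept explicit and quadratic: both the
  domination along rays and the comparison with the Gaussian part depend on it.\<close>

lemma lk_integrand_bound:
  fixes I :: "'t set"
  assumes chi: "truncation_factor chi" and I: "finite I"
  obtains C where "C \<ge> 0" "\<And>\<theta> x. norm (lk_integrand chi I \<theta> x) \<le> C * (1 + (\<Sum>t\<in>I. \<bar>\<theta> t\<bar>))\<^sup>2 * levy_weight I x"
proof -
  obtain K where K: "K \<ge> 0" "\<And>v. \<bar>v * chi \<bar>v\<bar>\<bar> \<le> K" "\<And>v. \<bar>v\<bar> \<le> 1 \<Longrightarrow> \<bar>v - v * chi \<bar>v\<bar>\<bar> \<le> K * v\<^sup>2"
    using truncation_bounds[OF chi] by metis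
  show ?thesis
  proof (rule that[of "2 + K"])
    fix \<theta> x :: "'t \<Rightarrow> real"
    define B where "B = (\<Sum>t\<in>I. \<bar>\<theta> t\<bar>)"
    define W where "W = levy_weight I x"
    define u where "u = inner_prod_on I \<theta> x"
    have B: "B \<ge> 0" by (simp add: B_def sum_nonneg)
    have W: "W \<ge> 0" by (simp add: W_def levy_weight_nonneg)
    have comp: "min (\<bar>x t\<bar>\<^sup>2) 1 \<le> W" if "t \<in> I" for t
      unfolding W_def levy_weight_def using I that by (intro member_le_sum) auto
    \<comment> \<open>If all coordinates are at most 1 in modulus, the second-order Taylor estimate
      applies. Otherwise the weight is at least 1 and a bounded estimate of the integrand
      suffices.\<close>
    have "norm (lk_integrand chi I \<theta> x) \<le> (2 + K * B + B\<^sup>2) * W"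
    proof (cases "\<forall>t\<in>I. \<bar>x t\<bar> \<le> 1")
      case True
      have x2: "(x t)\<^sup>2 \<le> W" if "t \<in> I" for t
        using comp[OF that] True that by (auto simp: min_def abs_square_le_1 split: if_splits)
      have "\<bar>u\<bar> \<le> B * sqrt W"
        unfolding u_def B_def using x2 by (intro abs_inner_prod_on_le) (simp add: real_le_rsqrt)
      then have "u\<^sup>2 \<le> (B * sqrt W)\<^sup>2"
        by (metis abs_ge_zero power2_abs power_mono)
      then have u2: "u\<^sup>2 \<le> B\<^sup>2 * W"
        using W by (simp add: power_mult_distrib)
      have "inner_prod_on I \<theta> x - inner_prod_on I \<theta> (truncate chi x) = inner_prod_on I \<theta> (\<lambda>t. x t - x t * chi \<bar>x t\<bar>)"
        by (simp add: inner_prod_on_def truncate_def right_diff_distrib sum_subtractf)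
      also have "\<bar>\<dots>\<bar> \<le> B * (K * W)"
        unfolding B_def
      proof (rule abs_inner_prod_on_le)
        fix t assume t: "t \<in> I"
        then have "\<bar>x t - x t * chi \<bar>x t\<bar>\<bar> \<le> K * (x t)\<^sup>2"
          using True by (intro K) auto
        also have "\<dots> \<le> K * W"
          using x2[OF t] K(1) by (rule mult_left_mono)
        finally show "\<bar>x t - x t * chi \<bar>x t\<bar>\<bar> \<le> K * W" .
      qed
      finally have tr: "\<bar>inner_prod_on I \<theta> x - inner_prod_on I \<theta> (truncate chi x)\<bar> \<le> B * (K * W)" .
      have "lk_integrand chi I \<theta> x = (iexp u - 1 - \<i> * complex_of_real u) +
          \<i> * complex_of_real (inner_prod_on I \<theta> x - inner_prod_on I \<theta> (truncate chi x))"
        by (simp add: lk_integrand_def u_def algebra_simps)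
      also have "norm \<dots> \<le> norm (iexp u - 1 - \<i> * complex_of_real u) + \<bar>inner_prod_on I \<theta> x - inner_prod_on I \<theta> (truncate chi x)\<bar>"
        by (rule order_trans[OF norm_triangle_ineq]) (simp add: norm_mult del: of_real_diff)
      also have "norm (iexp u - 1 - \<i> * complex_of_real u) \<le> u\<^sup>2 / 2"
        using iexp_approx1[of u 1] by (simp add: algebra_simps eval_nat_numeral)
      also have "u\<^sup>2 / 2 + \<bar>inner_prod_on I \<theta> x - inner_prod_on I \<theta> (truncate chi x)\<bar> \<le> B\<^sup>2 * W + B * (K * W)"
        using u2 tr zero_le_power2[of u] by linarith
      also have "\<dots> \<le> (2 + K * B + B\<^sup>2) * W"
        using W by (simp add: algebra_simps)
      finally show ?thesis by simp
    next
      case False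
      then obtain t where "t \<in> I" "\<not> \<bar>x t\<bar> \<le> 1" by auto
      then have W1: "W \<ge> 1"
        using comp[of t] by (auto simp: min_def power_le_one_iff abs_square_le_1 split: if_splits)
      have "norm (lk_integrand chi I \<theta> x) \<le> norm (iexp u - 1) + \<bar>inner_prod_on I \<theta> (truncate chi x)\<bar>"
        unfolding lk_integrand_def u_def
        by (rule order_trans[OF norm_triangle_ineq4]) (simp add: norm_mult)
      also have "norm (iexp u - 1) \<le> 2"
        by (rule order_trans[OF norm_triangle_ineq4]) simp
      also have "\<bar>inner_prod_on I \<theta> (truncate chi x)\<bar> \<le> B * K"
        unfolding B_def using K by (intro abs_inner_prod_on_le) (auto simp: truncate_def)
      also have "2 + B * K \<le> (2 + K * B + B\<^sup>2) * 1"
        by (simp add: mult.commute)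
      also have "\<dots> \<le> (2 + K * B + B\<^sup>2) * W"
        using W1 K B by (intro mult_left_mono add_nonneg_nonneg) auto
      finally show ?thesis by simp
    qed
    also have "\<dots> \<le> (2 + K) * (1 + B)\<^sup>2 * W"
    proof (rule mult_right_mono[OF _ W])
      have "0 \<le> K * B" "0 \<le> K * B\<^sup>2" using K B by simp_all
      then show "2 + K * B + B\<^sup>2 \<le> (2 + K) * (1 + B)\<^sup>2"
        using K B by (simp add: power2_eq_square algebra_simps add_increasing)
    qed
    finally show "norm (lk_integrand chi I \<theta> x) \<le> (2 + K) * (1 + (\<Sum>t\<in>I. \<bar>\<theta> t\<bar>))\<^sup>2 * levy_weight I x"
      by (simp add: B_def W_def)
  qed (use K in simp)
qed

section \<open>The Levy--Khintchine exponent\<close>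

lemma lk_integrand_measurable:
  assumes chi: "truncation_factor chi" and s: "sets \<nu> = sets (path_space T)" and I: "I \<subseteq> T"
  shows "lk_integrand chi I \<theta> \<in> borel_measurable \<nu>"
proof -
  have [measurable]: "chi \<in> borel_measurable borel"
    using chi by (simp add: truncation_factor_def)
  have "(\<lambda>x. x t * chi \<bar>x t\<bar>) \<in> borel_measurable (path_space T)" if "t \<in> I" for t
  proof -
    have [measurable]: "(\<lambda>x. x t) \<in> borel_measurable (path_space T)"
      using that I by (intro measurable_component_singleton) auto
    show ?thesis by measurable
  qed
  then have [measurable]: "(\<lambda>x. inner_prod_on I \<theta> (truncate chi x)) \<in> borel_measurable (path_space T)"
    unfolding inner_prod_on_def truncate_def
    by (intro borel_measurable_sum borel_measurable_times[OF borel_measurable_const])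
  note [measurable] = inner_prod_on_measurable[OF I]
  show ?thesis
    unfolding measurable_cong_sets[OF s refl] lk_integrand_def by measurable
qed

lemma levy_integrable_sets: "levy_integrable T \<nu> \<Longrightarrow> sets \<nu> = sets (path_space T)"
  by (simp add: levy_integrable_def)

lemma integrable_lk_integrand:
  assumes chi: "truncation_factor chi" and \<nu>: "levy_integrable T \<nu>" and I: "finite I" "I \<subseteq> T"
  shows "integrable \<nu> (lk_integrand chi I \<theta>)"
proof -
  obtain C where C: "C \<ge> 0"
    "\<And>\<theta> x. norm (lk_integrand chi I \<theta> x) \<le> C * (1 + (\<Sum>t\<in>I. \<bar>\<theta> t\<bar>))\<^sup>2 * levy_weight I x"
    using lk_integrand_bound[OF chi I(1)] by blast
  show ?thesis
  proof (rule Bochner_Integration.integrable_bound)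
    show "integrable \<nu> (\<lambda>x. C * (1 + (\<Sum>t\<in>I. \<bar>\<theta> t\<bar>))\<^sup>2 * levy_weight I x)"
      by (intro integrable_mult_right integrable_levy_weight[OF \<nu> I(2)])
    show "lk_integrand chi I \<theta> \<in> borel_measurable \<nu>"
      by (rule lk_integrand_measurable[OF chi levy_integrable_sets[OF \<nu>] I(2)])
    show "AE x in \<nu>. norm (lk_integrand chi I \<theta> x) \<le> norm (C * (1 + (\<Sum>t\<in>I. \<bar>\<theta> t\<bar>))\<^sup>2 * levy_weight I x)"
      using C(2)[of \<theta>] by (intro AE_I2) (simp add: order_trans[OF _ abs_ge_self])
  qed
qed

text \<open>The constant and the truncation term are affine in \<open>\<theta>\<close> and
  disappear, so the result no longer involves \<open>chi\<close>.\<close>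

lemma second_diff_lk_integrand:
  "second_diff h (\<lambda>\<theta>. lk_integrand chi I \<theta> x) \<theta> = iexp (inner_prod_on I \<theta> x) * complex_of_real (cos_weight I h x)"
  unfolding second_diff_iexp[symmetric]
  by (simp add: second_diff_def lk_integrand_def inner_prod_on_linear algebra_simps)

text \<open>The weight is the second difference of the integrand at the zero frequency, so it
  inherits integrability without a separate estimate.\<close>

lemma integrable_cos_weight:
  assumes chi: "truncation_factor chi" and \<nu>: "levy_integrable T \<nu>" and I: "finite I" "I \<subseteq> T"
  shows "integrable \<nu> (cos_weight I h)"
proof -
  have "integrable \<nu> (\<lambda>x. second_diff h (\<lambda>\<theta>. lk_integrand chi I \<theta> x) (\<lambda>_. 0))"
    unfolding second_diff_def
    by (intro Bochner_Integration.integrable_diff integrable_mult_right integrable_lk_integrand[OF chi \<nu> I])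
  then have "integrable \<nu> (\<lambda>x. complex_of_real (cos_weight I h x))"
    unfolding second_diff_lk_integrand by (simp add: inner_prod_on_linear)
  then show ?thesis
    by (simp add: complex_of_real_integrable_eq)
qed

lemma second_diff_integral_lk_integrand:
  assumes chi: "truncation_factor chi" and \<nu>: "levy_integrable T \<nu>" and I: "finite I" "I \<subseteq> T"
  shows "second_diff h (\<lambda>\<theta>. CLINT x|\<nu>. lk_integrand chi I \<theta> x) = weighted_char I \<nu> (cos_weight I h)"
proof
  fix \<theta>
  note i = integrable_lk_integrand[OF chi \<nu> I]
  have "second_diff h (\<lambda>\<theta>. CLINT x|\<nu>. lk_integrand chi I \<theta> x) \<theta> =
      (CLINT x|\<nu>. second_diff h (\<lambda>\<theta>. lk_integrand chi I \<theta> x) \<theta>)"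
    unfolding second_diff_def
    by (simp add: i Bochner_Integration.integral_diff Bochner_Integration.integrable_diff)
  then show "second_diff h (\<lambda>\<theta>. CLINT x|\<nu>. lk_integrand chi I \<theta> x) \<theta> = weighted_char I \<nu> (cos_weight I h) \<theta>"
    unfolding second_diff_lk_integrand weighted_char_def .
qed

lemma second_diff_linear:
  "second_diff h (\<lambda>\<theta>. f \<theta> - g \<theta>) \<theta> = second_diff h f \<theta> - second_diff h g \<theta>"
  "second_diff h (\<lambda>\<theta>. f \<theta> + g \<theta>) \<theta> = second_diff h f \<theta> + second_diff h g \<theta>"
  "second_diff h (\<lambda>\<theta>. a * f \<theta>) \<theta> = a * second_diff h f \<theta>"
  "second_diff h (\<lambda>_. a) \<theta> = 0"
  unfolding second_diff_def by (simp_all add: algebra_simps)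

lemma quad_form_on_parallelogram:
  "quad_form_on I (\<lambda>t. \<theta> t + h t) S + quad_form_on I (\<lambda>t. \<theta> t - h t) S = 2 * quad_form_on I \<theta> S + 2 * quad_form_on I h S"
proof -
  have "quad_form_on I (\<lambda>t. \<theta> t + h t) S + quad_form_on I (\<lambda>t. \<theta> t - h t) S =
      (\<Sum>s\<in>I. \<Sum>t\<in>I. (\<theta> s + h s) * S (s, t) * (\<theta> t + h t) + (\<theta> s - h s) * S (s, t) * (\<theta> t - h t))"
    unfolding quad_form_on_def by (simp only: sum.distrib)
  also have "\<dots> = (\<Sum>s\<in>I. \<Sum>t\<in>I. 2 * (\<theta> s * S (s, t) * \<theta> t) + 2 * (h s * S (s, t) * h t))"
    by (intro sum.cong refl) (simp add: algebra_simps)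
  also have "\<dots> = 2 * quad_form_on I \<theta> S + 2 * quad_form_on I h S"
    unfolding quad_form_on_def by (simp only: sum.distrib sum_distrib_left)
  finally show ?thesis .
qed

lemma second_diff_lk_exponent:
  "second_diff h (lk_exponent chi I S J b) \<theta> =
     complex_of_real (quad_form_on I h S) + second_diff h (\<lambda>\<theta>. J (lk_integrand chi I \<theta>)) \<theta>"
proof -
  have "complex_of_real (quad_form_on I (\<lambda>t. \<theta> t + h t) S) + complex_of_real (quad_form_on I (\<lambda>t. \<theta> t - h t) S) =
      2 * complex_of_real (quad_form_on I \<theta> S) + 2 * complex_of_real (quad_form_on I h S)"
    using arg_cong[OF quad_form_on_parallelogram[of I \<theta> h S], of complex_of_real] by simp
  then have "complex_of_real (quad_form_on I (\<lambda>t. \<theta> t + h t) S) / 2 =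
      complex_of_real (quad_form_on I \<theta> S) + complex_of_real (quad_form_on I h S) -
      complex_of_real (quad_form_on I (\<lambda>t. \<theta> t - h t) S) / 2"
    by (simp add: field_simps)
  then show ?thesis
    by (simp add: second_diff_def lk_exponent_def inner_prod_on_linear algebra_simps)
qed

abbreviation diff_integral :: "('t \<Rightarrow> real) measure \<Rightarrow> ('t \<Rightarrow> real) measure \<Rightarrow> (('t \<Rightarrow> real) \<Rightarrow> complex) \<Rightarrow> complex" where
  "diff_integral \<nu>1 \<nu>2 g \<equiv> (CLINT x|\<nu>1. g x) - (CLINT x|\<nu>2. g x)"

text \<open>A second application of \<open>second_diff\<close> removes the Gaussian part.\<close>

lemma second_diff_second_diff_lk_exponent:
  assumes chi: "truncation_factor chi" and \<nu>1: "levy_integrable T \<nu>1" and \<nu>2: "levy_integrable T \<nu>2"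
    and I: "finite I" "I \<subseteq> T"
  shows "second_diff h (second_diff h (lk_exponent chi I S (diff_integral \<nu>1 \<nu>2) b)) \<theta> =
     weighted_char I \<nu>1 (\<lambda>x. (cos_weight I h x)\<^sup>2) \<theta> - weighted_char I \<nu>2 (\<lambda>x. (cos_weight I h x)\<^sup>2) \<theta>"
proof -
  have 1: "second_diff h (lk_exponent chi I S (diff_integral \<nu>1 \<nu>2) b) =
      (\<lambda>\<theta>. complex_of_real (quad_form_on I h S) + (weighted_char I \<nu>1 (cos_weight I h) \<theta> - weighted_char I \<nu>2 (cos_weight I h) \<theta>))"
    by (rule ext) (simp add: second_diff_lk_exponent second_diff_linear
      second_diff_integral_lk_integrand[OF chi \<nu>1 I] second_diff_integral_lk_integrand[OF chi \<nu>2 I])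
  have 2: "second_diff h (weighted_char I \<nu> (cos_weight I h)) = weighted_char I \<nu> (\<lambda>x. (cos_weight I h x)\<^sup>2)"
    if "levy_integrable T \<nu>" for \<nu>
    using second_diff_weighted_char[OF levy_integrable_sets[OF that] I(2) integrable_cos_weight[OF chi that I, of h], of h]
    by (simp add: power2_eq_square)
  show ?thesis
    unfolding 1 by (simp add: second_diff_linear 2[OF \<nu>1] 2[OF \<nu>2])
qed

section \<open>Continuity along rays and uniqueness of the logarithm\<close>

text \<open>For factors between 0 and 1 the bound at \<open>\<theta>\<close> dominates the bound at
  every point of the segment, so a single integrable function serves for dominated
  convergence.\<close>

lemma continuous_on_integral_lk_integrand_ray:
  assumes chi: "truncation_factor chi" and \<nu>: "levy_integrable T \<nu>" and I: "finite I" "I \<subseteq> T"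
  shows "continuous_on {0..1} (\<lambda>s. CLINT x|\<nu>. lk_integrand chi I (\<lambda>t. s * \<theta> t) x)"
proof (rule continuous_on_sequentiallyI)
  fix u :: "nat \<Rightarrow> real" and a assume u: "\<forall>n. u n \<in> {0..1}" "u \<longlonglongrightarrow> a"
  obtain C where C: "C \<ge> 0"
    "\<And>\<theta> x. norm (lk_integrand chi I \<theta> x) \<le> C * (1 + (\<Sum>t\<in>I. \<bar>\<theta> t\<bar>))\<^sup>2 * levy_weight I x"
    using lk_integrand_bound[OF chi I(1)] by blast
  note meas = lk_integrand_measurable[OF chi levy_integrable_sets[OF \<nu>] I(2)]
  show "(\<lambda>n. CLINT x|\<nu>. lk_integrand chi I (\<lambda>t. u n * \<theta> t) x) \<longlonglongrightarrow> (CLINT x|\<nu>. lk_integrand chi I (\<lambda>t. a * \<theta> t) x)"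
  proof (rule integral_dominated_convergence[where w = "\<lambda>x. C * (1 + (\<Sum>t\<in>I. \<bar>\<theta> t\<bar>))\<^sup>2 * levy_weight I x"])
    show "integrable \<nu> (\<lambda>x. C * (1 + (\<Sum>t\<in>I. \<bar>\<theta> t\<bar>))\<^sup>2 * levy_weight I x)"
      by (intro integrable_mult_right integrable_levy_weight[OF \<nu> I(2)])
    have "(\<lambda>n. lk_integrand chi I (\<lambda>t. u n * \<theta> t) x) \<longlonglongrightarrow> lk_integrand chi I (\<lambda>t. a * \<theta> t) x" for x
      unfolding lk_integrand_def inner_prod_on_linear
      by (intro tendsto_intros u tendsto_of_real tendsto_exp)
    then show "AE x in \<nu>. (\<lambda>n. lk_integrand chi I (\<lambda>t. u n * \<theta> t) x) \<longlonglongrightarrow> lk_integrand chi I (\<lambda>t. a * \<theta> t) x"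
      by simp
    fix n
    have "(\<Sum>t\<in>I. \<bar>u n * \<theta> t\<bar>) \<le> (\<Sum>t\<in>I. \<bar>\<theta> t\<bar>)"
      using u(1) by (intro sum_mono) (auto simp: abs_mult mult_left_le_one_le)
    then have "(1 + (\<Sum>t\<in>I. \<bar>u n * \<theta> t\<bar>))\<^sup>2 \<le> (1 + (\<Sum>t\<in>I. \<bar>\<theta> t\<bar>))\<^sup>2"
      by (intro power_mono) (auto intro!: add_nonneg_nonneg sum_nonneg)
    then have "norm (lk_integrand chi I (\<lambda>t. u n * \<theta> t) x) \<le> C * (1 + (\<Sum>t\<in>I. \<bar>\<theta> t\<bar>))\<^sup>2 * levy_weight I x" for x
      using C(1) by (intro order_trans[OF C(2)] mult_right_mono mult_left_mono levy_weight_nonneg)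
    then show "AE x in \<nu>. norm (lk_integrand chi I (\<lambda>t. u n * \<theta> t) x) \<le> C * (1 + (\<Sum>t\<in>I. \<bar>\<theta> t\<bar>))\<^sup>2 * levy_weight I x"
      by simp
  qed (rule meas)+
qed

lemma quad_form_on_scale: "quad_form_on I (\<lambda>t. r * \<theta> t) S = r\<^sup>2 * quad_form_on I \<theta> S"
  unfolding quad_form_on_def sum_distrib_left by (intro sum.cong refl) (simp add: power2_eq_square)

lemma continuous_on_lk_exponent_ray:
  assumes chi: "truncation_factor chi" and \<nu>1: "levy_integrable T \<nu>1" and \<nu>2: "levy_integrable T \<nu>2"
    and I: "finite I" "I \<subseteq> T"
  shows "continuous_on {0..1} (\<lambda>s. lk_exponent chi I S (diff_integral \<nu>1 \<nu>2) b (\<lambda>t. s * \<theta> t))"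
  unfolding lk_exponent_def inner_prod_on_linear quad_form_on_scale
  by (intro continuous_intros continuous_on_integral_lk_integrand_ray[OF chi \<nu>1 I]
    continuous_on_integral_lk_integrand_ray[OF chi \<nu>2 I]) auto

lemma lk_exponent_0: "lk_exponent chi I S (diff_integral \<nu>1 \<nu>2) b (\<lambda>_. 0) = 0"
proof -
  have "lk_integrand chi I (\<lambda>_. 0) = (\<lambda>_. 0)"
    by (rule ext) (simp add: lk_integrand_def inner_prod_on_linear)
  then show ?thesis
    by (simp add: lk_exponent_def inner_prod_on_linear quad_form_on_def)
qed

text \<open>The values lie in the discrete set of multiples of 2\<pi>i, so a continuous function on
  a connected interval is constant; the value at 0 selects the branch.\<close>

lemma exp_eq_one_ray:
  fixes d :: "real \<Rightarrow> complex"
  assumes d: "continuous_on {0..1} d" "d 0 = 0" and e: "\<And>s. s \<in> {0..1} \<Longrightarrow> exp (d s) = 1"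
  shows "d 1 = 0"
proof -
  have "d constant_on {0..1}"
  proof (rule continuous_discrete_range_constant)
    fix x :: real assume x: "x \<in> {0..1}"
    have "2 * pi \<le> norm (d y - d x)" if y: "y \<in> {0..1}" "d y \<noteq> d x" for y
    proof (rule ccontr)
      assume "\<not> 2 * pi \<le> norm (d y - d x)"
      then have "\<bar>Im (d y) - Im (d x)\<bar> < 2 * pi"
        using abs_Im_le_cmod[of "d y - d x"] by simp
      moreover have "exp (d y) = exp (d x)"
        using e[OF x] e[OF y(1)] by (simp only:)
      ultimately have "d y = d x"
        by (rule exp_complex_eqI)
      with y show False by simp
    qed
    then show "\<exists>e>0. \<forall>y. y \<in> {0..1} \<and> d y \<noteq> d x \<longrightarrow> e \<le> norm (d y - d x)"
      by (intro exI[of _ "2 * pi"]) auto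
  qed (use d in auto)
  then obtain c where c: "\<And>s. s \<in> {0..1} \<Longrightarrow> d s = c"
    by (auto simp: constant_on_def)
  show ?thesis
    using c[of 0] c[of 1] d(2) by simp
qed

text \<open>Both exponents are continuous along the segment from 0 to \<open>\<theta>\<close> and
  vanish at 0. Working on rays replaces any topology on the space of frequencies by that of an
  interval.\<close>

lemma lk_exponent_eq_if_exp_eq:
  assumes chi: "truncation_factor chi" and I: "finite I" "I \<subseteq> T"
    and \<nu>: "levy_integrable T \<nu>1" "levy_integrable T \<nu>2" "levy_integrable T \<mu>1" "levy_integrable T \<mu>2"
    and e: "\<And>\<theta>. exp (lk_exponent chi I S (diff_integral \<nu>1 \<nu>2) b \<theta>) = exp (lk_exponent chi I S' (diff_integral \<mu>1 \<mu>2) b' \<theta>)"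
  shows "lk_exponent chi I S (diff_integral \<nu>1 \<nu>2) b \<theta> = lk_exponent chi I S' (diff_integral \<mu>1 \<mu>2) b' \<theta>"
proof -
  let ?d = "\<lambda>s. lk_exponent chi I S (diff_integral \<nu>1 \<nu>2) b (\<lambda>t. s * \<theta> t) - lk_exponent chi I S' (diff_integral \<mu>1 \<mu>2) b' (\<lambda>t. s * \<theta> t)"
  have "?d 1 = 0"
  proof (rule exp_eq_one_ray)
    show "continuous_on {0..1} ?d"
      by (intro continuous_on_diff continuous_on_lk_exponent_ray[OF chi _ _ I] \<nu>)
    show "exp (?d s) = 1" for s
      by (simp add: exp_diff e)
  qed (simp add: lk_exponent_0)
  then show ?thesis by simp
qed

text \<open>Along the ray \<open>n \<theta>\<close> the Gaussian part dominates the exponent, of order \<open>n\<^sup>2\<close>.\<close>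

lemma quad_form_on_nonneg_if_norm_exp_le_1:
  assumes chi: "truncation_factor chi" and \<nu>1: "levy_integrable T \<nu>1" and \<nu>2: "levy_integrable T \<nu>2"
    and I: "finite I" "I \<subseteq> T"
    and le: "\<And>\<theta>. norm (exp (lk_exponent chi I S (diff_integral \<nu>1 \<nu>2) b \<theta>)) \<le> 1"
  shows "0 \<le> quad_form_on I \<theta> S"
proof -
  obtain C where C: "C \<ge> 0"
    "\<And>\<theta> x. norm (lk_integrand chi I \<theta> x) \<le> C * (1 + (\<Sum>t\<in>I. \<bar>\<theta> t\<bar>))\<^sup>2 * levy_weight I x"
    using lk_integrand_bound[OF chi I(1)] by blast
  let ?B = "\<Sum>t\<in>I. \<bar>\<theta> t\<bar>"
  let ?n = "\<lambda>n. real (Suc n)"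
  have B: "?B \<ge> 0" by (simp add: sum_nonneg)
  have lim: "(\<lambda>n. Re (CLINT x|\<nu>. lk_integrand chi I (\<lambda>t. ?n n * \<theta> t) x) / (?n n)\<^sup>2) \<longlonglongrightarrow> 0"
    if \<nu>: "levy_integrable T \<nu>" for \<nu>
  proof -
    note i = integrable_lk_integrand[OF chi \<nu> I]
    \<comment> \<open>The integrand grows at most quadratically in the frequency, so division by the
      squared factor leaves one dominating function for the whole sequence.\<close>
    have "(\<lambda>n. \<integral>x. Re (lk_integrand chi I (\<lambda>t. ?n n * \<theta> t) x) / (?n n)\<^sup>2 \<partial>\<nu>) \<longlonglongrightarrow> (\<integral>x. 0 \<partial>\<nu>)"
    proof (rule integral_dominated_convergence[where w = "\<lambda>x. C * (1 + ?B)\<^sup>2 * levy_weight I x"])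
      show "integrable \<nu> (\<lambda>x. C * (1 + ?B)\<^sup>2 * levy_weight I x)"
        by (intro integrable_mult_right integrable_levy_weight[OF \<nu> I(2)])
      show "AE x in \<nu>. norm (Re (lk_integrand chi I (\<lambda>t. ?n n * \<theta> t) x) / (?n n)\<^sup>2) \<le> C * (1 + ?B)\<^sup>2 * levy_weight I x" for n
      proof (rule AE_I2)
        fix x
        have "\<bar>Re (lk_integrand chi I (\<lambda>t. ?n n * \<theta> t) x)\<bar> \<le> norm (lk_integrand chi I (\<lambda>t. ?n n * \<theta> t) x)"
          by (rule abs_Re_le_cmod)
        also have "\<dots> \<le> C * (1 + (\<Sum>t\<in>I. \<bar>?n n * \<theta> t\<bar>))\<^sup>2 * levy_weight I x"
          by (rule C(2))
        also have "\<dots> \<le> C * (?n n * (1 + ?B))\<^sup>2 * levy_weight I x"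
        proof (intro mult_right_mono mult_left_mono power_mono levy_weight_nonneg C(1))
          have "(\<Sum>t\<in>I. \<bar>?n n * \<theta> t\<bar>) = ?n n * ?B"
            by (simp add: sum_distrib_left abs_mult)
          then show "1 + (\<Sum>t\<in>I. \<bar>?n n * \<theta> t\<bar>) \<le> ?n n * (1 + ?B)"
            by (simp add: distrib_left)
          show "0 \<le> 1 + (\<Sum>t\<in>I. \<bar>?n n * \<theta> t\<bar>)"
            by (intro add_nonneg_nonneg sum_nonneg) auto
        qed
        also have "\<dots> = (C * (1 + ?B)\<^sup>2 * levy_weight I x) * (?n n)\<^sup>2"
          by (simp add: power_mult_distrib)
        finally show "norm (Re (lk_integrand chi I (\<lambda>t. ?n n * \<theta> t) x) / (?n n)\<^sup>2) \<le> C * (1 + ?B)\<^sup>2 * levy_weight I x"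
          by (simp add: pos_divide_le_eq)
      qed
      \<comment> \<open>The truncation term is imaginary; the real part is a cosine minus 1, bounded
        by 2, and the division sends it to 0.\<close>
      have "(\<lambda>n. Re (lk_integrand chi I (\<lambda>t. ?n n * \<theta> t) x) / (?n n)\<^sup>2) \<longlonglongrightarrow> 0" for x
      proof (rule tendsto_0_le)
        show "(\<lambda>n. 1 / ?n n) \<longlonglongrightarrow> 0"
          using LIMSEQ_Suc[OF lim_1_over_n[where ?'a = real]] by simp
        show "\<forall>\<^sub>F n in sequentially. norm (Re (lk_integrand chi I (\<lambda>t. ?n n * \<theta> t) x) / (?n n)\<^sup>2) \<le> norm (1 / ?n n) * 2"
        proof (intro always_eventually allI)
          fix n
          have "Re (lk_integrand chi I (\<lambda>t. ?n n * \<theta> t) x) = cos (?n n * inner_prod_on I \<theta> x) - 1"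
            by (simp add: lk_integrand_def inner_prod_on_linear Re_exp)
          moreover have "\<bar>cos (?n n * inner_prod_on I \<theta> x) - 1\<bar> \<le> 2"
            by (rule order_trans[OF abs_triangle_ineq4]) (use abs_cos_le_one in auto)
          ultimately have "norm (Re (lk_integrand chi I (\<lambda>t. ?n n * \<theta> t) x) / (?n n)\<^sup>2) \<le> 2 / (?n n)\<^sup>2"
            by (simp add: divide_right_mono)
          also have "\<dots> \<le> norm (1 / ?n n) * 2"
          proof -
            have "2 / (?n n)\<^sup>2 \<le> 2 / ?n n"
              by (intro divide_left_mono) (auto simp: power2_eq_square simp del: of_nat_Suc)
            then show ?thesis by simp
          qed
          finally show "norm (Re (lk_integrand chi I (\<lambda>t. ?n n * \<theta> t) x) / (?n n)\<^sup>2) \<le> norm (1 / ?n n) * 2" .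
        qed
      qed
      then show "AE x in \<nu>. (\<lambda>n. Re (lk_integrand chi I (\<lambda>t. ?n n * \<theta> t) x) / (?n n)\<^sup>2) \<longlonglongrightarrow> 0"
        by simp
    qed (use i in simp_all)
    moreover have "(\<integral>x. Re (lk_integrand chi I (\<lambda>t. ?n n * \<theta> t) x) / (?n n)\<^sup>2 \<partial>\<nu>) =
        Re (CLINT x|\<nu>. lk_integrand chi I (\<lambda>t. ?n n * \<theta> t) x) / (?n n)\<^sup>2" for n
      using i by simp
    ultimately show ?thesis by simp
  qed
  have "(\<lambda>n. - quad_form_on I \<theta> S / 2 + (Re (CLINT x|\<nu>1. lk_integrand chi I (\<lambda>t. ?n n * \<theta> t) x) / (?n n)\<^sup>2
      - Re (CLINT x|\<nu>2. lk_integrand chi I (\<lambda>t. ?n n * \<theta> t) x) / (?n n)\<^sup>2)) \<longlonglongrightarrow> - quad_form_on I \<theta> S / 2 + (0 - 0)"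
    by (intro tendsto_intros lim \<nu>1 \<nu>2)
  moreover have "- quad_form_on I \<theta> S / 2 + (Re (CLINT x|\<nu>1. lk_integrand chi I (\<lambda>t. ?n n * \<theta> t) x) / (?n n)\<^sup>2
      - Re (CLINT x|\<nu>2. lk_integrand chi I (\<lambda>t. ?n n * \<theta> t) x) / (?n n)\<^sup>2) \<le> 0" for n
  proof -
    let ?e = "lk_exponent chi I S (diff_integral \<nu>1 \<nu>2) b (\<lambda>t. ?n n * \<theta> t)"
    have "Re ?e \<le> 0"
      using le[of "\<lambda>t. ?n n * \<theta> t"] by simp
    then have "Re ?e / (?n n)\<^sup>2 \<le> 0"
      by (simp add: divide_nonpos_pos)
    also have "Re ?e / (?n n)\<^sup>2 = - quad_form_on I \<theta> S / 2 + (Re (CLINT x|\<nu>1. lk_integrand chi I (\<lambda>t. ?n n * \<theta> t) x) / (?n n)\<^sup>2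
        - Re (CLINT x|\<nu>2. lk_integrand chi I (\<lambda>t. ?n n * \<theta> t) x) / (?n n)\<^sup>2)"
      unfolding lk_exponent_def quad_form_on_scale by (simp add: add_divide_distrib diff_divide_distrib del: of_nat_Suc)
    finally show ?thesis .
  qed
  ultimately have "- quad_form_on I \<theta> S / 2 + (0 - 0) \<le> 0"
    by (intro tendsto_upperbound) auto
  then show ?thesis by simp
qed

section \<open>Uniqueness on finite index sets\<close>

lemma emeasure_eq_on_countable_cover:
  fixes E :: "'i \<Rightarrow> 'a set"
  assumes sets: "sets \<mu>2 = sets \<mu>1" and C: "countable C"
    and E: "\<And>i. i \<in> C \<Longrightarrow> E i \<in> sets \<mu>1"
    and eq: "\<And>A i. i \<in> C \<Longrightarrow> A \<in> sets \<mu>1 \<Longrightarrow> A \<subseteq> E i \<Longrightarrow> emeasure \<mu>1 A = emeasure \<mu>2 A"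
    and A: "A \<in> sets \<mu>1" "A \<subseteq> (\<Union>i\<in>C. E i)"
  shows "emeasure \<mu>1 A = emeasure \<mu>2 A"
proof (cases "C = {}")
  case True
  then show ?thesis using A by auto
next
  case False
  have C': "from_nat_into C k \<in> C" for k
    using False by (rule from_nat_into)
  show ?thesis
  proof (rule emeasure_eq_on_cover[OF sets, where E = "\<lambda>k. E (from_nat_into C k)"])
    show "A \<subseteq> (\<Union>k. E (from_nat_into C k))"
    proof
      fix x assume "x \<in> A"
      then obtain i where "i \<in> C" "x \<in> E i" using A(2) by auto
      then show "x \<in> (\<Union>k. E (from_nat_into C k))"
        using from_nat_into_surj[OF C] by auto
    qed
    show "emeasure \<mu>1 B = emeasure \<mu>2 B" if "B \<in> sets \<mu>1" "B \<subseteq> E (from_nat_into C k)" for B k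
      using C' that by (rule eq)
  qed (use E C' A in auto)
qed

text \<open>Frequencies that detect the coordinate \<open>t\<close>. All scales are needed because
  \<open>1 - cos\<close> also vanishes at nonzero multiples of 2\<pi>; a scale beyond
  \<open>\<bar>x t\<bar>\<close> brings the argument below \<pi>.\<close>

definition scaled_unit :: "'t \<Rightarrow> nat \<Rightarrow> 't \<Rightarrow> real" where
  "scaled_unit t n = (\<lambda>s. if s = t then 1 / real (Suc n) else 0)"

lemma inner_prod_on_scaled_unit:
  assumes "finite I" "t \<in> I"
  shows "inner_prod_on I (scaled_unit t n) x = x t / real (Suc n)"
  using assms by (simp add: inner_prod_on_def scaled_unit_def if_distrib[of "\<lambda>u. u * _"] cong: if_cong)

lemma origin_apply [simp]: "t \<in> T \<Longrightarrow> origin T t = 0"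
  by (simp add: origin_def)

lemma origin_in_space [simp]: "origin T \<in> space (path_space T)"
  by (auto simp: origin_def space_PiM)

lemma not_origin_iff:
  assumes "x \<in> space (path_space T)"
  shows "x \<noteq> origin T \<longleftrightarrow> (\<exists>t\<in>T. x t \<noteq> 0)"
  using assms by (auto simp: origin_def space_PiM PiE_def extensional_def fun_eq_iff)

lemma cos_weight_cover:
  assumes I: "finite I" and x: "x \<in> space (path_space I)" "x \<noteq> origin I"
  obtains t n where "t \<in> I" "cos_weight I (scaled_unit t n) x \<noteq> 0"
proof -
  obtain t where t: "t \<in> I" "x t \<noteq> 0"
    using x by (auto simp: not_origin_iff)
  obtain n :: nat where n: "\<bar>x t\<bar> < real n"
    using reals_Archimedean2 by blast
  define a where "a = \<bar>x t\<bar> / real (Suc n)"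
  have a: "0 < a" "a \<le> 1"
    using n t by (auto simp: a_def pos_divide_le_eq)
  have "cos (x t / real (Suc n)) = cos a"
    by (cases "x t \<ge> 0") (auto simp: a_def)
  also have "\<dots> < cos 0"
    using a pi_gt3 by (intro cos_monotone_0_pi) auto
  finally have "cos (x t / real (Suc n)) < 1" by simp
  then have "cos_weight I (scaled_unit t n) x \<noteq> 0"
    unfolding cos_weight_def inner_prod_on_scaled_unit[OF I t(1)] by simp
  with t(1) show ?thesis by (rule that)
qed

lemma origin_measurable:
  assumes "finite I"
  shows "{origin I} \<in> sets (path_space I)"
proof -
  have "{origin I} = (\<Pi>\<^sub>E t\<in>I. {0})"
    by (auto simp: origin_def PiE_def extensional_def fun_eq_iff)
  moreover have "(\<Pi>\<^sub>E t\<in>I. {0}) \<in> sets (path_space I)"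
    using assms by (intro sets_PiM_I_finite) auto
  ultimately show ?thesis by (simp only:)
qed

text \<open>The strongest agreement that exponents can force, since the Levy--Khintchine integrand
  vanishes at the origin.\<close>

definition agree_off_origin :: "'t set \<Rightarrow> ('t \<Rightarrow> real) measure \<Rightarrow> ('t \<Rightarrow> real) measure \<Rightarrow> bool" where
  "agree_off_origin T \<mu> \<nu> \<longleftrightarrow>
     (\<forall>A\<in>sets (path_space T). origin T \<notin> A \<longrightarrow> emeasure \<mu> A = emeasure \<nu> A)"

text \<open>The sets where the weight of some scaled unit vector is nonzero form a countable cover
  of the complement of the origin, and on each of them the weight can be divided out.\<close>

lemma agree_off_origin_if_density_eq:
  assumes I: "finite I" and s1: "sets \<mu>1 = sets (path_space I)" and s2: "sets \<mu>2 = sets (path_space I)"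
    and eq: "\<And>h. density \<mu>1 (\<lambda>x. ennreal ((cos_weight I h x)\<^sup>2)) = density \<mu>2 (\<lambda>x. ennreal ((cos_weight I h x)\<^sup>2))"
  shows "agree_off_origin I \<mu>1 \<mu>2"
  unfolding agree_off_origin_def
proof (intro ballI impI)
  fix A assume A: "A \<in> sets (path_space I)" "origin I \<notin> A"
  define E where "E = (\<lambda>(t, n). {x \<in> space (path_space I). cos_weight I (scaled_unit t n) x \<noteq> 0})"
  have m: "cos_weight I h \<in> borel_measurable (path_space I)" for h
    by (rule cos_weight_measurable) auto
  show "emeasure \<mu>1 A = emeasure \<mu>2 A"
  proof (rule emeasure_eq_on_countable_cover[where C = "I \<times> UNIV" and E = E])
    show "countable (I \<times> (UNIV :: nat set))"
      using I by (auto intro: countable_finite)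
    show "A \<subseteq> (\<Union>i\<in>I \<times> UNIV. E i)"
    proof
      fix x assume "x \<in> A"
      then have "x \<in> space (path_space I)" "x \<noteq> origin I"
        using A sets.sets_into_space by auto
      moreover from this obtain t n where "t \<in> I" "cos_weight I (scaled_unit t n) x \<noteq> 0"
        by (rule cos_weight_cover[OF I])
      ultimately show "x \<in> (\<Union>i\<in>I \<times> UNIV. E i)"
        by (intro UN_I[of "(t, n)"]) (auto simp: E_def)
    qed
    fix i
    show "E i \<in> sets \<mu>1"
      using m by (auto simp: E_def s1 split: prod.split)
    fix B assume B: "B \<in> sets \<mu>1" "B \<subseteq> E i"
    obtain h where h: "\<And>x. x \<in> B \<Longrightarrow> cos_weight I h x \<noteq> 0"
      using B by (cases i) (auto simp: E_def)
    let ?k = "\<lambda>x. ennreal ((cos_weight I h x)\<^sup>2)"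
    \<comment> \<open>The weight of \<open>h\<close> does not vanish on \<open>B\<close>, so its
      reciprocal recovers the mass of \<open>B\<close> from the weighted measure.\<close>
    let ?r = "\<lambda>x. ennreal (1 / (cos_weight I h x)\<^sup>2) * indicator B x"
    have *: "emeasure \<mu> B = (\<integral>\<^sup>+x. ?r x \<partial>density \<mu> ?k)" if s: "sets \<mu> = sets (path_space I)" for \<mu>
    proof -
      have mk: "?k \<in> borel_measurable \<mu>" and mr: "?r \<in> borel_measurable \<mu>"
        using m[of h] B(1) unfolding measurable_cong_sets[OF s refl] s1 by measurable
      have "(\<integral>\<^sup>+x. ?r x \<partial>density \<mu> ?k) = (\<integral>\<^sup>+x. ?k x * ?r x \<partial>\<mu>)"
        by (rule nn_integral_density[OF mk mr])
      also have "\<dots> = (\<integral>\<^sup>+x. indicator B x \<partial>\<mu>)"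
        using h by (intro nn_integral_cong) (auto simp: indicator_def simp flip: ennreal_mult)
      finally show ?thesis
        using B(1) s s1 by simp
    qed
    show "emeasure \<mu>1 B = emeasure \<mu>2 B"
      unfolding *[OF s1] *[OF s2] eq ..
  qed (use A s1 s2 in auto)
qed

lemma density_indicator_eqI:
  assumes s1: "sets \<mu>1 = sets M" and s2: "sets \<mu>2 = sets M" and D: "D \<in> sets M"
    and eq: "\<And>B. B \<in> sets M \<Longrightarrow> B \<subseteq> D \<Longrightarrow> emeasure \<mu>1 B = emeasure \<mu>2 B"
  shows "density \<mu>1 (indicator D) = density \<mu>2 (indicator D)"
proof (rule measure_eqI)
  fix A assume "A \<in> sets (density \<mu>1 (indicator D))"
  then have A: "A \<in> sets M" by (simp add: s1)
  have "emeasure (density \<mu> (indicator D)) A = emeasure \<mu> (D \<inter> A)" if s: "sets \<mu> = sets M" for \<mu>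
    using A D s by (simp add: emeasure_density flip: indicator_inter_arith)
  then show "emeasure (density \<mu>1 (indicator D)) A = emeasure (density \<mu>2 (indicator D)) A"
    using eq[of "D \<inter> A"] A D s1 s2 by simp
qed (simp add: s1 s2)

lemma integral_agree_off_origin:
  fixes g :: "('t \<Rightarrow> real) \<Rightarrow> 'b :: {banach, second_countable_topology}"
  assumes I: "finite I" and s1: "sets \<mu>1 = sets (path_space I)" and s2: "sets \<mu>2 = sets (path_space I)"
    and eq: "agree_off_origin I \<mu>1 \<mu>2" and g: "g \<in> borel_measurable (path_space I)" "g (origin I) = 0"
  shows "integral\<^sup>L \<mu>1 g = integral\<^sup>L \<mu>2 g"
proof -
  let ?N = "space (path_space I) - {origin I}"
  have N: "?N \<in> sets (path_space I)"
    using origin_measurable[OF I] by auto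
  have *: "integral\<^sup>L \<mu> g = integral\<^sup>L (density \<mu> (indicator ?N)) g" if s: "sets \<mu> = sets (path_space I)" for \<mu>
  proof -
    have sp: "space \<mu> = space (path_space I)" using s by (rule sets_eq_imp_space_eq)
    have "integral\<^sup>L (density \<mu> (indicator ?N)) g = integral\<^sup>L (density \<mu> (\<lambda>x. ennreal (indicator ?N x))) g"
      by (simp add: ennreal_indicator)
    also have "\<dots> = integral\<^sup>L \<mu> (\<lambda>x. indicator ?N x *\<^sub>R g x)"
      using g(1) N s by (intro integral_density) (auto cong: measurable_cong_sets)
    also have "\<dots> = integral\<^sup>L \<mu> g"
      using g(2) by (intro Bochner_Integration.integral_cong refl) (auto simp: indicator_def sp)
    finally show ?thesis ..
  qed
  have "density \<mu>1 (indicator ?N) = density \<mu>2 (indicator ?N)"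
    using eq by (intro density_indicator_eqI[OF s1 s2 N]) (auto simp: agree_off_origin_def)
  then show ?thesis
    using *[OF s1] *[OF s2] by simp
qed

lemma levy_integrable_add_measure:
  assumes "levy_integrable T \<mu>" "levy_integrable T \<nu>"
  shows "levy_integrable T (add_measure \<mu> \<nu>)"
  unfolding levy_integrable_def
proof (intro conjI ballI)
  show "sets (add_measure \<mu> \<nu>) = sets (path_space T)"
    using assms by (simp add: levy_integrable_def)
  fix t assume t: "t \<in> T"
  have s: "sets \<mu> = sets (path_space T)" "sets \<nu> = sets \<mu>" using assms by (auto simp: levy_integrable_def)
  have "(\<lambda>x. x t) \<in> borel_measurable \<mu>"
    unfolding measurable_cong_sets[OF s(1) refl] using t by (intro measurable_component_singleton) auto
  then have "(\<lambda>x. ennreal (min (\<bar>x t\<bar>\<^sup>2) 1)) \<in> borel_measurable \<mu>" by measurable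
  then show "(\<integral>\<^sup>+x. ennreal (min (\<bar>x t\<bar>\<^sup>2) 1) \<partial>add_measure \<mu> \<nu>) < \<infinity>"
    using assms t by (simp add: nn_integral_add_measure[OF s(2)] levy_integrable_def)
qed

lemma weighted_char_add_measure:
  assumes s: "sets \<mu> = sets (path_space T)" "sets \<nu> = sets (path_space T)" and I: "I \<subseteq> T"
    and k: "integrable \<mu> k" "integrable \<nu> k"
  shows "weighted_char I (add_measure \<mu> \<nu>) k \<theta> = weighted_char I \<mu> k \<theta> + weighted_char I \<nu> k \<theta>"
  unfolding weighted_char_def
  by (rule integral_add_measure) (simp_all add: s integrable_iexp_mult[OF s(1) I k(1)] integrable_iexp_mult[OF s(2) I k(2)])

lemma integrable_cos_weight_power2:
  assumes chi: "truncation_factor chi" and \<nu>: "levy_integrable T \<nu>" and I: "finite I" "I \<subseteq> T"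
  shows "integrable \<nu> (\<lambda>x. (cos_weight I h x)\<^sup>2)"
  using integrable_mult_cos_weight[OF levy_integrable_sets[OF \<nu>] I(2) integrable_cos_weight[OF chi \<nu> I], of h h]
  by (simp add: power2_eq_square)

lemma inner_prod_on_origin [simp]: "inner_prod_on I \<theta> (origin I) = 0"
  by (simp add: inner_prod_on_def)

lemma lk_integrand_origin [simp]: "lk_integrand chi I \<theta> (origin I) = 0"
  by (simp add: lk_integrand_def inner_prod_on_def truncate_def)

text \<open>The hypothesis is the subtraction-free form of \<open>p - n = p' - n'\<close>. After
  integration all four terms are finite and can be rearranged.\<close>

lemma diff_integral_eq_if_agree:
  assumes chi: "truncation_factor chi" and I: "finite I"
    and \<nu>: "levy_integrable I p" "levy_integrable I n" "levy_integrable I p'" "levy_integrable I n'"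
    and eq: "agree_off_origin I (add_measure p n') (add_measure p' n)"
  shows "diff_integral p n (lk_integrand chi I \<theta>) = diff_integral p' n' (lk_integrand chi I \<theta>)"
proof -
  note s = \<nu>[THEN levy_integrable_sets]
  note i = integrable_lk_integrand[OF chi _ I subset_refl]
  have "(CLINT x|add_measure p n'. lk_integrand chi I \<theta> x) = (CLINT x|add_measure p' n. lk_integrand chi I \<theta> x)"
    by (rule integral_agree_off_origin[OF I _ _ eq])
      (simp_all add: s lk_integrand_measurable[OF chi refl])
  then show ?thesis
    using s by (simp add: integral_add_measure i \<nu> algebra_simps)
qed

text \<open>The iterated second difference determines the measures off the origin. With the
  integrals known to be equal, a single second difference at 0 gives the quadratic form, and the
  drift is what remains.\<close>

lemma lk_exponent_unique:
  assumes chi: "truncation_factor chi" and I: "finite I"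
    and \<nu>: "levy_integrable I p" "levy_integrable I n" "levy_integrable I p'" "levy_integrable I n'"
    and eq: "\<And>\<theta>. lk_exponent chi I S (diff_integral p n) b \<theta> = lk_exponent chi I S' (diff_integral p' n') b' \<theta>"
  shows "agree_off_origin I (add_measure p n') (add_measure p' n)"
    and "\<And>\<theta>. quad_form_on I \<theta> S = quad_form_on I \<theta> S'"
    and "\<And>\<theta>. inner_prod_on I \<theta> b = inner_prod_on I \<theta> b'"
proof -
  note s = \<nu>[THEN levy_integrable_sets]
  have eq_fun: "lk_exponent chi I S (diff_integral p n) b = lk_exponent chi I S' (diff_integral p' n') b'"
    using eq by (rule ext)
  note k = integrable_cos_weight_power2[OF chi _ I subset_refl]
  show 1: "agree_off_origin I (add_measure p n') (add_measure p' n)"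
  proof (rule agree_off_origin_if_density_eq[OF I])
    fix h
    have "weighted_char I p (\<lambda>x. (cos_weight I h x)\<^sup>2) \<theta> - weighted_char I n (\<lambda>x. (cos_weight I h x)\<^sup>2) \<theta> =
        weighted_char I p' (\<lambda>x. (cos_weight I h x)\<^sup>2) \<theta> - weighted_char I n' (\<lambda>x. (cos_weight I h x)\<^sup>2) \<theta>" for \<theta>
      using second_diff_second_diff_lk_exponent[OF chi \<nu>(1,2) I subset_refl, of h S b \<theta>]
        second_diff_second_diff_lk_exponent[OF chi \<nu>(3,4) I subset_refl, of h S' b' \<theta>] eq_fun by simp
    then have "weighted_char I (add_measure p n') (\<lambda>x. (cos_weight I h x)\<^sup>2) \<theta> =
        weighted_char I (add_measure p' n) (\<lambda>x. (cos_weight I h x)\<^sup>2) \<theta>" for \<theta>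
      by (simp add: weighted_char_add_measure[where T = I] s k \<nu> algebra_simps)
    then show "density (add_measure p n') (\<lambda>x. ennreal ((cos_weight I h x)\<^sup>2)) =
        density (add_measure p' n) (\<lambda>x. ennreal ((cos_weight I h x)\<^sup>2))"
      using s by (intro density_eq_if_weighted_char_eq[OF I] k[OF levy_integrable_add_measure] \<nu>) simp_all
  qed (simp_all add: s)
  have J: "diff_integral p n (lk_integrand chi I \<theta>) = diff_integral p' n' (lk_integrand chi I \<theta>)" for \<theta>
    by (rule diff_integral_eq_if_agree[OF chi I \<nu> 1])
  show 2: "quad_form_on I h S = quad_form_on I h S'" for h
  proof -
    have "second_diff h (\<lambda>\<theta>. diff_integral p n (lk_integrand chi I \<theta>)) = second_diff h (\<lambda>\<theta>. diff_integral p' n' (lk_integrand chi I \<theta>))"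
      unfolding J ..
    then show ?thesis
      using second_diff_lk_exponent[of h chi I S "diff_integral p n" b "\<lambda>_. 0"]
        second_diff_lk_exponent[of h chi I S' "diff_integral p' n'" b' "\<lambda>_. 0"] eq_fun by simp
  qed
  show "inner_prod_on I \<theta> b = inner_prod_on I \<theta> b'" for \<theta>
    using eq[of \<theta>] J[of \<theta>] 2[of \<theta>] by (simp add: lk_exponent_def)
qed

section \<open>Infinitely divisible exponents\<close>

text \<open>The characteristic function of a sum over the product measure factorizes. This yields
  some root only; which branch it is has to be decided separately.\<close>

lemma id_char_root:
  assumes id: "infinitely_divisible_on I \<mu>" and n: "n \<ge> 1"
  obtains \<rho> where "prob_space \<rho>" "sets \<rho> = sets (path_space I)"
    "\<And>\<theta>. (CLINT x|\<rho>. iexp (inner_prod_on I \<theta> x)) ^ n = (CLINT x|\<mu>. iexp (inner_prod_on I \<theta> x))"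
proof -
  obtain \<rho> where \<rho>: "prob_space \<rho>" "sets \<rho> = sets (path_space I)"
    and \<mu>: "\<mu> = distr (PiM {..<n} (\<lambda>_. \<rho>)) (path_space I) (\<lambda>x. \<lambda>t\<in>I. \<Sum>k<n. x k t)"
    using id n by (auto simp: infinitely_divisible_on_def)
  interpret \<rho>: prob_space \<rho> by (rule \<rho>)
  interpret P: product_prob_space "\<lambda>_ :: nat. \<rho>" "{..<n}" by unfold_locales
  have comp: "(\<lambda>x. x t) \<in> borel_measurable \<rho>" if "t \<in> I" for t
    unfolding measurable_cong_sets[OF \<rho>(2) refl] using that by (rule measurable_component_singleton)
  have meas: "(\<lambda>x. \<lambda>t\<in>I. \<Sum>k<n. x k t) \<in> measurable (PiM {..<n} (\<lambda>_. \<rho>)) (path_space I)"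
  proof (intro measurable_restrict borel_measurable_sum)
    fix t k assume "t \<in> I" "k \<in> {..<n}"
    then show "(\<lambda>x. x k t) \<in> borel_measurable (PiM {..<n} (\<lambda>_. \<rho>))"
      by (intro measurable_compose[OF measurable_component_singleton[of k] comp[of t]])
  qed
  have im: "(\<lambda>x. iexp (inner_prod_on I \<theta> x)) \<in> borel_measurable (path_space I)" for \<theta>
    using inner_prod_on_measurable[of I I \<theta>] by measurable
  have im\<rho>: "(\<lambda>x. iexp (inner_prod_on I \<theta> x)) \<in> borel_measurable \<rho>" for \<theta>
    unfolding measurable_cong_sets[OF \<rho>(2) refl] by (rule im)
  show ?thesis
  proof (rule that[OF \<rho>])
    fix \<theta>
    have "(CLINT x|\<mu>. iexp (inner_prod_on I \<theta> x)) =
        (CLINT x|PiM {..<n} (\<lambda>_. \<rho>). iexp (inner_prod_on I \<theta> (\<lambda>t\<in>I. \<Sum>k<n. x k t)))"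
      unfolding \<mu> by (rule integral_distr[OF meas im])
    also have "\<dots> = (CLINT x|PiM {..<n} (\<lambda>_. \<rho>). (\<Prod>k<n. iexp (inner_prod_on I \<theta> (x k))))"
    proof (intro Bochner_Integration.integral_cong refl)
      fix x
      have "inner_prod_on I \<theta> (\<lambda>t\<in>I. \<Sum>k<n. x k t) = (\<Sum>t\<in>I. \<Sum>k<n. \<theta> t * x k t)"
        by (simp add: inner_prod_on_def sum_distrib_left)
      also have "\<dots> = (\<Sum>k<n. inner_prod_on I \<theta> (x k))"
        unfolding inner_prod_on_def by (rule sum.swap)
      finally show "iexp (inner_prod_on I \<theta> (\<lambda>t\<in>I. \<Sum>k<n. x k t)) = (\<Prod>k<n. iexp (inner_prod_on I \<theta> (x k)))"
        by (simp add: sum_distrib_left exp_sum)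
    qed
    also have "\<dots> = (\<Prod>k<n. CLINT x|\<rho>. iexp (inner_prod_on I \<theta> x))"
      using im\<rho> by (intro P.product_integral_prod) (auto intro!: \<rho>.integrable_const_bound[where B = 1])
    finally show "(CLINT x|\<rho>. iexp (inner_prod_on I \<theta> x)) ^ n = (CLINT x|\<mu>. iexp (inner_prod_on I \<theta> x))"
      by simp
  qed
qed

lemma continuous_on_char_ray:
  assumes \<rho>: "prob_space \<rho>" "sets \<rho> = sets (path_space I)"
  shows "continuous_on {0..1} (\<lambda>s. CLINT x|\<rho>. iexp (inner_prod_on I (\<lambda>t. s * \<theta> t) x))"
proof (rule continuous_on_sequentiallyI)
  interpret prob_space \<rho> by (rule \<rho>)
  fix u :: "nat \<Rightarrow> real" and a assume u: "u \<longlonglongrightarrow> a"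
  have [measurable]: "inner_prod_on I \<theta> \<in> borel_measurable \<rho>" for \<theta>
    unfolding measurable_cong_sets[OF \<rho>(2) refl] by (rule inner_prod_on_measurable) simp
  show "(\<lambda>n. CLINT x|\<rho>. iexp (inner_prod_on I (\<lambda>t. u n * \<theta> t) x)) \<longlonglongrightarrow> (CLINT x|\<rho>. iexp (inner_prod_on I (\<lambda>t. a * \<theta> t) x))"
  proof (rule integral_dominated_convergence[where w = "\<lambda>_. 1"])
    show "AE x in \<rho>. (\<lambda>n. iexp (inner_prod_on I (\<lambda>t. u n * \<theta> t) x)) \<longlonglongrightarrow> iexp (inner_prod_on I (\<lambda>t. a * \<theta> t) x)"
      unfolding inner_prod_on_linear by (intro AE_I2 tendsto_intros u tendsto_of_real tendsto_exp)
  qed auto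
qed

text \<open>On a ray the quotient of the two sides is a continuous \<open>n\<close>-th root of unity, hence constant.\<close>

lemma char_root_eq:
  assumes chi: "truncation_factor chi" and \<nu>: "levy_integrable I \<nu>1" "levy_integrable I \<nu>2" and I: "finite I"
    and \<rho>: "prob_space \<rho>" "sets \<rho> = sets (path_space I)" and n: "n \<ge> 1"
    and root: "\<And>\<theta>. (CLINT x|\<rho>. iexp (inner_prod_on I \<theta> x)) ^ n = exp (lk_exponent chi I S (diff_integral \<nu>1 \<nu>2) b \<theta>)"
  shows "(CLINT x|\<rho>. iexp (inner_prod_on I \<theta> x)) = exp (lk_exponent chi I S (diff_integral \<nu>1 \<nu>2) b \<theta> / of_nat n)"
proof -
  interpret prob_space \<rho> by (rule \<rho>)
  let ?\<psi> = "\<lambda>s. lk_exponent chi I S (diff_integral \<nu>1 \<nu>2) b (\<lambda>t. s * \<theta> t)"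
  let ?f = "\<lambda>s. (CLINT x|\<rho>. iexp (inner_prod_on I (\<lambda>t. s * \<theta> t) x)) * exp (- ?\<psi> s / of_nat n)"
  have "?f constant_on {0..1}"
  proof (rule continuous_finite_range_constant)
    show "continuous_on {0..1} ?f"
      using n by (intro continuous_intros continuous_on_char_ray[OF \<rho>]
        continuous_on_lk_exponent_ray[OF chi \<nu> I subset_refl]) auto
    have "?f s ^ n = 1" for s
    proof -
      have "exp (- ?\<psi> s / of_nat n) ^ n = exp (- ?\<psi> s)"
        using n by (simp flip: exp_of_nat_mult)
      then show ?thesis
        by (simp add: power_mult_distrib root flip: exp_add)
    qed
    then have "?f ` {0..1} \<subseteq> {z. z ^ n = 1}" by blast
    then show "finite (?f ` {0..1})"
      using n by (rule finite_subset[OF _ finite_roots_unity])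
  qed auto
  then obtain c where c: "\<And>s. s \<in> {0..1} \<Longrightarrow> ?f s = c"
    by (auto simp: constant_on_def)
  have "?f 0 = 1"
    by (simp add: inner_prod_on_linear lk_exponent_0 prob_space)
  then have "?f 1 = 1"
    using c[of 0] c[of 1] by simp
  then show ?thesis
    by (simp add: exp_minus field_simps)
qed

text \<open>The derivative of \<open>exp\<close> at 0, along increments that are nonzero only for
  nonzero \<open>z\<close>. The shift to \<open>Suc n\<close> avoids division by zero.\<close>

lemma tendsto_n_exp_minus_1:
  fixes z :: complex
  shows "(\<lambda>n. of_nat (Suc n) * (exp (z / of_nat (Suc n)) - 1)) \<longlonglongrightarrow> z"
proof (cases "z = 0")
  case False
  have "((\<lambda>h. (exp (0 + h) - exp 0) / h) \<longlongrightarrow> (exp 0 :: complex)) (at 0)"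
    using DERIV_exp[of "0 :: complex"] by (simp only: DERIV_def)
  then have d: "((\<lambda>h. (exp h - 1) / h) \<longlongrightarrow> (1 :: complex)) (at 0)"
    by simp
  have lim0: "(\<lambda>n. z / of_nat (Suc n)) \<longlonglongrightarrow> 0"
    using tendsto_mult[OF tendsto_const[of z] LIMSEQ_Suc[OF lim_1_over_n[where ?'a = complex]]] by simp
  have "filterlim (\<lambda>n. z / of_nat (Suc n)) (at 0) sequentially"
    unfolding filterlim_at using lim0 False by (auto simp del: of_nat_Suc)
  from filterlim_compose[OF d this]
  have "(\<lambda>n. (exp (z / of_nat (Suc n)) - 1) / (z / of_nat (Suc n))) \<longlonglongrightarrow> 1" .
  from tendsto_mult[OF tendsto_const[of z] this]
  have "(\<lambda>n. z * ((exp (z / of_nat (Suc n)) - 1) / (z / of_nat (Suc n)))) \<longlonglongrightarrow> z"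
    by simp
  moreover have "z * ((exp (z / of_nat (Suc n)) - 1) / (z / of_nat (Suc n))) = of_nat (Suc n) * (exp (z / of_nat (Suc n)) - 1)" for n
    using False by simp
  ultimately show ?thesis
    by (simp only:)
qed simp

lemma second_diff_tendsto:
  assumes "\<And>\<theta>. ((\<lambda>n. f n \<theta>) \<longlongrightarrow> g \<theta>) F"
  shows "((\<lambda>n. second_diff h (f n) \<theta>) \<longlongrightarrow> second_diff h g \<theta>) F"
  unfolding second_diff_def by (intro tendsto_intros assms)

text \<open>With \<open>\<phi>\<^sub>n\<close> the characteristic function of the \<open>n\<close>-th convolution root, \<open>n (\<phi>\<^sub>n - 1)\<close> tends to the
  exponent, and its iterated second differences are positive definite.\<close>

lemma pd_second_diff_id_exponent:
  assumes chi: "truncation_factor chi" and \<nu>: "levy_integrable I \<nu>1" "levy_integrable I \<nu>2" and I: "finite I"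
    and id: "infinitely_divisible_on I \<mu>"
    and ch: "\<And>\<theta>. (CLINT x|\<mu>. iexp (inner_prod_on I \<theta> x)) = exp (lk_exponent chi I S (diff_integral \<nu>1 \<nu>2) b \<theta>)"
  shows "0 \<le> Re (pd_form cs cs (second_diff h (second_diff h (lk_exponent chi I S (diff_integral \<nu>1 \<nu>2) b))))"
proof -
  let ?\<psi> = "lk_exponent chi I S (diff_integral \<nu>1 \<nu>2) b"
  define f where "f n \<theta> = of_nat (Suc n) * (exp (?\<psi> \<theta> / of_nat (Suc n)) - 1)" for n \<theta>
  have lim: "(\<lambda>n. f n \<theta>) \<longlonglongrightarrow> ?\<psi> \<theta>" for \<theta>
    unfolding f_def by (rule tendsto_n_exp_minus_1)
  have "(\<lambda>n. Re (pd_form cs cs (second_diff h (second_diff h (f n))))) \<longlonglongrightarrow> Re (pd_form cs cs (second_diff h (second_diff h ?\<psi>)))"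
    by (intro tendsto_Re pd_form_tendsto second_diff_tendsto lim)
  moreover have "0 \<le> Re (pd_form cs cs (second_diff h (second_diff h (f n))))" for n
  proof -
    obtain \<rho> where \<rho>: "prob_space \<rho>" "sets \<rho> = sets (path_space I)"
      and root: "\<And>\<theta>. (CLINT x|\<rho>. iexp (inner_prod_on I \<theta> x)) ^ Suc n = (CLINT x|\<mu>. iexp (inner_prod_on I \<theta> x))"
      using id_char_root[OF id, of "Suc n"] by auto
    interpret prob_space \<rho> by (rule \<rho>)
    have "(CLINT x|\<rho>. iexp (inner_prod_on I \<theta> x)) = exp (?\<psi> \<theta> / of_nat (Suc n))" for \<theta>
      by (rule char_root_eq[OF chi \<nu> I \<rho>]) (simp_all add: root ch del: power_Suc)
    then have f: "f n = (\<lambda>\<theta>. of_nat (Suc n) * weighted_char I \<rho> (\<lambda>_. 1) \<theta> - of_nat (Suc n))"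
      by (simp add: f_def fun_eq_iff weighted_char_def right_diff_distrib del: of_nat_Suc)
    have i1: "integrable \<rho> (\<lambda>_. 1 :: real)" by simp
    have i2: "integrable \<rho> (cos_weight I h)"
      using integrable_mult_cos_weight[OF \<rho>(2) subset_refl i1] by simp
    have i3: "integrable \<rho> (\<lambda>x. cos_weight I h x * cos_weight I h x)"
      by (rule integrable_mult_cos_weight[OF \<rho>(2) subset_refl i2])
    \<comment> \<open>The subtracted constant \<open>Suc n\<close> disappears, leaving a positive
      multiple of a characteristic function with nonnegative weight.\<close>
    have "second_diff h (f n) = (\<lambda>\<theta>. of_nat (Suc n) * weighted_char I \<rho> (cos_weight I h) \<theta>)"
      unfolding f by (rule ext) (simp add: second_diff_linear second_diff_weighted_char[OF \<rho>(2) subset_refl i1] del: of_nat_Suc)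
    then have sd2: "second_diff h (second_diff h (f n)) =
        (\<lambda>\<theta>. of_nat (Suc n) * weighted_char I \<rho> (\<lambda>x. cos_weight I h x * cos_weight I h x) \<theta>)"
      by (intro ext) (simp add: second_diff_linear second_diff_weighted_char[OF \<rho>(2) subset_refl i2] del: of_nat_Suc)
    have "pd_form cs cs (second_diff h (second_diff h (f n))) =
        complex_of_real (real (Suc n) * (\<integral>x. (norm (trig I cs x))\<^sup>2 * (cos_weight I h x * cos_weight I h x) \<partial>\<rho>))"
      unfolding sd2 by (simp add: pd_form_cmult pd_form_weighted_char[OF \<rho>(2) subset_refl i3] del: of_nat_Suc)
    then show ?thesis
      by (simp add: Bochner_Integration.integral_nonneg del: of_nat_Suc)
  qed
  ultimately show ?thesis
    by (intro tendsto_lowerbound[where F = sequentially]) auto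
qed

lemma levy_integrable_mono:
  assumes \<nu>: "levy_integrable T \<nu>" and s: "sets \<mu> = sets \<nu>" and le: "\<And>A. A \<in> sets \<nu> \<Longrightarrow> emeasure \<mu> A \<le> emeasure \<nu> A"
  shows "levy_integrable T \<mu>"
  unfolding levy_integrable_def
proof (intro conjI ballI)
  show "sets \<mu> = sets (path_space T)"
    using \<nu> s by (simp add: levy_integrable_def)
  fix t assume t: "t \<in> T"
  have "\<mu> \<le> \<nu>"
    using s le emeasure_notin_sets[of _ \<mu>] by (subst le_measure[OF s]) (auto simp: le_fun_def)
  from nn_integral_mono_measure[OF s this]
  show "(\<integral>\<^sup>+x. ennreal (min (\<bar>x t\<bar>\<^sup>2) 1) \<partial>\<mu>) < \<infinity>"
    using \<nu> t by (auto simp: levy_integrable_def intro: le_less_trans)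
qed

lemma levy_weight_pos_iff:
  assumes "finite I"
  shows "0 < levy_weight I x \<longleftrightarrow> (\<exists>t\<in>I. x t \<noteq> 0)"
proof -
  have "levy_weight I x = 0 \<longleftrightarrow> (\<forall>t\<in>I. x t = 0)"
    using assms unfolding levy_weight_def by (subst sum_nonneg_eq_0_iff) (auto simp: min_def)
  then show ?thesis
    using levy_weight_nonneg[of I x] by auto
qed

text \<open>Markov's inequality for the integrable weight. It is the source of \<sigma>-finiteness
  away from paths that vanish on \<open>I\<close>.\<close>

lemma emeasure_levy_weight_ge_finite:
  assumes \<nu>: "levy_integrable T \<nu>" and I: "I \<subseteq> T" and c: "c > 0"
  shows "emeasure \<nu> {x \<in> space \<nu>. c \<le> levy_weight I x} < \<infinity>"
proof -
  have m: "levy_weight I \<in> borel_measurable \<nu>"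
    unfolding measurable_cong_sets[OF levy_integrable_sets[OF \<nu>] refl] using I by (rule levy_weight_measurable)
  have i: "integrable \<nu> (\<lambda>x. levy_weight I x / c)"
    using integrable_levy_weight[OF \<nu> I] by simp
  have "emeasure \<nu> {x \<in> space \<nu>. c \<le> levy_weight I x} = (\<integral>\<^sup>+x. indicator {x \<in> space \<nu>. c \<le> levy_weight I x} x \<partial>\<nu>)"
    using m by simp
  also have "\<dots> \<le> (\<integral>\<^sup>+x. ennreal (levy_weight I x / c) \<partial>\<nu>)"
    using c by (intro nn_integral_mono) (auto simp: indicator_def)
  also have "\<dots> = ennreal (\<integral>x. levy_weight I x / c \<partial>\<nu>)"
    using c by (intro nn_integral_eq_integral i) (auto simp: levy_weight_nonneg)
  finally show ?thesis
    by (rule le_less_trans) simp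
qed

text \<open>The Jordan parts of \<open>\<nu>\<^sub>1 - \<nu>\<^sub>2\<close> are mutually singular, so positive definiteness forces the negative
  part to vanish.\<close>

lemma id_exponent_levy:
  assumes chi: "truncation_factor chi" and \<nu>: "levy_integrable I \<nu>1" "levy_integrable I \<nu>2" and I: "finite I"
    and id: "infinitely_divisible_on I \<mu>"
    and ch: "\<And>\<theta>. (CLINT x|\<mu>. iexp (inner_prod_on I \<theta> x)) = exp (lk_exponent chi I S (diff_integral \<nu>1 \<nu>2) b \<theta>)"
  obtains \<nu> where "levy_integrable I \<nu>"
    "\<And>\<theta>. lk_exponent chi I S (diff_integral \<nu>1 \<nu>2) b \<theta> = lk_exponent chi I S (\<lambda>g. CLINT x|\<nu>. g x) b \<theta>"
proof -
  note s = \<nu>[THEN levy_integrable_sets]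
  have s21: "sets \<nu>2 = sets \<nu>1" using s by simp
  have sp: "space \<nu>1 = space (path_space I)" "space \<nu>2 = space (path_space I)"
    using s[THEN sets_eq_imp_space_eq] by simp_all
  \<comment> \<open>The superlevel sets of the weight exhaust the complement of the origin and have
    finite mass for both measures.\<close>
  define E where "E k = {x \<in> space (path_space I). 1 / real (Suc k) \<le> levy_weight I x}" for k
  have E: "E k \<in> sets \<nu>1" for k
    unfolding E_def s using levy_weight_measurable[of I I] by measurable
  have U: "(\<Union>k. E k) = space (path_space I) - {origin I}"
  proof (intro set_eqI iffI)
    fix x assume "x \<in> (\<Union>k. E k)"
    then obtain k where x: "x \<in> space (path_space I)" "1 / real (Suc k) \<le> levy_weight I x"
      by (auto simp: E_def)
    have "0 < 1 / real (Suc k)" by simp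
    then have "0 < levy_weight I x" using x(2) by (rule less_le_trans)
    then show "x \<in> space (path_space I) - {origin I}"
      using x levy_weight_pos_iff[OF I] not_origin_iff[OF x(1)] by simp
  next
    fix x assume "x \<in> space (path_space I) - {origin I}"
    then have x: "x \<in> space (path_space I)" "0 < levy_weight I x"
      using levy_weight_pos_iff[OF I] not_origin_iff[of x I] by auto
    then obtain k where "inverse (real (Suc k)) < levy_weight I x"
      using reals_Archimedean by blast
    then show "x \<in> (\<Union>k. E k)"
      using x by (auto simp: E_def inverse_eq_divide intro!: exI[of _ k])
  qed
  have fin: "emeasure \<nu>1 (E k) < \<infinity>" "emeasure \<nu>2 (E k) < \<infinity>" for k
    using emeasure_levy_weight_ge_finite[OF \<nu>(1) subset_refl, of "1 / real (Suc k)"]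
      emeasure_levy_weight_ge_finite[OF \<nu>(2) subset_refl, of "1 / real (Suc k)"] by (simp_all add: E_def sp)
  obtain p n P where pn: "sets p = sets \<nu>1" "sets n = sets \<nu>1" "P \<in> sets \<nu>1" "P \<subseteq> (\<Union>k. E k)"
    "emeasure n P = 0" "emeasure p (space \<nu>1 - P) = 0" "emeasure n (space \<nu>1 - (\<Union>k. E k)) = 0"
    and add: "\<And>A. A \<in> sets \<nu>1 \<Longrightarrow> emeasure \<nu>1 (A \<inter> (\<Union>k. E k)) + emeasure n A = emeasure \<nu>2 (A \<inter> (\<Union>k. E k)) + emeasure p A"
    and p_le: "\<And>A. A \<in> sets \<nu>1 \<Longrightarrow> emeasure p A \<le> emeasure \<nu>1 (A \<inter> (\<Union>k. E k))"
    and n_le: "\<And>A. A \<in> sets \<nu>1 \<Longrightarrow> emeasure n A \<le> emeasure \<nu>2 (A \<inter> (\<Union>k. E k))"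
    by (rule mutually_singular_decomposition[OF s21 E fin]) (assumption | rule that)+
  have Um: "(\<Union>k. E k) \<in> sets \<nu>1" using E by auto
  have mono: "emeasure \<mu> (A \<inter> B) \<le> emeasure \<mu> A" if "A \<in> sets \<mu>" for \<mu> :: "('a \<Rightarrow> real) measure" and A B
    using that by (intro emeasure_mono) auto
  have p: "levy_integrable I p"
    using order_trans[OF p_le mono] pn by (intro levy_integrable_mono[OF \<nu>(1)]) auto
  have n: "levy_integrable I n"
    using order_trans[OF n_le mono] pn s by (intro levy_integrable_mono[OF \<nu>(2)]) auto
  have null: "levy_integrable I (null_measure (path_space I))"
    by (simp add: levy_integrable_def)
  have "agree_off_origin I (add_measure \<nu>1 n) (add_measure p \<nu>2)"
    unfolding agree_off_origin_def
  proof (intro ballI impI)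
    fix A assume A: "A \<in> sets (path_space I)" "origin I \<notin> A"
    then have "A \<inter> (\<Union>k. E k) = A"
      using sets.sets_into_space[OF A(1)] unfolding U by auto
    then show "emeasure (add_measure \<nu>1 n) A = emeasure (add_measure p \<nu>2) A"
      using add[of A] A pn s by (simp add: emeasure_add_measure add.commute)
  qed
  then have J: "diff_integral \<nu>1 \<nu>2 (lk_integrand chi I \<theta>) = diff_integral p n (lk_integrand chi I \<theta>)" for \<theta>
    by (intro diff_integral_eq_if_agree[OF chi I \<nu> p n])
  then have ex: "lk_exponent chi I S (diff_integral \<nu>1 \<nu>2) b = lk_exponent chi I S (diff_integral p n) b"
    by (simp add: lk_exponent_def fun_eq_iff)
  have dens: "emeasure (density n (\<lambda>x. (cos_weight I h x)\<^sup>2)) A \<le> emeasure (density p (\<lambda>x. (cos_weight I h x)\<^sup>2)) A" for h A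
  proof (rule density_le_if_pd[OF I])
    fix cs
    show "0 \<le> Re (pd_form cs cs (\<lambda>\<theta>. weighted_char I p (\<lambda>x. (cos_weight I h x)\<^sup>2) \<theta> - weighted_char I n (\<lambda>x. (cos_weight I h x)\<^sup>2) \<theta>))"
      using pd_second_diff_id_exponent[OF chi \<nu> I id ch, of cs h]
      unfolding ex second_diff_second_diff_lk_exponent[OF chi p n I subset_refl, abs_def] .
  qed (simp_all add: integrable_cos_weight_power2[OF chi p I subset_refl] integrable_cos_weight_power2[OF chi n I subset_refl] pn s)
  \<comment> \<open>On \<open>P\<close> the measure \<open>n\<close> has no mass; off
    \<open>P\<close> the weighted \<open>n\<close> lies below the weighted \<open>p\<close>, which
    has no mass there.\<close>
  have "density n (\<lambda>x. (cos_weight I h x)\<^sup>2) = null_measure (path_space I)" for h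
  proof (rule measure_eqI)
    fix A assume "A \<in> sets (density n (\<lambda>x. (cos_weight I h x)\<^sup>2))"
    then have A: "A \<in> sets \<nu>1" by (simp add: pn)
    have m: "(\<lambda>x. ennreal ((cos_weight I h x)\<^sup>2)) \<in> borel_measurable p" "(\<lambda>x. ennreal ((cos_weight I h x)\<^sup>2)) \<in> borel_measurable n"
      using cos_weight_measurable[OF levy_integrable_sets[OF p] subset_refl, of h]
        cos_weight_measurable[OF levy_integrable_sets[OF n] subset_refl, of h] by measurable
    have nP: "emeasure (density n (\<lambda>x. (cos_weight I h x)\<^sup>2)) P = 0"
      using pn m by (intro absolutely_continuousD[OF absolutely_continuousI_density]) auto
    have "emeasure (density p (\<lambda>x. (cos_weight I h x)\<^sup>2)) (space \<nu>1 - P) = 0"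
      using pn m by (intro absolutely_continuousD[OF absolutely_continuousI_density]) auto
    then have nPc: "emeasure (density n (\<lambda>x. (cos_weight I h x)\<^sup>2)) (space \<nu>1 - P) = 0"
      using dens[of h "space \<nu>1 - P"] by simp
    have "emeasure (density n (\<lambda>x. (cos_weight I h x)\<^sup>2)) A \<le>
        emeasure (density n (\<lambda>x. (cos_weight I h x)\<^sup>2)) (P \<union> (space \<nu>1 - P))"
      using pn A sets.sets_into_space[OF A] by (intro emeasure_mono) auto
    also have "\<dots> = 0"
      using nP nPc pn by (subst emeasure_Un_null_set) (auto intro!: null_setsI)
    finally show "emeasure (density n (\<lambda>x. (cos_weight I h x)\<^sup>2)) A = emeasure (null_measure (path_space I)) A"
      by simp
  qed (simp add: pn s)
  then have agree: "agree_off_origin I n (null_measure (path_space I))"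
    by (intro agree_off_origin_if_density_eq[OF I]) (simp_all add: pn s)
  have "(CLINT x|n. lk_integrand chi I \<theta> x) = (CLINT x|null_measure (path_space I). lk_integrand chi I \<theta> x)" for \<theta>
    by (rule integral_agree_off_origin[OF I _ _ agree lk_integrand_measurable[OF chi refl subset_refl]])
      (simp_all add: pn s)
  then show ?thesis
    using J by (intro that[OF p]) (simp add: lk_exponent_def)
qed

section \<open>Levy measures on path space\<close>

text \<open>Coordinate cylinders depend on one coordinate, and countable unions of countable sets of
  coordinates are countable.\<close>

lemma sets_path_space_countable_dependence:
  assumes "A \<in> sets (path_space T)"
  shows "\<exists>C\<subseteq>T. countable C \<and> (\<forall>x\<in>space (path_space T). \<forall>y\<in>space (path_space T).
    (\<forall>t\<in>C. x t = y t) \<longrightarrow> x \<in> A \<longrightarrow> y \<in> A)"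
  using assms unfolding sets_PiM_single
proof (induction rule: sigma_sets.induct)
  case (Basic A)
  then obtain t B where t: "t \<in> T" and A: "A = {f \<in> \<Pi>\<^sub>E i\<in>T. space borel. f t \<in> B}" by auto
  then show ?case
    by (intro exI[of _ "{t}"]) (auto simp: space_PiM)
next
  case Empty
  then show ?case by auto
next
  case (Compl A)
  from Compl.IH obtain C where C: "C \<subseteq> T" "countable C"
    "\<forall>x\<in>space (path_space T). \<forall>y\<in>space (path_space T). (\<forall>t\<in>C. x t = y t) \<longrightarrow> x \<in> A \<longrightarrow> y \<in> A"
    by (elim exE conjE)
  show ?case
  proof (intro exI[of _ C] conjI ballI impI)
    fix x y assume *: "x \<in> space (path_space T)" "y \<in> space (path_space T)" "\<forall>t\<in>C. x t = y t"
      "x \<in> (\<Pi>\<^sub>E i\<in>T. space borel) - A"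
    \<comment> \<open>The implication is quantified over both paths, so exchanging them turns
      dependence of \<open>A\<close> into dependence of its complement.\<close>
    from *(3) have "\<forall>t\<in>C. y t = x t" by auto
    with C(3) *(1,2,4) have "y \<notin> A" by blast
    then show "y \<in> (\<Pi>\<^sub>E i\<in>T. space borel) - A"
      using *(2) by (simp add: space_PiM)
  qed (use C in auto)
next
  case (Union A)
  have "\<forall>i. \<exists>C. C \<subseteq> T \<and> countable C \<and>
    (\<forall>x\<in>space (path_space T). \<forall>y\<in>space (path_space T). (\<forall>t\<in>C. x t = y t) \<longrightarrow> x \<in> A i \<longrightarrow> y \<in> A i)"
    by (intro allI Union.IH)
  from choice[OF this] obtain C where "\<forall>i. C i \<subseteq> T \<and> countable (C i) \<and>
    (\<forall>x\<in>space (path_space T). \<forall>y\<in>space (path_space T). (\<forall>t\<in>C i. x t = y t) \<longrightarrow> x \<in> A i \<longrightarrow> y \<in> A i)"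
    by (elim exE)
  note C = this[THEN spec, THEN conjunct1] this[THEN spec, THEN conjunct2, THEN conjunct1]
    this[THEN spec, THEN conjunct2, THEN conjunct2]
  show ?case
  proof (intro exI[of _ "\<Union>i. C i"] conjI ballI impI)
    fix x y assume *: "x \<in> space (path_space T)" "y \<in> space (path_space T)" "\<forall>t\<in>(\<Union>i. C i). x t = y t" "x \<in> (\<Union>i. A i)"
    then obtain i where i: "x \<in> A i" by blast
    have "\<forall>t\<in>C i. x t = y t" using *(3) by blast
    with C(3)[of i] *(1,2) i have "y \<in> A i" by blast
    then show "y \<in> (\<Union>i. A i)" by blast
  next
    show "(\<Union>i. C i) \<subseteq> T" using C(1) by (rule UN_least)
    show "countable (\<Union>i. C i)" using C(2) by (intro countable_UN) auto
  qed
qed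

text \<open>For countable \<open>C\<close> a measurable substitute for the complement of
  \<open>{origin T}\<close>, which in general is not measurable.\<close>

definition nonzero_set :: "'t set \<Rightarrow> 't set \<Rightarrow> ('t \<Rightarrow> real) set" where
  "nonzero_set T C = {x \<in> space (path_space T). \<exists>t\<in>C. x t \<noteq> 0}"

lemma nonzero_set_mono: "C \<subseteq> D \<Longrightarrow> nonzero_set T C \<subseteq> nonzero_set T D"
  by (auto simp: nonzero_set_def)

lemma nonzero_set_UN: "nonzero_set T C = (\<Union>t\<in>C. nonzero_set T {t})"
  by (auto simp: nonzero_set_def)

lemma nonzero_set_measurable:
  assumes "C \<subseteq> T" "countable C"
  shows "nonzero_set T C \<in> sets (path_space T)"
proof -
  have "nonzero_set T {t} \<in> sets (path_space T)" if "t \<in> C" for t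
  proof -
    have [measurable]: "(\<lambda>x. x t) \<in> borel_measurable (path_space T)"
      using assms that by (intro measurable_component_singleton) auto
    have "nonzero_set T {t} = {x \<in> space (path_space T). x t \<noteq> 0}"
      by (auto simp: nonzero_set_def)
    also have "\<dots> \<in> sets (path_space T)" by measurable
    finally show ?thesis .
  qed
  then show ?thesis
    unfolding nonzero_set_UN[of T C] using assms by (intro sets.countable_UN') auto
qed

lemma origin_notin_nonzero_set: "C \<subseteq> T \<Longrightarrow> origin T \<notin> nonzero_set T C"
  by (auto simp: nonzero_set_def)

text \<open>If \<open>A\<close> depends only on the coordinates in \<open>C\<close>, a path of
  \<open>A\<close> vanishing on \<open>C\<close> would agree there with the origin and force the
  origin into \<open>A\<close>.\<close>

lemma subset_nonzero_set_if_origin_notin: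
  assumes A: "A \<in> sets (path_space T)" "origin T \<notin> A"
  obtains C where "C \<subseteq> T" "countable C" "A \<subseteq> nonzero_set T C"
proof -
  obtain C where C: "C \<subseteq> T" "countable C"
    "\<And>x y. x \<in> space (path_space T) \<Longrightarrow> y \<in> space (path_space T) \<Longrightarrow> (\<forall>t\<in>C. x t = y t) \<Longrightarrow> x \<in> A \<Longrightarrow> y \<in> A"
    using sets_path_space_countable_dependence[OF A(1)] by blast
  have "A \<subseteq> nonzero_set T C"
  proof
    fix x assume x: "x \<in> A"
    then have xs: "x \<in> space (path_space T)"
      using A sets.sets_into_space by blast
    show "x \<in> nonzero_set T C"
    proof (rule ccontr)
      assume "x \<notin> nonzero_set T C"
      then have "\<forall>t\<in>C. x t = origin T t"
        using xs C(1) by (auto simp: nonzero_set_def)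
      then show False
        using C(3)[OF xs origin_in_space _ x] A(2) by auto
    qed
  qed
  with C(1,2) show ?thesis by (rule that)
qed

lemma inner_measure_le: "A \<in> sets M \<Longrightarrow> B \<subseteq> A \<Longrightarrow> inner_measure M B \<le> emeasure M A"
  unfolding inner_measure_def by (intro SUP_least emeasure_mono) auto

lemma le_inner_measure: "B \<in> sets M \<Longrightarrow> B \<subseteq> A \<Longrightarrow> emeasure M B \<le> inner_measure M A"
  unfolding inner_measure_def by (intro SUP_upper) auto

lemma inner_measure_mono: "A \<subseteq> B \<Longrightarrow> inner_measure M A \<le> inner_measure M B"
  unfolding inner_measure_def by (intro SUP_subset_mono) auto

text \<open>The supremum in the inner measure is reached along a sequence of sets avoiding the
  origin, each of which is caught by countably many coordinates. Their union turns regularity at the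
  origin into a statement about one countable set \<open>C\<close>.\<close>

lemma emeasure_eq_inner_measure_iff:
  assumes s: "sets \<mu> = sets (path_space T)" and A: "A \<in> sets (path_space T)"
  shows "emeasure \<mu> A = inner_measure \<mu> (A - {origin T}) \<longleftrightarrow>
    (\<exists>C\<subseteq>T. countable C \<and> emeasure \<mu> (A \<inter> nonzero_set T C) = emeasure \<mu> A)"
proof
  assume eq: "emeasure \<mu> A = inner_measure \<mu> (A - {origin T})"
  let ?S = "{B \<in> sets \<mu>. B \<subseteq> A - {origin T}}"
  have "?S \<noteq> {}" by auto
  from ennreal_SUP_countable_SUP[OF this, of "emeasure \<mu>"] obtain f :: "nat \<Rightarrow> ennreal"
    where f: "range f \<subseteq> emeasure \<mu> ` ?S" "Sup (emeasure \<mu> ` ?S) = Sup (range f)"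
    by (elim exE conjE)
  have "\<forall>n. \<exists>B. B \<in> ?S \<and> f n = emeasure \<mu> B"
  proof
    fix n
    have "f n \<in> emeasure \<mu> ` ?S" using f(1) by (rule subsetD) simp
    then show "\<exists>B. B \<in> ?S \<and> f n = emeasure \<mu> B" by (elim imageE) (intro exI conjI)
  qed
  from choice[OF this] obtain B where B': "\<forall>n. B n \<in> ?S \<and> f n = emeasure \<mu> (B n)" by (elim exE)
  have B: "B n \<in> ?S" "f n = emeasure \<mu> (B n)" for n using B' by simp_all
  have "\<exists>C. C \<subseteq> T \<and> countable C \<and> B n \<subseteq> nonzero_set T C" for n
  proof -
    have "B n \<in> sets (path_space T)" "origin T \<notin> B n"
      using B(1)[of n] s by auto
    then show ?thesis
      by (rule subset_nonzero_set_if_origin_notin) (intro exI conjI)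
  qed
  then have "\<forall>n. \<exists>C. C \<subseteq> T \<and> countable C \<and> B n \<subseteq> nonzero_set T C" ..
  from choice[OF this] obtain C where C': "\<forall>n. C n \<subseteq> T \<and> countable (C n) \<and> B n \<subseteq> nonzero_set T (C n)"
    by (elim exE)
  have C: "C n \<subseteq> T" "countable (C n)" "B n \<subseteq> nonzero_set T (C n)" for n using C' by simp_all
  let ?C = "\<Union>n. C n"
  have CT: "?C \<subseteq> T" "countable ?C" using C by auto
  have m: "A \<inter> nonzero_set T ?C \<in> sets \<mu>"
    using A s nonzero_set_measurable[OF CT] by auto
  have "emeasure \<mu> A = (SUP n. emeasure \<mu> (B n))"
    using eq f(2) B(2) by (simp add: inner_measure_def)
  also have "\<dots> \<le> emeasure \<mu> (A \<inter> nonzero_set T ?C)"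
  proof (intro SUP_least emeasure_mono m)
    show "B n \<subseteq> A \<inter> nonzero_set T ?C" for n
      using B(1)[of n] C(3)[of n] nonzero_set_mono[of "C n" ?C T] by auto
  qed
  finally have "emeasure \<mu> A \<le> emeasure \<mu> (A \<inter> nonzero_set T ?C)" .
  moreover have "emeasure \<mu> (A \<inter> nonzero_set T ?C) \<le> emeasure \<mu> A"
    using A s by (intro emeasure_mono) auto
  ultimately show "\<exists>C\<subseteq>T. countable C \<and> emeasure \<mu> (A \<inter> nonzero_set T C) = emeasure \<mu> A"
    using CT by (intro exI[of _ ?C]) auto
next
  assume "\<exists>C\<subseteq>T. countable C \<and> emeasure \<mu> (A \<inter> nonzero_set T C) = emeasure \<mu> A"
  then obtain C where C: "C \<subseteq> T" "countable C" "emeasure \<mu> (A \<inter> nonzero_set T C) = emeasure \<mu> A" by auto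
  have "emeasure \<mu> (A \<inter> nonzero_set T C) \<le> inner_measure \<mu> (A - {origin T})"
    using A s nonzero_set_measurable[OF C(1,2)] origin_notin_nonzero_set[OF C(1)]
    by (intro le_inner_measure) auto
  then show "emeasure \<mu> A = inner_measure \<mu> (A - {origin T})"
    using C(3) A s inner_measure_le[of A \<mu> "A - {origin T}"] by (intro antisym) simp_all
qed

lemma levy_measure_iff:
  "levy_measure T \<nu> \<longleftrightarrow> levy_integrable T \<nu> \<and> (\<forall>A\<in>sets (path_space T).
     \<exists>C\<subseteq>T. countable C \<and> emeasure \<nu> (A \<inter> nonzero_set T C) = emeasure \<nu> A)"
  unfolding levy_measure_def levy_integrable_def
  using emeasure_eq_inner_measure_iff[of \<nu> T] by auto

section \<open>Marginals and equality of Levy measures on path space\<close>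

text \<open>The image under restriction may have infinite mass at \<open>origin I\<close>, that of
  the paths vanishing on \<open>I\<close>; this is why marginals are compared only off the
  origin.\<close>

definition marginal :: "'t set \<Rightarrow> ('t \<Rightarrow> real) measure \<Rightarrow> ('t \<Rightarrow> real) measure" where
  "marginal I \<nu> = distr \<nu> (path_space I) (\<lambda>x. restrict x I)"

lemma sets_marginal [simp, measurable_cong]: "sets (marginal I \<nu>) = sets (path_space I)"
  by (simp add: marginal_def)

lemma measurable_restrict_path:
  assumes "sets \<nu> = sets (path_space T)" "I \<subseteq> T"
  shows "(\<lambda>x. restrict x I) \<in> measurable \<nu> (path_space I)"
  unfolding measurable_cong_sets[OF assms(1) refl] using assms(2) by (rule measurable_restrict_subset)

lemma inner_prod_on_restrict [simp]: "inner_prod_on I \<theta> (restrict x I) = inner_prod_on I \<theta> x"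
  by (simp add: inner_prod_on_def)

lemma lk_integrand_restrict [simp]: "lk_integrand chi I \<theta> (restrict x I) = lk_integrand chi I \<theta> x"
  by (simp add: lk_integrand_def inner_prod_on_def truncate_def)

lemma emeasure_marginal:
  assumes "sets \<nu> = sets (path_space T)" "I \<subseteq> T" "B \<in> sets (path_space I)"
  shows "emeasure (marginal I \<nu>) B = emeasure \<nu> (prod_emb T (\<lambda>_. borel) I B)"
  unfolding marginal_def using measurable_restrict_path[OF assms(1,2)] assms
  by (simp add: emeasure_distr prod_emb_def sets_eq_imp_space_eq[OF assms(1)] space_PiM)

lemma nn_integral_marginal:
  assumes "sets \<nu> = sets (path_space T)" "I \<subseteq> T" "g \<in> borel_measurable (path_space I)"
  shows "(\<integral>\<^sup>+x. g x \<partial>marginal I \<nu>) = (\<integral>\<^sup>+x. g (restrict x I) \<partial>\<nu>)"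
  unfolding marginal_def using measurable_restrict_path[OF assms(1,2)] assms(3) by (simp add: nn_integral_distr)

lemma levy_integrable_marginal:
  assumes \<nu>: "levy_integrable T \<nu>" and I: "I \<subseteq> T"
  shows "levy_integrable I (marginal I \<nu>)"
  unfolding levy_integrable_def
proof (intro conjI ballI)
  fix t assume t: "t \<in> I"
  have [measurable]: "(\<lambda>x. x t) \<in> borel_measurable (path_space I)"
    using t by (rule measurable_component_singleton)
  have "(\<integral>\<^sup>+x. ennreal (min (\<bar>x t\<bar>\<^sup>2) 1) \<partial>marginal I \<nu>) = (\<integral>\<^sup>+x. ennreal (min (\<bar>restrict x I t\<bar>\<^sup>2) 1) \<partial>\<nu>)"
    by (rule nn_integral_marginal[OF levy_integrable_sets[OF \<nu>] I]) measurable
  then show "(\<integral>\<^sup>+x. ennreal (min (\<bar>x t\<bar>\<^sup>2) 1) \<partial>marginal I \<nu>) < \<infinity>"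
    using \<nu> t I by (auto simp: levy_integrable_def)
qed simp

lemma integral_lk_integrand_marginal:
  assumes chi: "truncation_factor chi" and s: "sets \<nu> = sets (path_space T)" and I: "I \<subseteq> T"
  shows "(CLINT x|marginal I \<nu>. lk_integrand chi I \<theta> x) = (CLINT x|\<nu>. lk_integrand chi I \<theta> x)"
  unfolding marginal_def
  by (subst integral_distr[OF measurable_restrict_path[OF s I] lk_integrand_measurable[OF chi refl subset_refl]]) simp

lemma nn_integral_eq_if_agree_on:
  assumes s1: "sets \<mu>1 = sets (path_space I)" and s2: "sets \<mu>2 = sets (path_space I)" and D: "D \<in> sets (path_space I)"
    and eq: "\<And>B. B \<in> sets (path_space I) \<Longrightarrow> B \<subseteq> D \<Longrightarrow> emeasure \<mu>1 B = emeasure \<mu>2 B"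
    and g: "g \<in> borel_measurable (path_space I)" "\<And>x. x \<in> space (path_space I) \<Longrightarrow> x \<notin> D \<Longrightarrow> g x = 0"
  shows "(\<integral>\<^sup>+x. g x \<partial>\<mu>1) = (\<integral>\<^sup>+x. g x \<partial>\<mu>2)"
proof -
  have *: "(\<integral>\<^sup>+x. g x \<partial>\<mu>) = (\<integral>\<^sup>+x. g x \<partial>density \<mu> (indicator D))" if s: "sets \<mu> = sets (path_space I)" for \<mu>
  proof -
    have "(\<integral>\<^sup>+x. g x \<partial>density \<mu> (indicator D)) = (\<integral>\<^sup>+x. indicator D x * g x \<partial>\<mu>)"
      using D g(1) s by (intro nn_integral_density) (auto cong: measurable_cong_sets)
    also have "\<dots> = (\<integral>\<^sup>+x. g x \<partial>\<mu>)"
      using g(2) by (intro nn_integral_cong) (auto simp: indicator_def sets_eq_imp_space_eq[OF s])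
    finally show ?thesis ..
  qed
  have "density \<mu>1 (indicator D) = density \<mu>2 (indicator D)"
    by (rule density_indicator_eqI[OF s1 s2 D eq])
  then show ?thesis
    using *[OF s1] *[OF s2] by simp
qed

text \<open>The finite measures \<open>min (x\<^sub>t\<^sup>2) 1 \<partial>\<mu>\<^sub>i\<close> agree on cylinders, hence everywhere.\<close>

lemma emeasure_eq_on_nonzero_set:
  assumes \<mu>1: "levy_integrable T \<mu>1" and \<mu>2: "levy_integrable T \<mu>2"
    and t: "t \<in> J0" and J0: "finite J0" "J0 \<subseteq> T"
    and eq: "\<And>J B. finite J \<Longrightarrow> J0 \<subseteq> J \<Longrightarrow> J \<subseteq> T \<Longrightarrow> B \<in> sets (path_space J) \<Longrightarrow> B \<subseteq> nonzero_set J {t} \<Longrightarrow>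
       emeasure (marginal J \<mu>1) B = emeasure (marginal J \<mu>2) B"
    and A: "A \<in> sets (path_space T)" "A \<subseteq> nonzero_set T {t}"
  shows "emeasure \<mu>1 A = emeasure \<mu>2 A"
proof -
  let ?w = "\<lambda>x :: 'a \<Rightarrow> real. ennreal (min (\<bar>x t\<bar>\<^sup>2) 1)"
  have tT: "t \<in> T" using t J0 by auto
  have w: "?w \<in> borel_measurable (path_space J)" if "t \<in> J" for J
  proof -
    have [measurable]: "(\<lambda>x. x t) \<in> borel_measurable (path_space J)"
      using that by (rule measurable_component_singleton)
    show ?thesis by measurable
  qed
  note s = \<mu>1[THEN levy_integrable_sets] \<mu>2[THEN levy_integrable_sets]
  have wm: "?w \<in> borel_measurable \<mu>1" "?w \<in> borel_measurable \<mu>2"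
    using w[OF tT] s by (auto cong: measurable_cong_sets)
  have "density \<mu>1 ?w = density \<mu>2 ?w"
  proof (rule measure_eqI_PiM_infinite[where I = T and M = "\<lambda>_. borel"])
    show "sets (density \<mu>1 ?w) = sets (path_space T)" "sets (density \<mu>2 ?w) = sets (path_space T)"
      by (simp_all add: s)
    have "emeasure (density \<mu>1 ?w) (space \<mu>1) < \<infinity>"
    proof -
      have "emeasure (density \<mu>1 ?w) (space \<mu>1) = (\<integral>\<^sup>+x. ?w x * indicator (space \<mu>1) x \<partial>\<mu>1)"
        using wm(1) by (rule emeasure_density) simp
      also have "\<dots> = (\<integral>\<^sup>+x. ?w x \<partial>\<mu>1)"
        by (intro nn_integral_cong) simp
      also have "\<dots> < \<infinity>"
        using \<mu>1 tT by (simp add: levy_integrable_def)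
      finally show ?thesis .
    qed
    then show "finite_measure (density \<mu>1 ?w)"
      by (intro finite_measureI) auto
    fix F J assume J: "finite J" "J \<subseteq> T" and F: "\<And>j. j \<in> J \<Longrightarrow> F j \<in> sets (borel :: real measure)"
    \<comment> \<open>Enlarging \<open>J\<close> by \<open>J0\<close> makes the coordinate
      \<open>t\<close>, and with it the weight, visible in the marginal and brings the index set
      into the range of the hypothesis.\<close>
    let ?K = "J \<union> J0" and ?B = "\<Pi>\<^sub>E j\<in>J. F j"
    let ?g = "\<lambda>x. ?w x * indicator (prod_emb ?K (\<lambda>_. borel) J ?B) x"
    have K: "finite ?K" "?K \<subseteq> T" "J0 \<subseteq> ?K" "t \<in> ?K" using J J0 t by auto
    have B: "?B \<in> sets (path_space J)"
      using J F by (intro sets_PiM_I_finite) auto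
    have emb: "prod_emb ?K (\<lambda>_. borel) J ?B \<in> sets (path_space ?K)" "prod_emb T (\<lambda>_. borel) J ?B \<in> sets (path_space T)"
      using B J by (auto intro!: measurable_prod_emb)
    have g: "?g \<in> borel_measurable (path_space ?K)"
      using w[OF K(4)] emb(1) by measurable
    have *: "emeasure (density \<mu> ?w) (prod_emb T (\<lambda>_. borel) J ?B) = (\<integral>\<^sup>+x. ?g x \<partial>marginal ?K \<mu>)"
      if s: "sets \<mu> = sets (path_space T)" for \<mu>
    proof -
      have "(\<integral>\<^sup>+x. ?g x \<partial>marginal ?K \<mu>) = (\<integral>\<^sup>+x. ?g (restrict x ?K) \<partial>\<mu>)"
        by (rule nn_integral_marginal[OF s K(2) g])
      also have "\<dots> = (\<integral>\<^sup>+x. ?w x * indicator (prod_emb T (\<lambda>_. borel) J ?B) x \<partial>\<mu>)"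
        using K(4) J by (intro nn_integral_cong)
          (auto simp: indicator_def prod_emb_def space_PiM sets_eq_imp_space_eq[OF s] restrict_def Int_absorb1 split: if_splits)
      also have "\<dots> = emeasure (density \<mu> ?w) (prod_emb T (\<lambda>_. borel) J ?B)"
        using w[OF tT] emb(2) s by (subst emeasure_density) (auto cong: measurable_cong_sets)
      finally show ?thesis ..
    qed
    show "emeasure (density \<mu>1 ?w) (prod_emb T (\<lambda>_. borel) J ?B) = emeasure (density \<mu>2 ?w) (prod_emb T (\<lambda>_. borel) J ?B)"
      unfolding *[OF s(1)] *[OF s(2)]
    proof (rule nn_integral_eq_if_agree_on[where I = ?K and D = "nonzero_set ?K {t}"])
      show "nonzero_set ?K {t} \<in> sets (path_space ?K)"
        using K by (intro nonzero_set_measurable) auto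
      show "emeasure (marginal ?K \<mu>1) B = emeasure (marginal ?K \<mu>2) B"
        if "B \<in> sets (path_space ?K)" "B \<subseteq> nonzero_set ?K {t}" for B
        using that K by (intro eq) auto
    qed (use g in \<open>auto simp: nonzero_set_def\<close>)
  qed
  \<comment> \<open>The weight is positive on \<open>A\<close>, so integrating its reciprocal
    against the weighted measure recovers the possibly infinite mass of \<open>A\<close>.\<close>
  moreover have "emeasure \<mu> A = (\<integral>\<^sup>+x. (1 / ?w x) * indicator A x \<partial>density \<mu> ?w)"
    if s: "sets \<mu> = sets (path_space T)" for \<mu>
  proof -
    have m: "?w \<in> borel_measurable \<mu>" "(\<lambda>x. (1 / ?w x) * indicator A x) \<in> borel_measurable \<mu>"
      using w[OF tT] A(1) unfolding measurable_cong_sets[OF s refl] by measurable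
    have "(\<integral>\<^sup>+x. (1 / ?w x) * indicator A x \<partial>density \<mu> ?w) = (\<integral>\<^sup>+x. ?w x * ((1 / ?w x) * indicator A x) \<partial>\<mu>)"
      by (rule nn_integral_density[OF m])
    also have "\<dots> = (\<integral>\<^sup>+x. indicator A x \<partial>\<mu>)"
    proof (intro nn_integral_cong)
      fix x
      show "?w x * ((1 / ?w x) * indicator A x) = indicator A x"
      proof (cases "x \<in> A")
        case True
        then have "0 < min (\<bar>x t\<bar>\<^sup>2) 1" using A(2) by (auto simp: nonzero_set_def)
        then have "?w x \<noteq> 0" "?w x \<noteq> top" by (simp_all only: ennreal_eq_0_iff not_le ennreal_neq_top not_False_eq_True)
        then show ?thesis by (simp add: ennreal_times_divide ennreal_divide_self less_top mult.assoc[symmetric])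
      qed simp
    qed
    finally show ?thesis
      using A(1) s by simp
  qed
  ultimately show ?thesis
    using s by simp
qed

text \<open>For each \<open>A\<close> regularity gives a countable set of coordinates for either
  measure. On their union the problem splits into the sets where a single coordinate is nonzero, and
  these are governed by finite-dimensional marginals.\<close>

lemma levy_measure_eqI:
  assumes \<mu>1: "levy_measure T \<mu>1" and \<mu>2: "levy_measure T \<mu>2"
    and eq: "\<And>I. finite I \<Longrightarrow> I \<noteq> {} \<Longrightarrow> I \<subseteq> T \<Longrightarrow> agree_off_origin I (marginal I \<mu>1) (marginal I \<mu>2)"
  shows "\<mu>1 = \<mu>2"
proof (rule measure_eqI)
  have l: "levy_integrable T \<mu>1" "levy_integrable T \<mu>2"
    using \<mu>1 \<mu>2 by (simp_all add: levy_measure_iff)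
  then have s: "sets \<mu>1 = sets (path_space T)" "sets \<mu>2 = sets (path_space T)"
    by (simp_all add: levy_integrable_def)
  then show "sets \<mu>1 = sets \<mu>2" by simp
  fix A assume "A \<in> sets \<mu>1"
  then have A: "A \<in> sets (path_space T)" by (simp add: s)
  obtain C1 where C1: "C1 \<subseteq> T" "countable C1" "emeasure \<mu>1 (A \<inter> nonzero_set T C1) = emeasure \<mu>1 A"
    using \<mu>1 A by (auto simp: levy_measure_iff)
  obtain C2 where C2: "C2 \<subseteq> T" "countable C2" "emeasure \<mu>2 (A \<inter> nonzero_set T C2) = emeasure \<mu>2 A"
    using \<mu>2 A by (auto simp: levy_measure_iff)
  let ?C = "C1 \<union> C2"
  have C: "?C \<subseteq> T" "countable ?C" using C1 C2 by auto
  have m: "A \<inter> nonzero_set T ?C \<in> sets (path_space T)"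
    using A nonzero_set_measurable[OF C] by auto
  have "emeasure \<mu>1 (A \<inter> nonzero_set T ?C) = emeasure \<mu>2 (A \<inter> nonzero_set T ?C)"
  proof (rule emeasure_eq_on_countable_cover[where C = ?C and E = "\<lambda>t. nonzero_set T {t}"])
    show "nonzero_set T {t} \<in> sets \<mu>1" if "t \<in> ?C" for t
      unfolding s using that C by (intro nonzero_set_measurable) auto
    show "A \<inter> nonzero_set T ?C \<subseteq> (\<Union>t\<in>?C. nonzero_set T {t})"
      by (auto simp: nonzero_set_def)
    fix t B assume t: "t \<in> ?C" and B: "B \<in> sets \<mu>1" "B \<subseteq> nonzero_set T {t}"
    show "emeasure \<mu>1 B = emeasure \<mu>2 B"
    proof (rule emeasure_eq_on_nonzero_set[OF l, of t "{t}"])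
      fix J D assume J: "finite J" "{t} \<subseteq> J" "J \<subseteq> T" and D: "D \<in> sets (path_space J)" "D \<subseteq> nonzero_set J {t}"
      then have "origin J \<notin> D"
        using origin_notin_nonzero_set[of "{t}" J] by auto
      then show "emeasure (marginal J \<mu>1) D = emeasure (marginal J \<mu>2) D"
        using eq[of J] J D by (auto simp: agree_off_origin_def)
    qed (use t C B s in auto)
  qed (use m s C in auto)
  moreover have "emeasure \<mu>1 (A \<inter> nonzero_set T ?C) = emeasure \<mu>1 A"
  proof (rule antisym)
    have "emeasure \<mu>1 (A \<inter> nonzero_set T C1) \<le> emeasure \<mu>1 (A \<inter> nonzero_set T ?C)"
      using m s nonzero_set_mono[of C1 ?C T] by (intro emeasure_mono) auto
    then show "emeasure \<mu>1 A \<le> emeasure \<mu>1 (A \<inter> nonzero_set T ?C)" by (simp add: C1)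
  qed (use A s in \<open>auto intro!: emeasure_mono\<close>)
  moreover have "emeasure \<mu>2 (A \<inter> nonzero_set T ?C) = emeasure \<mu>2 A"
  proof (rule antisym)
    have "emeasure \<mu>2 (A \<inter> nonzero_set T C2) \<le> emeasure \<mu>2 (A \<inter> nonzero_set T ?C)"
      using m s nonzero_set_mono[of C2 ?C T] by (intro emeasure_mono) auto
    then show "emeasure \<mu>2 A \<le> emeasure \<mu>2 (A \<inter> nonzero_set T ?C)" by (simp add: C2)
  qed (use A s in \<open>auto intro!: emeasure_mono\<close>)
  ultimately show "emeasure \<mu>1 A = emeasure \<mu>2 A" by simp
qed

section \<open>Projective limits of Levy measures\<close>

lemma levy_weight_restrict [simp]: "I \<subseteq> J \<Longrightarrow> levy_weight I (restrict x J) = levy_weight I x"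
  unfolding levy_weight_def by (intro sum.cong refl) auto

lemma levy_weight_pos_iff_nonzero_set:
  "finite I \<Longrightarrow> x \<in> space (path_space J) \<Longrightarrow> 0 < levy_weight I x \<longleftrightarrow> x \<in> nonzero_set J I"
  by (simp add: levy_weight_pos_iff nonzero_set_def)

text \<open>Consistency is asked only off the origin: paths vanishing on \<open>I\<close> but not on
  \<open>J\<close> are projected to \<open>origin I\<close>, and \<open>nu I\<close> need not record
  their mass.\<close>

locale levy_family =
  fixes T :: "'t set" and nu :: "'t set \<Rightarrow> ('t \<Rightarrow> real) measure"
  assumes lev: "\<And>I. finite I \<Longrightarrow> I \<noteq> {} \<Longrightarrow> I \<subseteq> T \<Longrightarrow> levy_integrable I (nu I)"
    and cons: "\<And>I J. finite J \<Longrightarrow> I \<noteq> {} \<Longrightarrow> I \<subseteq> J \<Longrightarrow> J \<subseteq> T \<Longrightarrow> agree_off_origin I (nu I) (marginal I (nu J))"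
begin

lemma sets_nu: "finite I \<Longrightarrow> I \<noteq> {} \<Longrightarrow> I \<subseteq> T \<Longrightarrow> sets (nu I) = sets (path_space I)"
  by (rule levy_integrable_sets[OF lev])

text \<open>The vanishing of \<open>g\<close> at the origin is what makes consistency off the origin
  sufficient for equal integrals.\<close>

lemma nn_integral_cons:
  assumes J: "finite J" "J \<subseteq> T" and I: "I \<noteq> {}" "I \<subseteq> J"
    and g: "g \<in> borel_measurable (path_space I)" "g (origin I) = 0"
  shows "(\<integral>\<^sup>+x. g x \<partial>nu I) = (\<integral>\<^sup>+x. g (restrict x I) \<partial>nu J)"
proof -
  have fI: "finite I" "I \<subseteq> T" "J \<noteq> {}" using J I finite_subset by auto
  have "(\<integral>\<^sup>+x. g x \<partial>nu I) = (\<integral>\<^sup>+x. g x \<partial>marginal I (nu J))"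
  proof (rule nn_integral_eq_if_agree_on[where I = I and D = "nonzero_set I I"])
    show "nonzero_set I I \<in> sets (path_space I)"
      using fI by (intro nonzero_set_measurable) (auto intro: countable_finite)
    show "emeasure (nu I) B = emeasure (marginal I (nu J)) B"
      if "B \<in> sets (path_space I)" "B \<subseteq> nonzero_set I I" for B
    proof -
      have "origin I \<notin> B"
        using that(2) origin_notin_nonzero_set[of I I] by auto
      with cons[OF J(1) I J(2)] that(1) show ?thesis
        by (simp add: agree_off_origin_def)
    qed
    show "g x = 0" if "x \<in> space (path_space I)" "x \<notin> nonzero_set I I" for x
      using that g(2) not_origin_iff[OF that(1)] by (cases "x = origin I") (auto simp: nonzero_set_def)
  qed (use g sets_nu[OF fI(1) I(1) fI(2)] in simp_all)
  also have "\<dots> = (\<integral>\<^sup>+x. g (restrict x I) \<partial>nu J)"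
    by (rule nn_integral_marginal[OF sets_nu[OF J(1) fI(3) J(2)] I(2) g(1)])
  finally show ?thesis .
qed

text \<open>The weight of the fixed set \<open>I\<close> gives all \<open>nu J\<close> with
  \<open>I \<subseteq> J\<close> the same finite mass \<open>m\<close>, so dividing by
  \<open>m\<close> yields a projective family of probabilities. Removing the weight from the limit
  recovers \<open>nu J\<close> only where the weight is positive, hence the indicator.\<close>

lemma ex_extension:
  assumes I: "finite I" "I \<noteq> {}" "I \<subseteq> T"
  shows "\<exists>V. sets V = sets (path_space T) \<and>
    (\<forall>J. finite J \<longrightarrow> I \<subseteq> J \<longrightarrow> J \<subseteq> T \<longrightarrow> marginal J V = density (nu J) (indicator (nonzero_set J I)))"
proof -
  define m where "m = (\<integral>x. levy_weight I x \<partial>nu I)"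
  have int: "integrable (nu I) (levy_weight I)"
    by (rule integrable_levy_weight[OF lev[OF I] subset_refl])
  have m0: "m \<ge> 0"
    unfolding m_def by (intro Bochner_Integration.integral_nonneg levy_weight_nonneg)
  have total: "(\<integral>\<^sup>+x. ennreal (levy_weight I x) \<partial>nu J) = ennreal m" if J: "finite J" "I \<subseteq> J" "J \<subseteq> T" for J
  proof -
    have "(\<integral>\<^sup>+x. ennreal (levy_weight I x) \<partial>nu I) = (\<integral>\<^sup>+x. ennreal (levy_weight I (restrict x I)) \<partial>nu J)"
      using J I levy_weight_measurable[of I I]
      by (intro nn_integral_cons) (simp_all add: levy_weight_def)
    then show ?thesis
      using nn_integral_eq_integral[OF int] by (simp add: levy_weight_nonneg m_def)
  qed
  have nzm: "nonzero_set J I \<in> sets (path_space J)" if "I \<subseteq> J" for J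
    using that I by (intro nonzero_set_measurable) (auto intro: countable_finite)
  have lwm: "levy_weight I \<in> borel_measurable (nu J)" if J: "finite J" "I \<subseteq> J" "J \<subseteq> T" for J
  proof -
    have "J \<noteq> {}" using J I by auto
    from sets_nu[OF J(1) this J(3)] levy_weight_measurable[OF J(2)] show ?thesis
      by (simp cong: measurable_cong_sets)
  qed
  show ?thesis
  proof (cases "m = 0")
    \<comment> \<open>Normalization is impossible for \<open>m = 0\<close>; but then the weight
      vanishes almost everywhere, \<open>nonzero_set J I\<close> is null and the null measure is the
      extension.\<close>
    case True
    show ?thesis
    proof (intro exI[of _ "null_measure (path_space T)"] conjI allI impI)
      fix J assume J: "finite J" "I \<subseteq> J" "J \<subseteq> T"
      then have "J \<noteq> {}" using I by auto
      note sJ = sets_nu[OF J(1) this J(3)]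
      have "emeasure (nu J) {x \<in> space (nu J). ennreal (levy_weight I x) \<noteq> 0} = 0"
        using total[OF J] lwm[OF J] True nn_integral_0_iff[of "\<lambda>x. ennreal (levy_weight I x)" "nu J"] by simp
      also have "{x \<in> space (nu J). ennreal (levy_weight I x) \<noteq> 0} = nonzero_set J I"
        using levy_weight_pos_iff_nonzero_set[OF I(1)] 
        by (auto simp: sets_eq_imp_space_eq[OF sJ] ennreal_eq_0_iff not_le nonzero_set_def)
      finally have 0: "emeasure (nu J) (nonzero_set J I) = 0" .
      show "marginal J (null_measure (path_space T)) = density (nu J) (indicator (nonzero_set J I))"
      proof (rule measure_eqI)
        fix A assume "A \<in> sets (marginal J (null_measure (path_space T)))"
        then have A: "A \<in> sets (path_space J)" by simp
        have "emeasure (density (nu J) (indicator (nonzero_set J I))) A = emeasure (nu J) (nonzero_set J I \<inter> A)"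
          using A nzm[OF J(2)] sJ by (simp add: emeasure_density flip: indicator_inter_arith)
        also have "\<dots> \<le> emeasure (nu J) (nonzero_set J I)"
          using nzm[OF J(2)] sJ by (intro emeasure_mono) auto
        finally show "emeasure (marginal J (null_measure (path_space T))) A = emeasure (density (nu J) (indicator (nonzero_set J I))) A"
          using A J 0 by (simp add: emeasure_marginal[where T = T])
      qed (simp add: sJ)
    qed simp
  next
    case False
    with m0 have m: "m > 0" by simp
    define w where "w x = ennreal (levy_weight I x / m)" for x :: "'t \<Rightarrow> real"
    have wm: "w \<in> borel_measurable (path_space J)" if "I \<subseteq> J" for J
      unfolding w_def using levy_weight_measurable[OF that] by measurable
    \<comment> \<open>The weight needs the coordinates in \<open>I\<close>, so the measure on
      \<open>J\<close> is obtained by projection from \<open>I \<union> J\<close>.\<close>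
    define P where "P J = distr (density (nu (I \<union> J)) w) (path_space J) (\<lambda>x. restrict x J)" for J
    have sP: "sets (P J) = sets (path_space J)" for J by (simp add: P_def)
    have nnP: "(\<integral>\<^sup>+x. g x \<partial>P J) = (\<integral>\<^sup>+x. w x * g (restrict x J) \<partial>nu K)"
      if J: "finite J" "J \<subseteq> T" and K: "finite K" "I \<union> J \<subseteq> K" "K \<subseteq> T" and g: "g \<in> borel_measurable (path_space J)" for J K g
    proof -
      let ?L = "I \<union> J"
      have L: "finite ?L" "?L \<noteq> {}" "?L \<subseteq> T" using I J by auto
      note sL = sets_nu[OF L]
      have r: "(\<lambda>x. restrict x J) \<in> measurable (density (nu ?L) w) (path_space J)"
        by (rule measurable_restrict_path[where T = ?L]) (simp_all add: sL)
      have gr: "(\<lambda>x. g (restrict x J)) \<in> borel_measurable (path_space ?L)"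
        using measurable_compose[OF measurable_restrict_path[OF refl, of J ?L] g] by simp
      have "(\<integral>\<^sup>+x. g x \<partial>P J) = (\<integral>\<^sup>+x. g (restrict x J) \<partial>density (nu ?L) w)"
        unfolding P_def using g by (intro nn_integral_distr[OF r]) simp
      also have "\<dots> = (\<integral>\<^sup>+x. w x * g (restrict x J) \<partial>nu ?L)"
        using wm[of ?L] gr by (intro nn_integral_density) (simp_all cong: measurable_cong_sets[OF sL refl])
      also have "\<dots> = (\<integral>\<^sup>+x. w (restrict x ?L) * g (restrict (restrict x ?L) J) \<partial>nu K)"
        using L K wm[of ?L] gr by (intro nn_integral_cons) (auto simp: w_def levy_weight_def)
      also have "\<dots> = (\<integral>\<^sup>+x. w x * g (restrict x J) \<partial>nu K)"
        by (simp add: w_def Int_absorb1)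
      finally show ?thesis .
    qed
    have eP: "emeasure (P J) A = (\<integral>\<^sup>+x. w x * indicator A (restrict x J) \<partial>nu K)"
      if "finite J" "J \<subseteq> T" "finite K" "I \<union> J \<subseteq> K" "K \<subseteq> T" "A \<in> sets (path_space J)" for J K A
      using nnP[of J K "indicator A"] that by (simp add: sP)
    interpret polish_projective T P
    proof (intro polish_projective.intro projective_family.intro)
      fix J H assume J: "J \<subseteq> H" "finite H" "H \<subseteq> T"
      then have fJ: "finite J" "J \<subseteq> T" by (auto intro: finite_subset)
      show "P J = distr (P H) (path_space J) (\<lambda>f. restrict f J)"
      proof (rule measure_eqI)
        fix A assume "A \<in> sets (P J)"
        then have A: "A \<in> sets (path_space J)" by (simp add: sP)
        have r: "(\<lambda>x. restrict x J) \<in> measurable (P H) (path_space J)"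
          by (rule measurable_restrict_path[OF sP J(1)])
        have rA: "(\<lambda>x. restrict x J) -` A \<inter> space (P H) \<in> sets (path_space H)"
          using measurable_sets[OF r A] by (simp add: sP)
        have "emeasure (distr (P H) (path_space J) (\<lambda>f. restrict f J)) A = emeasure (P H) ((\<lambda>x. restrict x J) -` A \<inter> space (P H))"
          by (rule emeasure_distr[OF r A])
        also have "\<dots> = (\<integral>\<^sup>+x. w x * indicator ((\<lambda>x. restrict x J) -` A \<inter> space (P H)) (restrict x H) \<partial>nu (I \<union> H))"
          using J I rA by (intro eP) auto
        also have "\<dots> = (\<integral>\<^sup>+x. w x * indicator A (restrict x J) \<partial>nu (I \<union> H))"
          using J by (intro nn_integral_cong) 
            (auto simp: indicator_def Int_absorb1 sets_eq_imp_space_eq[OF sP] space_PiM)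
        also have "\<dots> = emeasure (P J) A"
          using J I fJ A by (intro eP[symmetric]) auto
        finally show "emeasure (P J) A = emeasure (distr (P H) (path_space J) (\<lambda>f. restrict f J)) A" by simp
      qed (simp add: sP)
    next
      fix J assume J: "finite J" "J \<subseteq> T"
      have IJ: "finite (I \<union> J)" "I \<subseteq> I \<union> J" "I \<union> J \<subseteq> T" using I J by auto
      have "emeasure (P J) (space (P J)) = (\<integral>\<^sup>+x. w x * indicator (space (P J)) (restrict x J) \<partial>nu (I \<union> J))"
        using I J by (intro eP) (auto simp: sets_eq_imp_space_eq[OF sP])
      also have "\<dots> = (\<integral>\<^sup>+x. ennreal (1 / m) * ennreal (levy_weight I x) \<partial>nu (I \<union> J))"
        using m by (intro nn_integral_cong)
          (auto simp: indicator_def sets_eq_imp_space_eq[OF sP] space_PiM w_def levy_weight_nonneg simp flip: ennreal_mult)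
      also have "\<dots> = ennreal (1 / m) * ennreal m"
        using total[OF IJ] lwm[OF IJ] by (simp add: nn_integral_cmult)
      also have "\<dots> = 1"
        using m by (simp flip: ennreal_mult)
      finally show "prob_space (P J)" by (rule prob_spaceI)
    qed
    have marg: "marginal J lim = P J" if J: "finite J" "J \<subseteq> T" for J
    proof (rule measure_eqI)
      show "emeasure (marginal J lim) A = emeasure (P J) A" if "A \<in> sets (marginal J lim)" for A
        using that J by (simp add: emeasure_marginal[where T = T] emeasure_lim_emb)
    qed (simp add: sP)
    \<comment> \<open>The reciprocal of \<open>w\<close>. Where the weight vanishes both are 0, so
      that their product is the indicator of \<open>nonzero_set J I\<close>.\<close>
    define v where "v x = ennreal (m / levy_weight I x)" for x :: "'t \<Rightarrow> real"
    have vm: "v \<in> borel_measurable (path_space J)" if "I \<subseteq> J" for J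
      unfolding v_def using levy_weight_measurable[OF that] by measurable
    show ?thesis
    proof (intro exI[of _ "density lim v"] conjI allI impI)
      fix J assume J: "finite J" "I \<subseteq> J" "J \<subseteq> T"
      then have "J \<noteq> {}" using I by auto
      note sJ = sets_nu[OF J(1) this J(3)]
      show "marginal J (density lim v) = density (nu J) (indicator (nonzero_set J I))"
      proof (rule measure_eqI)
        fix A assume "A \<in> sets (marginal J (density lim v))"
        then have A: "A \<in> sets (path_space J)" by simp
        have sl: "sets (density lim v) = sets (path_space T)" by simp
        have iA: "(\<lambda>x. indicator A (restrict x J) :: ennreal) \<in> borel_measurable (path_space T)"
          using measurable_compose[OF measurable_restrict_path[OF refl J(3)], of "indicator A" borel] A by simp
        have vA: "(\<lambda>x. v x * indicator A x) \<in> borel_measurable (path_space J)"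
          using vm[OF J(2)] A by measurable
        have "emeasure (marginal J (density lim v)) A = (\<integral>\<^sup>+x. indicator A x \<partial>marginal J (density lim v))"
          using A by simp
        also have "\<dots> = (\<integral>\<^sup>+x. indicator A (restrict x J) \<partial>density lim v)"
          using A by (intro nn_integral_marginal[OF sl J(3)]) simp
        also have "\<dots> = (\<integral>\<^sup>+x. v x * indicator A (restrict x J) \<partial>lim)"
          using vm[of T] iA I by (intro nn_integral_density) (simp_all cong: measurable_cong_sets[OF sets_lim refl])
        also have "\<dots> = (\<integral>\<^sup>+x. v (restrict x J) * indicator A (restrict x J) \<partial>lim)"
          using J by (simp add: v_def)
        also have "\<dots> = (\<integral>\<^sup>+x. v x * indicator A x \<partial>marginal J lim)"
          by (rule nn_integral_marginal[OF sets_lim J(3) vA, symmetric])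
        also have "\<dots> = (\<integral>\<^sup>+x. w x * (v (restrict x J) * indicator A (restrict x J)) \<partial>nu J)"
          unfolding marg[OF J(1,3)] using J vA by (intro nnP) auto
        also have "\<dots> = (\<integral>\<^sup>+x. indicator (nonzero_set J I \<inter> A) x \<partial>nu J)"
        proof (intro nn_integral_cong)
          fix x assume "x \<in> space (nu J)"
          then have x: "x \<in> space (path_space J)" by (simp add: sets_eq_imp_space_eq[OF sJ])
          then have "restrict x J = x" by (auto simp: space_PiM PiE_def extensional_restrict)
          moreover have "w x * v x = indicator (nonzero_set J I) x"
            using levy_weight_pos_iff_nonzero_set[OF I(1) x] levy_weight_nonneg[of I x] m
            by (cases "levy_weight I x = 0") (auto simp: w_def v_def indicator_def simp flip: ennreal_mult)
          ultimately show "w x * (v (restrict x J) * indicator A (restrict x J)) = indicator (nonzero_set J I \<inter> A) x"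
            by (simp add: mult.assoc[symmetric] indicator_inter_arith)
        qed
        also have "\<dots> = emeasure (density (nu J) (indicator (nonzero_set J I))) A"
          using A nzm[OF J(2)] sJ by (simp add: emeasure_density flip: indicator_inter_arith)
        finally show "emeasure (marginal J (density lim v)) A = emeasure (density (nu J) (indicator (nonzero_set J I))) A" .
      qed (simp add: sJ)
    qed simp
  qed
qed

text \<open>The empty index set receives the null measure, in accordance with its empty
  \<open>nonzero_set\<close>, and so can take part in the directed family of finite sets.\<close>

definition extension :: "'t set \<Rightarrow> ('t \<Rightarrow> real) measure" where
  "extension I = (if I = {} then null_measure (path_space T) else
     (SOME V. sets V = sets (path_space T) \<and>
       (\<forall>J. finite J \<longrightarrow> I \<subseteq> J \<longrightarrow> J \<subseteq> T \<longrightarrow> marginal J V = density (nu J) (indicator (nonzero_set J I)))))"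

lemma extension_nonempty:
  assumes "finite I" "I \<noteq> {}" "I \<subseteq> T"
  shows "sets (extension I) = sets (path_space T)"
    and "finite J \<Longrightarrow> I \<subseteq> J \<Longrightarrow> J \<subseteq> T \<Longrightarrow> marginal J (extension I) = density (nu J) (indicator (nonzero_set J I))"
  using someI_ex[OF ex_extension[OF assms]] assms(2) by (simp_all add: extension_def)

lemma sets_extension: "finite I \<Longrightarrow> I \<subseteq> T \<Longrightarrow> sets (extension I) = sets (path_space T)"
  using extension_nonempty(1)[of I] by (cases "I = {}") (simp_all add: extension_def)

lemma emeasure_marginal_extension:
  assumes I: "finite I" "I \<subseteq> T" and J: "finite J" "J \<noteq> {}" "I \<subseteq> J" "J \<subseteq> T" and B: "B \<in> sets (path_space J)"
  shows "emeasure (marginal J (extension I)) B = emeasure (nu J) (nonzero_set J I \<inter> B)"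
proof (cases "I = {}")
  case True
  then show ?thesis
    using J B by (simp add: extension_def emeasure_marginal[where T = T] nonzero_set_def)
next
  case False
  have "nonzero_set J I \<in> sets (path_space J)"
    using I J by (intro nonzero_set_measurable) (auto intro: countable_finite)
  then show ?thesis
    using extension_nonempty(2)[OF I(1) False I(2) J(1,3,4)] B sets_nu[OF J(1,2,4)]
    by (simp add: emeasure_density flip: indicator_inter_arith)
qed

lemma levy_integrable_extension:
  assumes I: "finite I" "I \<subseteq> T"
  shows "levy_integrable T (extension I)"
  unfolding levy_integrable_def
proof (intro conjI ballI sets_extension[OF I])
  fix t assume t: "t \<in> T"
  let ?J = "insert t I"
  have J: "finite ?J" "?J \<noteq> {}" "I \<subseteq> ?J" "?J \<subseteq> T" using I t by auto
  have [measurable]: "(\<lambda>x. x t) \<in> borel_measurable (path_space ?J)"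
    by (rule measurable_component_singleton) simp
  have "(\<integral>\<^sup>+x. ennreal (min (\<bar>x t\<bar>\<^sup>2) 1) \<partial>extension I) = (\<integral>\<^sup>+x. ennreal (min (\<bar>restrict x ?J t\<bar>\<^sup>2) 1) \<partial>extension I)"
    by simp
  also have "\<dots> = (\<integral>\<^sup>+x. ennreal (min (\<bar>x t\<bar>\<^sup>2) 1) \<partial>marginal ?J (extension I))"
    by (rule nn_integral_marginal[OF sets_extension[OF I] J(4), symmetric]) measurable
  also have "\<dots> \<le> (\<integral>\<^sup>+x. ennreal (min (\<bar>x t\<bar>\<^sup>2) 1) \<partial>nu ?J)"
  proof (rule nn_integral_mono_measure)
    show s: "sets (marginal ?J (extension I)) = sets (nu ?J)"
      using sets_nu[OF J(1,2,4)] by simp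
    have "emeasure (marginal ?J (extension I)) B \<le> emeasure (nu ?J) B" if "B \<in> sets (path_space ?J)" for B
      unfolding emeasure_marginal_extension[OF I J that] using that sets_nu[OF J(1,2,4)] by (intro emeasure_mono) auto
    then show "marginal ?J (extension I) \<le> nu ?J"
      using s by (subst le_measure[OF s]) (auto simp: le_fun_def emeasure_notin_sets)
  qed
  also have "\<dots> < \<infinity>"
    using lev[OF J(1,2,4)] by (simp add: levy_integrable_def)
  finally show "(\<integral>\<^sup>+x. ennreal (min (\<bar>x t\<bar>\<^sup>2) 1) \<partial>extension I) < \<infinity>" .
qed

lemma emeasure_extension_nonzero_set:
  assumes I: "finite I" "I \<subseteq> T" and A: "A \<in> sets (path_space T)"
  shows "emeasure (extension I) A = emeasure (extension I) (A \<inter> nonzero_set T I)"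
proof (cases "I = {}")
  case True
  then show ?thesis by (simp add: extension_def)
next
  case False
  note s = sets_extension[OF I]
  have nz: "nonzero_set T I \<in> sets (path_space T)" "nonzero_set I I \<in> sets (path_space I)"
    using I by (auto intro!: nonzero_set_measurable intro: countable_finite)
  let ?B = "space (path_space I) - nonzero_set I I"
  have B: "?B \<in> sets (path_space I)" using nz by auto
  have "emeasure (extension I) (prod_emb T (\<lambda>_. borel) I ?B) = emeasure (nu I) (nonzero_set I I \<inter> ?B)"
    using emeasure_marginal_extension[OF I I(1) False subset_refl I(2) B] emeasure_marginal[OF s I(2) B] by simp
  also have "nonzero_set I I \<inter> ?B = {}" by auto
  also have "prod_emb T (\<lambda>_. borel) I ?B = space (path_space T) - nonzero_set T I"
    by (auto simp: prod_emb_def nonzero_set_def space_PiM)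
  finally have 0: "emeasure (extension I) (space (path_space T) - nonzero_set T I) = 0" by simp
  have "emeasure (extension I) A \<le> emeasure (extension I) ((A \<inter> nonzero_set T I) \<union> (space (path_space T) - nonzero_set T I))"
    using A nz s sets.sets_into_space[OF A] by (intro emeasure_mono) auto
  also have "\<dots> \<le> emeasure (extension I) (A \<inter> nonzero_set T I) + emeasure (extension I) (space (path_space T) - nonzero_set T I)"
    using A nz s by (intro emeasure_subadditive) auto
  finally have "emeasure (extension I) A \<le> emeasure (extension I) (A \<inter> nonzero_set T I)" using 0 by simp
  moreover have "emeasure (extension I) (A \<inter> nonzero_set T I) \<le> emeasure (extension I) A"
    using A s by (intro emeasure_mono) auto
  ultimately show ?thesis by (rule antisym)
qed

text \<open>Where a coordinate \<open>t\<close> of \<open>I\<close> is nonzero, the indicators of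
  \<open>nonzero_set J I\<close> and \<open>nonzero_set J K\<close> are both 1, so all marginals
  agree there.\<close>

lemma emeasure_extension_eq:
  assumes K: "finite K" "K \<subseteq> T" and I: "I \<subseteq> K" and A: "A \<in> sets (path_space T)" "A \<subseteq> nonzero_set T I"
  shows "emeasure (extension I) A = emeasure (extension K) A"
proof -
  have fI: "finite I" "I \<subseteq> T" using K I finite_subset by auto
  note s = sets_extension[OF fI] sets_extension[OF K]
  show ?thesis
  proof (rule emeasure_eq_on_countable_cover[where C = I and E = "\<lambda>t. nonzero_set T {t}"])
    show "nonzero_set T {t} \<in> sets (extension I)" if "t \<in> I" for t
      unfolding s using that fI by (intro nonzero_set_measurable) auto
    show "A \<subseteq> (\<Union>t\<in>I. nonzero_set T {t})"
      using A(2) nonzero_set_UN[of T I] by simp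
    fix t B assume t: "t \<in> I" and B: "B \<in> sets (extension I)" "B \<subseteq> nonzero_set T {t}"
    show "emeasure (extension I) B = emeasure (extension K) B"
    proof (rule emeasure_eq_on_nonzero_set[of T _ _ t K])
      fix J D assume J: "finite J" "K \<subseteq> J" "J \<subseteq> T" and D: "D \<in> sets (path_space J)" "D \<subseteq> nonzero_set J {t}"
      have "J \<noteq> {}" "I \<subseteq> J" using J I t by auto
      moreover have "nonzero_set J I \<inter> D = D" "nonzero_set J K \<inter> D = D"
        using D(2) t I by (auto simp: nonzero_set_def)
      ultimately show "emeasure (marginal J (extension I)) D = emeasure (marginal J (extension K)) D"
        using J D fI K by (simp add: emeasure_marginal_extension)
    qed (use t I K fI B s levy_integrable_extension in auto)
  qed (use s A fI in \<open>auto intro: countable_finite\<close>)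
qed

text \<open>Monotonicity makes the extensions a directed family, which is what turns their supremum
  into a measure.\<close>

lemma emeasure_extension_mono:
  assumes K: "finite K" "K \<subseteq> T" and I: "I \<subseteq> K" and A: "A \<in> sets (path_space T)"
  shows "emeasure (extension I) A \<le> emeasure (extension K) A"
proof -
  have fI: "finite I" "I \<subseteq> T" using K I finite_subset by auto
  have nz: "nonzero_set T I \<in> sets (path_space T)"
    using fI by (auto intro!: nonzero_set_measurable intro: countable_finite)
  have "emeasure (extension I) A = emeasure (extension K) (A \<inter> nonzero_set T I)"
    using emeasure_extension_nonzero_set[OF fI A] emeasure_extension_eq[OF K I, of "A \<inter> nonzero_set T I"] A nz by auto
  also have "\<dots> \<le> emeasure (extension K) A"
    using A sets_extension[OF K] by (intro emeasure_mono) auto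
  finally show ?thesis .
qed

text \<open>A supremum over all finite index sets instead of a limit along a sequence, because
  \<open>T\<close> may be uncountable. No single finite set sees all paths different from the origin
  if \<open>T\<close> is infinite.\<close>

definition proj_lim :: "('t \<Rightarrow> real) measure" where
  "proj_lim = measure_of (space (path_space T)) (sets (path_space T)) (\<lambda>A. SUP I\<in>{I. finite I \<and> I \<subseteq> T}. emeasure (extension I) A)"

lemma sets_proj_lim [simp]: "sets proj_lim = sets (path_space T)"
  by (simp add: proj_lim_def)

lemma emeasure_proj_lim:
  assumes A: "A \<in> sets (path_space T)"
  shows "emeasure proj_lim A = (SUP I\<in>{I. finite I \<and> I \<subseteq> T}. emeasure (extension I) A)"
  unfolding proj_lim_def
proof (rule emeasure_measure_of_sigma)
  show "sigma_algebra (space (path_space T)) (sets (path_space T))" ..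
  show "positive (sets (path_space T)) (\<lambda>A. SUP I\<in>{I. finite I \<and> I \<subseteq> T}. emeasure (extension I) A)"
    by (auto simp: positive_def intro!: antisym SUP_least)
  show "countably_additive (sets (path_space T)) (\<lambda>A. SUP I\<in>{I. finite I \<and> I \<subseteq> T}. emeasure (extension I) A)"
  proof (rule countably_additiveI)
    fix B :: "nat \<Rightarrow> _" assume B: "range B \<subseteq> sets (path_space T)" "disjoint_family B"
    have "(\<Sum>i. SUP I\<in>{I. finite I \<and> I \<subseteq> T}. emeasure (extension I) (B i)) =
        (SUP I\<in>{I. finite I \<and> I \<subseteq> T}. \<Sum>i. emeasure (extension I) (B i))"
    \<comment> \<open>Series and directed suprema may be exchanged; the union of two index sets
      dominates both of them.\<close>
    proof (rule ennreal_suminf_SUP_eq_directed)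
      fix N :: "nat set" and I J assume "I \<in> {I. finite I \<and> I \<subseteq> T}" "J \<in> {I. finite I \<and> I \<subseteq> T}"
      then show "\<exists>K\<in>{I. finite I \<and> I \<subseteq> T}. \<forall>n\<in>N. emeasure (extension I) (B n) \<le> emeasure (extension K) (B n) \<and>
          emeasure (extension J) (B n) \<le> emeasure (extension K) (B n)"
        using B(1) by (intro bexI[of _ "I \<union> J"]) (auto intro!: emeasure_extension_mono)
    qed
    also have "\<dots> = (SUP I\<in>{I. finite I \<and> I \<subseteq> T}. emeasure (extension I) (\<Union>i. B i))"
      using B sets_extension by (intro SUP_cong refl suminf_emeasure) auto
    finally show "(\<Sum>i. SUP I\<in>{I. finite I \<and> I \<subseteq> T}. emeasure (extension I) (B i)) =
        (SUP I\<in>{I. finite I \<and> I \<subseteq> T}. emeasure (extension I) (\<Union>i. B i))" .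
  qed
qed (fact A)

lemma emeasure_proj_lim_nonzero_set:
  assumes I: "finite I" "I \<subseteq> T" and A: "A \<in> sets (path_space T)" "A \<subseteq> nonzero_set T I"
  shows "emeasure proj_lim A = emeasure (extension I) A"
  unfolding emeasure_proj_lim[OF A(1)]
proof (rule antisym)
  show "(SUP J\<in>{J. finite J \<and> J \<subseteq> T}. emeasure (extension J) A) \<le> emeasure (extension I) A"
  proof (rule SUP_least)
    fix J assume "J \<in> {J. finite J \<and> J \<subseteq> T}"
    then have J: "finite (I \<union> J)" "I \<union> J \<subseteq> T" using I by auto
    have "emeasure (extension J) A \<le> emeasure (extension (I \<union> J)) A"
      by (rule emeasure_extension_mono[OF J _ A(1)]) simp
    also have "\<dots> = emeasure (extension I) A"
      by (rule emeasure_extension_eq[OF J _ A, symmetric]) simp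
    finally show "emeasure (extension J) A \<le> emeasure (extension I) A" .
  qed
qed (use I in \<open>auto intro!: SUP_upper\<close>)

lemma agree_marginal_proj_lim:
  assumes I: "finite I" "I \<noteq> {}" "I \<subseteq> T"
  shows "agree_off_origin I (nu I) (marginal I proj_lim)"
  unfolding agree_off_origin_def
proof (intro ballI impI)
  fix B assume B: "B \<in> sets (path_space I)" "origin I \<notin> B"
  have Bs: "B \<subseteq> space (path_space I)" using B(1) sets.sets_into_space by blast
  have sub: "B \<subseteq> nonzero_set I I"
    using B(2) Bs not_origin_iff[of _ I] by (auto simp: nonzero_set_def)
  have "emeasure (marginal I proj_lim) B = emeasure proj_lim (prod_emb T (\<lambda>_. borel) I B)"
    by (rule emeasure_marginal[OF sets_proj_lim I(3) B(1)])
  also have "\<dots> = emeasure (extension I) (prod_emb T (\<lambda>_. borel) I B)"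
  proof (rule emeasure_proj_lim_nonzero_set[OF I(1,3)])
    show "prod_emb T (\<lambda>_. borel) I B \<in> sets (path_space T)"
      using B(1) I by (intro measurable_prod_emb) auto
    show "prod_emb T (\<lambda>_. borel) I B \<subseteq> nonzero_set T I"
    proof
      fix x assume "x \<in> prod_emb T (\<lambda>_. borel) I B"
      then have x: "x \<in> space (path_space T)" "restrict x I \<in> B"
        by (auto simp: prod_emb_def space_PiM)
      with sub have "restrict x I \<in> nonzero_set I I" by auto
      with x(1) show "x \<in> nonzero_set T I" by (auto simp: nonzero_set_def)
    qed
  qed
  also have "\<dots> = emeasure (marginal I (extension I)) B"
    by (rule emeasure_marginal[OF sets_extension[OF I(1,3)] I(3) B(1), symmetric])
  also have "\<dots> = emeasure (nu I) B"
    using emeasure_marginal_extension[OF I(1,3) I(1,2) subset_refl I(3) B(1)] sub by (simp add: Int_absorb1)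
  finally show "emeasure (nu I) B = emeasure (marginal I proj_lim) B" ..
qed

text \<open>The supremum defining the mass of \<open>A\<close> is reached along a sequence of finite
  index sets. Their countable union carries the whole mass, which is the required regularity;
  integrability is read off the one-dimensional marginals.\<close>

lemma levy_measure_proj_lim: "levy_measure T proj_lim"
  unfolding levy_measure_iff
proof (intro conjI ballI)
  show "levy_integrable T proj_lim"
    unfolding levy_integrable_def
  proof (intro conjI ballI sets_proj_lim)
    fix t assume t: "t \<in> T"
    have [measurable]: "(\<lambda>x. x t) \<in> borel_measurable (path_space {t})"
      by (rule measurable_component_singleton) simp
    have "(\<integral>\<^sup>+x. ennreal (min (\<bar>x t\<bar>\<^sup>2) 1) \<partial>proj_lim) = (\<integral>\<^sup>+x. ennreal (min (\<bar>restrict x {t} t\<bar>\<^sup>2) 1) \<partial>proj_lim)"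
      by simp
    also have "\<dots> = (\<integral>\<^sup>+x. ennreal (min (\<bar>x t\<bar>\<^sup>2) 1) \<partial>marginal {t} proj_lim)"
      using t by (intro nn_integral_marginal[OF sets_proj_lim, symmetric]) measurable
    also have "\<dots> = (\<integral>\<^sup>+x. ennreal (min (\<bar>x t\<bar>\<^sup>2) 1) \<partial>nu {t})"
    proof (rule nn_integral_eq_if_agree_on[where I = "{t}" and D = "nonzero_set {t} {t}"])
      show "nonzero_set {t} {t} \<in> sets (path_space {t})"
        by (intro nonzero_set_measurable) auto
      show "emeasure (marginal {t} proj_lim) B = emeasure (nu {t}) B"
        if "B \<in> sets (path_space {t})" "B \<subseteq> nonzero_set {t} {t}" for B
        using that agree_marginal_proj_lim[of "{t}"] t origin_notin_nonzero_set[of "{t}" "{t}"]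
        by (auto simp: agree_off_origin_def)
    qed (use t sets_nu[of "{t}"] in \<open>auto simp: nonzero_set_def\<close>)
    also have "\<dots> < \<infinity>"
      using lev[of "{t}"] t by (simp add: levy_integrable_def)
    finally show "(\<integral>\<^sup>+x. ennreal (min (\<bar>x t\<bar>\<^sup>2) 1) \<partial>proj_lim) < \<infinity>" .
  qed
  fix A assume A: "A \<in> sets (path_space T)"
  let ?S = "{I. finite I \<and> I \<subseteq> T}"
  have "?S \<noteq> {}" by auto
  from ennreal_SUP_countable_SUP[OF this, of "\<lambda>I. emeasure (extension I) A"] obtain f :: "nat \<Rightarrow> ennreal"
    where f: "range f \<subseteq> (\<lambda>I. emeasure (extension I) A) ` ?S" "(SUP I\<in>?S. emeasure (extension I) A) = Sup (range f)"
    by (elim exE conjE)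
  have "\<forall>n. \<exists>I. I \<in> ?S \<and> f n = emeasure (extension I) A"
  proof
    fix n
    have "f n \<in> (\<lambda>I. emeasure (extension I) A) ` ?S" using f(1) by (rule subsetD) simp
    then show "\<exists>I. I \<in> ?S \<and> f n = emeasure (extension I) A" by (elim imageE) (intro exI conjI)
  qed
  from choice[OF this] obtain I where "\<forall>n. I n \<in> ?S \<and> f n = emeasure (extension (I n)) A" by (elim exE)
  then have I: "finite (I n)" "I n \<subseteq> T" "f n = emeasure (extension (I n)) A" for n by simp_all
  let ?C = "\<Union>n. I n"
  have C: "?C \<subseteq> T" "countable ?C" using I by (auto intro: countable_finite)
  have m: "A \<inter> nonzero_set T ?C \<in> sets (path_space T)"
    using A nonzero_set_measurable[OF C] by auto
  have "emeasure proj_lim A = (SUP n. emeasure (extension (I n)) A)"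
    using emeasure_proj_lim[OF A] f(2) I(3) by simp
  also have "\<dots> \<le> emeasure proj_lim (A \<inter> nonzero_set T ?C)"
  proof (rule SUP_least)
    fix n
    have nz: "nonzero_set T (I n) \<in> sets (path_space T)"
      using I by (auto intro!: nonzero_set_measurable intro: countable_finite)
    have "emeasure (extension (I n)) A = emeasure (extension (I n)) (A \<inter> nonzero_set T (I n))"
      by (rule emeasure_extension_nonzero_set[OF I(1,2) A])
    also have "\<dots> = emeasure proj_lim (A \<inter> nonzero_set T (I n))"
      using A nz by (intro emeasure_proj_lim_nonzero_set[OF I(1,2), symmetric]) auto
    also have "\<dots> \<le> emeasure proj_lim (A \<inter> nonzero_set T ?C)"
      using m nonzero_set_mono[of "I n" ?C T] by (intro emeasure_mono) auto
    finally show "emeasure (extension (I n)) A \<le> emeasure proj_lim (A \<inter> nonzero_set T ?C)" .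
  qed
  finally have "emeasure proj_lim A \<le> emeasure proj_lim (A \<inter> nonzero_set T ?C)" .
  moreover have "emeasure proj_lim (A \<inter> nonzero_set T ?C) \<le> emeasure proj_lim A"
    using A by (intro emeasure_mono) auto
  ultimately show "\<exists>C\<subseteq>T. countable C \<and> emeasure proj_lim (A \<inter> nonzero_set T C) = emeasure proj_lim A"
    using C by (intro exI[of _ ?C]) auto
qed

end

section \<open>Jordan decomposition on path space\<close>

text \<open>Radon--Nikodym is available on \<open>?U\<close> only. Off \<open>?U\<close> the finite
  measure \<open>\<mu>2\<close> is null, so \<open>\<mu>1\<close> can be added to the positive part
  there unchanged, although it need not be \<sigma>-finite.\<close>

lemma levy_measure_decomposition:
  assumes \<mu>1: "levy_measure T \<mu>1" and \<mu>2: "levy_measure T \<mu>2" and fin: "emeasure \<mu>2 (space \<mu>2) < \<infinity>"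
  obtains p n P where "levy_measure T p" "levy_measure T n" "finite_measure n"
    "P \<in> sets (path_space T)" "emeasure n P = 0" "emeasure p (space (path_space T) - P) = 0"
    "\<And>A. A \<in> sets (path_space T) \<Longrightarrow> emeasure \<mu>1 A + emeasure n A = emeasure \<mu>2 A + emeasure p A"
proof -
  have l: "levy_integrable T \<mu>1" "levy_integrable T \<mu>2"
    using \<mu>1 \<mu>2 by (simp_all add: levy_measure_iff)
  note s = l[THEN levy_integrable_sets]
  have sp: "space \<mu>1 = space (path_space T)" "space \<mu>2 = space (path_space T)"
    using s[THEN sets_eq_imp_space_eq] by simp_all
  have "\<exists>C\<subseteq>T. countable C \<and> emeasure \<mu>2 (space (path_space T) \<inter> nonzero_set T C) = emeasure \<mu>2 (space (path_space T))"
    using \<mu>2 by (simp add: levy_measure_iff)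
  then obtain C where C: "C \<subseteq> T" "countable C"
    and C2: "emeasure \<mu>2 (space (path_space T) \<inter> nonzero_set T C) = emeasure \<mu>2 (space (path_space T))"
    by blast
  let ?U = "nonzero_set T C"
  have U: "?U \<in> sets (path_space T)" by (rule nonzero_set_measurable[OF C])
  have U0: "emeasure \<mu>2 (space (path_space T) - ?U) = 0"
  proof -
    have "space (path_space T) \<inter> ?U = ?U" by (auto simp: nonzero_set_def)
    then show ?thesis
      using C2 fin U s sp emeasure_compl[of ?U \<mu>2] by simp
  qed
  \<comment> \<open>The index \<open>k\<close> encodes a pair of a coordinate in \<open>C\<close>
    and a level for its weight. An empty \<open>C\<close> is treated apart because it cannot be
    enumerated.\<close>
  define E where "E k = (if C = {} then {} else {x \<in> space (path_space T).
    1 / real (Suc (snd (prod_decode k))) \<le> levy_weight {from_nat_into C (fst (prod_decode k))} x})" for k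
  have CT: "from_nat_into C i \<in> T" if "C \<noteq> {}" for i
    using from_nat_into[OF that] C by auto
  have E: "E k \<in> sets \<mu>1" for k
  proof (cases "C = {}")
    case False
    have [measurable]: "levy_weight {from_nat_into C i} \<in> borel_measurable (path_space T)" for i
      using CT[OF False] by (intro levy_weight_measurable) auto
    show ?thesis
      using False unfolding E_def s by simp
  qed (simp add: E_def)
  have UE: "(\<Union>k. E k) = ?U"
  proof (intro set_eqI iffI)
    fix x assume "x \<in> (\<Union>k. E k)"
    then obtain k where k: "x \<in> E k" by auto
    then have ne: "C \<noteq> {}" by (auto simp: E_def)
    with k have x: "x \<in> space (path_space T)"
      "1 / real (Suc (snd (prod_decode k))) \<le> levy_weight {from_nat_into C (fst (prod_decode k))} x"
      by (auto simp: E_def)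
    have "0 < 1 / real (Suc (snd (prod_decode k)))" by simp
    then have "0 < levy_weight {from_nat_into C (fst (prod_decode k))} x"
      using x(2) by (rule less_le_trans)
    then have "x \<in> nonzero_set T {from_nat_into C (fst (prod_decode k))}"
      using levy_weight_pos_iff_nonzero_set[OF _ x(1)] by simp
    then show "x \<in> ?U"
      using from_nat_into[OF ne] by (auto simp: nonzero_set_def)
  next
    fix x assume x: "x \<in> ?U"
    then obtain t where t: "t \<in> C" "x t \<noteq> 0" and xs: "x \<in> space (path_space T)"
      by (auto simp: nonzero_set_def)
    obtain i where i: "from_nat_into C i = t"
      using from_nat_into_surj[OF C(2) t(1)] by blast
    have "0 < levy_weight {t} x"
      using levy_weight_pos_iff_nonzero_set[of "{t}", OF _ xs] t xs by (auto simp: nonzero_set_def)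
    then obtain j where "inverse (real (Suc j)) < levy_weight {t} x"
      using reals_Archimedean by blast
    then have "x \<in> E (prod_encode (i, j))"
      using t(1) i xs by (auto simp: E_def inverse_eq_divide)
    then show "x \<in> (\<Union>k. E k)" by blast
  qed
  have finE: "emeasure \<mu>1 (E k) < \<infinity>" "emeasure \<mu>2 (E k) < \<infinity>" for k
  proof -
    show "emeasure \<mu>1 (E k) < \<infinity>"
    proof (cases "C = {}")
      case False
      then show ?thesis
        using emeasure_levy_weight_ge_finite[OF l(1), of "{from_nat_into C (fst (prod_decode k))}" "1 / real (Suc (snd (prod_decode k)))"] CT[OF False]
        by (simp add: E_def sp)
    qed (simp add: E_def)
    have "emeasure \<mu>2 (E k) \<le> emeasure \<mu>2 (space \<mu>2)"
      by (rule emeasure_space)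
    then show "emeasure \<mu>2 (E k) < \<infinity>" using fin by (rule le_less_trans)
  qed
  have s21: "sets \<mu>2 = sets \<mu>1" using s by simp
  obtain p n P where pn: "sets p = sets \<mu>1" "sets n = sets \<mu>1" "P \<in> sets \<mu>1" "P \<subseteq> ?U"
    "emeasure n P = 0" "emeasure p (space \<mu>1 - P) = 0" "emeasure n (space \<mu>1 - ?U) = 0"
    and add: "\<And>A. A \<in> sets \<mu>1 \<Longrightarrow> emeasure \<mu>1 (A \<inter> ?U) + emeasure n A = emeasure \<mu>2 (A \<inter> ?U) + emeasure p A"
    and p_le: "\<And>A. A \<in> sets \<mu>1 \<Longrightarrow> emeasure p A \<le> emeasure \<mu>1 (A \<inter> ?U)"
    and n_le: "\<And>A. A \<in> sets \<mu>1 \<Longrightarrow> emeasure n A \<le> emeasure \<mu>2 (A \<inter> ?U)"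
    by (rule mutually_singular_decomposition[where E = E, OF s21 E finE, unfolded UE]) (assumption | rule that)+
  have s_pn: "sets p = sets (path_space T)" "sets n = sets (path_space T)" "sets n = sets p"
    using pn s by simp_all
  let ?V = "space (path_space T) - ?U"
  have V: "?V \<in> sets (path_space T)" using U by auto
  \<comment> \<open>The part of \<open>\<mu>1\<close> off \<open>?U\<close> meets no mass of
    \<open>n\<close>, so mutual singularity persists with the Hahn set
    \<open>P \<union> ?V\<close>.\<close>
  define p' where "p' = add_measure p (density \<mu>1 (indicator ?V))"
  have sp': "sets p' = sets (path_space T)" by (simp add: p'_def s_pn)
  have p': "emeasure p' A = emeasure p A + emeasure \<mu>1 (A \<inter> ?V)" if "A \<in> sets (path_space T)" for A
    using that V s s_pn unfolding p'_def
    by (simp add: emeasure_add_measure emeasure_density Int_commute flip: indicator_inter_arith)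
  have splitA: "emeasure \<mu> A = emeasure \<mu> (A \<inter> ?U) + emeasure \<mu> (A \<inter> ?V)"
    if A: "A \<in> sets (path_space T)" and s: "sets \<mu> = sets (path_space T)" for A \<mu>
  proof -
    have "(A \<inter> ?U) \<union> (A \<inter> ?V) = A"
      using sets.sets_into_space[OF A] by auto
    moreover have "emeasure \<mu> (A \<inter> ?U) + emeasure \<mu> (A \<inter> ?V) = emeasure \<mu> ((A \<inter> ?U) \<union> (A \<inter> ?V))"
      using A U V s by (intro plus_emeasure) auto
    ultimately show ?thesis by simp
  qed
  have null: "emeasure \<mu> (A \<inter> ?V) = 0" if "A \<in> sets (path_space T)" "sets \<mu> = sets (path_space T)" "emeasure \<mu> ?V = 0" for A \<mu>
  proof -
    have "emeasure \<mu> (A \<inter> ?V) \<le> emeasure \<mu> ?V"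
      using that V by (intro emeasure_mono) auto
    with that show ?thesis by simp
  qed
  have pV: "emeasure p ?V = 0"
  proof -
    have VU: "?V \<inter> ?U = {}" by auto
    have "emeasure p ?V \<le> emeasure \<mu>1 (?V \<inter> ?U)"
      using V s by (intro p_le) simp
    then show ?thesis
      unfolding VU by simp
  qed
  have nV: "emeasure n ?V = 0" using pn(7) sp by simp
  show ?thesis
  proof (rule that[of p' n "P \<union> ?V"])
    show "finite_measure n"
    proof (rule finite_measureI)
      have "emeasure n (space n) \<le> emeasure \<mu>2 (space n \<inter> ?U)"
        using n_le[of "space n"] sets.top[of n] pn(2) by simp
      also have "\<dots> \<le> emeasure \<mu>2 (space \<mu>2)" by (rule emeasure_space)
      finally show "emeasure n (space n) \<noteq> \<infinity>" using fin by auto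
    qed
    show "P \<union> ?V \<in> sets (path_space T)" using pn V s by auto
    show "emeasure n (P \<union> ?V) = 0"
      using pn V s nV by (subst emeasure_Un_null_set) (auto intro!: null_setsI)
    have Q: "space (path_space T) - (P \<union> ?V) \<in> sets (path_space T)" using pn V s by auto
    have "(space (path_space T) - (P \<union> ?V)) \<inter> ?V = {}" by auto
    moreover have "emeasure p (space (path_space T) - (P \<union> ?V)) \<le> emeasure p (space \<mu>1 - P)"
      using pn s sp by (intro emeasure_mono) auto
    ultimately show "emeasure p' (space (path_space T) - (P \<union> ?V)) = 0"
      using pn by (simp add: p'[OF Q])
    show "emeasure \<mu>1 A + emeasure n A = emeasure \<mu>2 A + emeasure p' A" if A: "A \<in> sets (path_space T)" for A
    proof -
      have "emeasure \<mu>1 A + emeasure n A = (emeasure \<mu>1 (A \<inter> ?U) + emeasure n A) + emeasure \<mu>1 (A \<inter> ?V)"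
        using splitA[OF A s(1)] by (simp add: ac_simps)
      also have "\<dots> = emeasure \<mu>2 (A \<inter> ?U) + emeasure p A + emeasure \<mu>1 (A \<inter> ?V)"
        using add[of A] A s by simp
      also have "emeasure \<mu>2 (A \<inter> ?U) = emeasure \<mu>2 A"
        using splitA[OF A s(2)] null[OF A s(2) U0] by simp
      finally show ?thesis using p'[OF A] by (simp add: ac_simps)
    qed
    show "levy_measure T n"
      unfolding levy_measure_iff
    proof (intro conjI ballI)
      show "levy_integrable T n"
      proof (rule levy_integrable_mono[OF l(2)])
        fix A assume A: "A \<in> sets \<mu>2"
        then have "emeasure \<mu>2 (A \<inter> ?U) \<le> emeasure \<mu>2 A" by (intro emeasure_mono) auto
        then show "emeasure n A \<le> emeasure \<mu>2 A" using n_le[of A] A s by simp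
      qed (use pn s in simp)
      fix A assume A: "A \<in> sets (path_space T)"
      show "\<exists>C\<subseteq>T. countable C \<and> emeasure n (A \<inter> nonzero_set T C) = emeasure n A"
        using C splitA[OF A s_pn(2)] null[OF A s_pn(2) nV] by (intro exI[of _ C]) auto
    qed
    show "levy_measure T p'"
      unfolding levy_measure_iff
    proof (intro conjI ballI)
      show "levy_integrable T p'"
      proof (rule levy_integrable_mono[OF l(1)])
        fix A assume A: "A \<in> sets \<mu>1"
        then have "emeasure p A + emeasure \<mu>1 (A \<inter> ?V) \<le> emeasure \<mu>1 (A \<inter> ?U) + emeasure \<mu>1 (A \<inter> ?V)"
          using p_le[of A] by (intro add_right_mono) auto
        then show "emeasure p' A \<le> emeasure \<mu>1 A" using splitA[of A \<mu>1] p'[of A] A s by simp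
      qed (use sp' s in simp)
      fix A assume A: "A \<in> sets (path_space T)"
      \<comment> \<open>\<open>C\<close> serves the part of \<open>p'\<close> on \<open>?U\<close>;
        the added part of \<open>\<mu>1\<close> needs a countable set of its own, depending on
        \<open>A\<close>.\<close>
      obtain D where D: "D \<subseteq> T" "countable D" "emeasure \<mu>1 (A \<inter> ?V \<inter> nonzero_set T D) = emeasure \<mu>1 (A \<inter> ?V)"
        using \<mu>1 A V by (auto simp: levy_measure_iff)
      have CD: "C \<union> D \<subseteq> T" "countable (C \<union> D)" using C D by auto
      let ?W = "nonzero_set T (C \<union> D)"
      have W: "A \<inter> ?W \<in> sets (path_space T)" using A nonzero_set_measurable[OF CD] by auto
      have "emeasure p A = emeasure p (A \<inter> ?U)"
        using splitA[OF A s_pn(1)] null[OF A s_pn(1) pV] by simp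
      also have "\<dots> \<le> emeasure p (A \<inter> ?W)"
        using W s_pn nonzero_set_mono[of C "C \<union> D" T] by (intro emeasure_mono) auto
      finally have 1: "emeasure p A \<le> emeasure p (A \<inter> ?W)" .
      have "emeasure \<mu>1 (A \<inter> ?V) \<le> emeasure \<mu>1 (A \<inter> ?W \<inter> ?V)"
        unfolding D(3)[symmetric] using W V s nonzero_set_mono[of D "C \<union> D" T] by (intro emeasure_mono) auto
      with 1 have "emeasure p' A \<le> emeasure p' (A \<inter> ?W)"
        unfolding p'[OF A] p'[OF W] by (rule add_mono)
      moreover have "emeasure p' (A \<inter> ?W) \<le> emeasure p' A"
        using A sp' by (intro emeasure_mono) auto
      ultimately show "\<exists>C\<subseteq>T. countable C \<and> emeasure p' (A \<inter> nonzero_set T C) = emeasure p' A"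
        using CD by (intro exI[of _ "C \<union> D"]) auto
    qed
  qed
qed

section \<open>Signed measures on path space and their Jordan parts\<close>

definition signed_diff :: "'t set \<Rightarrow> ('t \<Rightarrow> real) measure \<Rightarrow> ('t \<Rightarrow> real) measure \<Rightarrow> ('t \<Rightarrow> real) set \<Rightarrow> ereal" where
  "signed_diff T p n A = (if A \<in> sets (path_space T) then enn2ereal (emeasure p A) - enn2ereal (emeasure n A) else 0)"

lemma jordan_decomposition_signed_diff:
  assumes "sets p = sets (path_space T)" "sets n = sets (path_space T)" "finite_measure p \<or> finite_measure n"
    and "P \<in> sets (path_space T)" "emeasure n P = 0" "emeasure p (space (path_space T) - P) = 0"
  shows "jordan_decomposition (path_space T) (signed_diff T p n) p n"
  using assms by (auto simp: jordan_decomposition_def signed_diff_def)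

text \<open>The hypothesis excludes infinity minus infinity in every term: either both minuends or
  both subtrahends are finite.\<close>

lemma enn2ereal_diff_add:
  assumes "(a \<noteq> \<infinity> \<and> c \<noteq> \<infinity>) \<or> (b \<noteq> \<infinity> \<and> d \<noteq> \<infinity>)"
  shows "(enn2ereal a - enn2ereal b) + (enn2ereal c - enn2ereal d) = (enn2ereal a + enn2ereal c) - (enn2ereal b + enn2ereal d)"
  using assms by (cases a; cases b; cases c; cases d) (auto simp: ennreal.rep_eq max_def)

text \<open>Partial sums split into a positive and a negative one, and since one of the two measures
  is finite the limits can be subtracted. The same alternative decides which infinite value is
  avoided.\<close>

lemma signed_measure_if_jordan_decomposition:
  assumes J: "jordan_decomposition M \<nu> p n" and out: "\<And>A. A \<notin> sets M \<Longrightarrow> \<nu> A = 0"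
  shows "signed_measure M \<nu>"
proof -
  have s: "sets p = sets M" "sets n = sets M" and fin: "finite_measure p \<or> finite_measure n"
    and eq: "\<And>A. A \<in> sets M \<Longrightarrow> \<nu> A = enn2ereal (emeasure p A) - enn2ereal (emeasure n A)"
    using J by (auto simp: jordan_decomposition_def)
  have pn_fin: "(\<forall>A. emeasure p A \<noteq> \<infinity>) \<or> (\<forall>A. emeasure n A \<noteq> \<infinity>)"
    using fin by (auto dest: finite_measure.emeasure_finite)
  show ?thesis
    unfolding signed_measure_def
  proof (intro conjI allI impI)
    show "\<nu> {} = 0" using eq[of "{}"] by simp
    show "(\<forall>A\<in>sets M. \<nu> A \<noteq> \<infinity>) \<or> (\<forall>A\<in>sets M. \<nu> A \<noteq> - \<infinity>)"
      using pn_fin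
    proof
      assume fin: "\<forall>A. emeasure p A \<noteq> \<infinity>"
      have "enn2ereal (emeasure p A) - enn2ereal (emeasure n A) \<noteq> \<infinity>" for A
        using fin[THEN spec, of A] by (cases "emeasure p A"; cases "emeasure n A") auto
      then show ?thesis using eq by auto
    next
      assume fin: "\<forall>A. emeasure n A \<noteq> \<infinity>"
      have "enn2ereal (emeasure p A) - enn2ereal (emeasure n A) \<noteq> - \<infinity>" for A
        using fin[THEN spec, of A] by (cases "emeasure p A"; cases "emeasure n A") auto
      then show ?thesis using eq by auto
    qed
    fix A :: "nat \<Rightarrow> _" assume A: "range A \<subseteq> sets M" "disjoint_family A"
    have lim: "(\<lambda>k. \<Sum>i<k. enn2ereal (emeasure \<mu> (A i))) \<longlonglongrightarrow> enn2ereal (emeasure \<mu> (\<Union>i. A i))"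
      if "sets \<mu> = sets M" for \<mu>
    proof -
      have "(\<lambda>i. emeasure \<mu> (A i)) sums emeasure \<mu> (\<Union>i. A i)"
        using summable_sums[OF summableI, of "\<lambda>i. emeasure \<mu> (A i)"] suminf_emeasure[of A \<mu>] A that by simp
      then have "(\<lambda>k. enn2ereal (\<Sum>i<k. emeasure \<mu> (A i))) \<longlonglongrightarrow> enn2ereal (emeasure \<mu> (\<Union>i. A i))"
        unfolding sums_def by (intro tendsto_enn2erealI)
      then show ?thesis by (simp add: sum_enn2ereal)
    qed
    have part: "(\<Sum>i<k. \<nu> (A i)) = (\<Sum>i<k. enn2ereal (emeasure p (A i))) - (\<Sum>i<k. enn2ereal (emeasure n (A i)))" for k
    proof -
      have "(\<Sum>i<k. \<nu> (A i)) = (\<Sum>i<k. enn2ereal (emeasure p (A i)) - enn2ereal (emeasure n (A i)))"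
        using A by (intro sum.cong refl eq) auto
      also have "\<dots> = (\<Sum>i<k. enn2ereal (emeasure p (A i))) - (\<Sum>i<k. enn2ereal (emeasure n (A i)))"
      proof (induction k)
        case (Suc k)
        have "(\<forall>i. emeasure p (A i) \<noteq> \<infinity>) \<or> (\<forall>i. emeasure n (A i) \<noteq> \<infinity>)"
          using pn_fin by blast
        then have "((\<Sum>i<k. emeasure p (A i)) \<noteq> \<infinity> \<and> emeasure p (A k) \<noteq> \<infinity>) \<or>
            ((\<Sum>i<k. emeasure n (A i)) \<noteq> \<infinity> \<and> emeasure n (A k) \<noteq> \<infinity>)"
          by auto
        from enn2ereal_diff_add[OF this] show ?case
          unfolding sum.lessThan_Suc Suc by simp
      qed simp
      finally show ?thesis .
    qed
    have "(\<lambda>k. \<Sum>i<k. \<nu> (A i)) \<longlonglongrightarrow> enn2ereal (emeasure p (\<Union>i. A i)) - enn2ereal (emeasure n (\<Union>i. A i))"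
      unfolding part
    proof (rule tendsto_diff_ereal_general[OF lim[OF s(1)] lim[OF s(2)]])
      show "\<not> (enn2ereal (emeasure p (\<Union>i. A i)) = \<infinity> \<and> enn2ereal (emeasure n (\<Union>i. A i)) = \<infinity> \<or>
          enn2ereal (emeasure p (\<Union>i. A i)) = - \<infinity> \<and> enn2ereal (emeasure n (\<Union>i. A i)) = - \<infinity>)"
        using pn_fin by (cases "emeasure p (\<Union>i. A i)"; cases "emeasure n (\<Union>i. A i)") auto
    qed
    then show "(\<lambda>n. \<nu> (A n)) sums \<nu> (\<Union>n. A n)"
      unfolding sums_def using A by (subst eq) auto
  qed (rule out)
qed

lemma total_variation_eq:
  assumes "jordan_decomposition M \<nu> p n"
  shows "total_variation M \<nu> = add_measure p n"
proof -
  have s: "sets p = sets M" using assms by (simp add: jordan_decomposition_def)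
  show ?thesis
    unfolding total_variation_def add_measure_def jordan_decomposition_imp_eq[OF assms] s sets_eq_imp_space_eq[OF s] ..
qed

lemma quasi_levy_type_measureI:
  assumes J: "jordan_decomposition (path_space T) \<nu> p n" and out: "\<And>A. A \<notin> sets (path_space T) \<Longrightarrow> \<nu> A = 0"
    and p: "levy_measure T p" and n: "levy_measure T n"
  shows "quasi_levy_type_measure T \<nu>"
proof -
  have "levy_integrable T (add_measure p n)"
    using p n by (intro levy_integrable_add_measure) (simp_all add: levy_measure_iff)
  moreover have "sets n = sets p"
    using J by (simp add: jordan_decomposition_def)
  ultimately show ?thesis
    using J p n signed_measure_if_jordan_decomposition[OF J out]
    unfolding quasi_levy_type_measure_def total_variation_eq[OF J] jordan_decomposition_imp_eq[OF J]
    by (auto simp: levy_integrable_def emeasure_add_measure levy_measure_def)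
qed

text \<open>The inner regularity of \<open>\<bar>\<nu>\<bar>\<close> passes to its parts by testing on subsets of the Hahn sets.\<close>

lemma quasi_levy_type_measureD:
  assumes Q: "quasi_levy_type_measure T \<nu>" and J: "jordan_decomposition (path_space T) \<nu> p n"
  shows "levy_measure T p" "levy_measure T n"
proof -
  have s: "sets p = sets (path_space T)" "sets n = sets (path_space T)" "sets n = sets p"
    using J by (auto simp: jordan_decomposition_def)
  obtain P where P: "P \<in> sets (path_space T)" "emeasure n P = 0" "emeasure p (space (path_space T) - P) = 0"
    using J by (auto simp: jordan_decomposition_def)
  have tv: "levy_integrable T (add_measure p n)"
    using Q s by (simp add: quasi_levy_type_measure_def total_variation_eq[OF J] levy_integrable_def)
  have reg: "emeasure p A + emeasure n A = inner_measure p (A - {origin T}) + inner_measure n (A - {origin T})"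
    if "A \<in> sets (path_space T)" for A
    using Q that s by (simp add: quasi_levy_type_measure_def total_variation_eq[OF J] jordan_decomposition_imp_eq[OF J] emeasure_add_measure)
  \<comment> \<open>Stated for an abstract pair, so that it serves \<open>p\<close> with the Hahn
    set \<open>P\<close> and \<open>n\<close> with its complement. Testing on
    \<open>A \<inter> R\<close> silences the other measure.\<close>
  have key: "emeasure q A = inner_measure q (A - {origin T})"
    if A: "A \<in> sets (path_space T)" and R: "R \<in> sets (path_space T)" and sq: "sets q = sets (path_space T)" "sets r = sets (path_space T)"
      and q0: "emeasure q (space (path_space T) - R) = 0" and r0: "emeasure r R = 0"
      and reg: "\<And>A. A \<in> sets (path_space T) \<Longrightarrow> emeasure q A + emeasure r A = inner_measure q (A - {origin T}) + inner_measure r (A - {origin T})"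
    for q r A R
  proof (rule antisym)
    have AR: "A \<inter> R \<in> sets (path_space T)" using A R by auto
    have "emeasure q A \<le> emeasure q ((A \<inter> R) \<union> (space (path_space T) - R))"
      using A R sq sets.sets_into_space[OF A] by (intro emeasure_mono) auto
    also have "\<dots> = emeasure q (A \<inter> R)"
      using A R sq q0 by (intro emeasure_Un_null_set) (auto intro!: null_setsI)
    also have "\<dots> \<le> emeasure q (A \<inter> R) + emeasure r (A \<inter> R)" by simp
    also have "\<dots> = inner_measure q (A \<inter> R - {origin T}) + inner_measure r (A \<inter> R - {origin T})"
      by (rule reg[OF AR])
    also have "inner_measure r (A \<inter> R - {origin T}) \<le> emeasure r R"
      using R sq by (intro inner_measure_le) auto
    also have "inner_measure q (A \<inter> R - {origin T}) \<le> inner_measure q (A - {origin T})"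
      by (intro inner_measure_mono) auto
    finally show "emeasure q A \<le> inner_measure q (A - {origin T})" by (simp add: r0)
    show "inner_measure q (A - {origin T}) \<le> emeasure q A"
      using A sq by (intro inner_measure_le) auto
  qed
  have le: "levy_integrable T p" "levy_integrable T n"
    using s by (auto intro!: levy_integrable_mono[OF tv] simp: emeasure_add_measure)
  have "space (path_space T) - (space (path_space T) - P) = P"
    using sets.sets_into_space[OF P(1)] by auto
  then have "emeasure n A = inner_measure n (A - {origin T})" if "A \<in> sets (path_space T)" for A
    using P s reg by (intro key[OF that, of "space (path_space T) - P" n p]) (auto simp: add.commute)
  moreover have "emeasure p A = inner_measure p (A - {origin T})" if "A \<in> sets (path_space T)" for A
    using P s reg by (intro key[OF that, of P p n]) auto
  ultimately show "levy_measure T p" "levy_measure T n"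
    using le by (auto simp: levy_measure_def levy_integrable_def)
qed

section \<open>Generating triplets\<close>

lemma norm_integral_iexp_le_1:
  assumes "prob_space M"
  shows "norm (CLINT \<omega>|M. iexp (f \<omega>)) \<le> 1"
proof -
  interpret prob_space M by fact
  have "norm (CLINT \<omega>|M. iexp (f \<omega>)) \<le> (\<integral>\<omega>. norm (iexp (f \<omega>)) \<partial>M)"
    by (rule integral_norm_bound)
  then show ?thesis
    by (simp add: prob_space)
qed

lemma path_map_measurable:
  assumes "process T M X" "I \<subseteq> T"
  shows "path_map I X \<in> measurable M (path_space I)"
  unfolding path_map_def using assms by (intro measurable_restrict) (auto simp: process_def)

lemma inner_prod_on_path_map: "I \<subseteq> T \<Longrightarrow> inner_prod_on I \<theta> (path_map T X \<omega>) = inner_prod_on I \<theta> (\<lambda>t. X t \<omega>)"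
  unfolding inner_prod_on_def path_map_def by (intro sum.cong refl) auto

lemma iexp_inner_prod_on_measurable:
  "I \<subseteq> T \<Longrightarrow> (\<lambda>x. iexp (inner_prod_on I \<theta> x)) \<in> borel_measurable (path_space T)"
  using inner_prod_on_measurable[of I T \<theta>] by measurable

lemma char_fin_dim_distr:
  assumes "process T M X" "I \<subseteq> T"
  shows "(CLINT x|fin_dim_distr M X I. iexp (inner_prod_on I \<theta> x)) = (CLINT \<omega>|M. iexp (inner_prod_on I \<theta> (\<lambda>t. X t \<omega>)))"
  unfolding fin_dim_distr_def
  by (subst integral_distr[OF path_map_measurable[OF assms] iexp_inner_prod_on_measurable[OF subset_refl]])
    (simp add: inner_prod_on_path_map)

lemma inner_prod_on_extend:
  assumes "I \<subseteq> J" "finite J"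
  shows "inner_prod_on J (\<lambda>t. if t \<in> I then \<theta> t else 0) x = inner_prod_on I \<theta> x"
  unfolding inner_prod_on_def using assms by (intro sum.mono_neutral_cong_right) auto

lemma quad_form_on_extend:
  assumes "I \<subseteq> J" "finite J"
  shows "quad_form_on J (\<lambda>t. if t \<in> I then \<theta> t else 0) S = quad_form_on I \<theta> S"
  unfolding quad_form_on_def
proof (rule sum.mono_neutral_cong_right[OF assms(2,1)])
  fix s assume "s \<in> I"
  with assms show "(\<Sum>t\<in>J. (if s \<in> I then \<theta> s else 0) * S (s, t) * (if t \<in> I then \<theta> t else 0)) = (\<Sum>t\<in>I. \<theta> s * S (s, t) * \<theta> t)"
    by (intro sum.mono_neutral_cong_right) auto
qed auto

text \<open>A frequency supported in \<open>I\<close> sees only the coordinates in \<open>I\<close>;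
  padding it with zeros amounts to passing to the marginal. This is where consistency of the
  finite-dimensional triplets comes from.\<close>

lemma lk_exponent_extend:
  assumes chi: "truncation_factor chi" and I: "I \<subseteq> J" "finite J" and s: "sets \<nu> = sets (path_space J)"
  shows "lk_exponent chi J S (\<lambda>g. CLINT x|\<nu>. g x) b (\<lambda>t. if t \<in> I then \<theta> t else 0) =
    lk_exponent chi I S (\<lambda>g. CLINT x|marginal I \<nu>. g x) b \<theta>"
proof -
  have "lk_integrand chi J (\<lambda>t. if t \<in> I then \<theta> t else 0) = lk_integrand chi I \<theta>"
    by (rule ext) (simp add: lk_integrand_def inner_prod_on_extend[OF I])
  then show ?thesis
    by (simp add: lk_exponent_def inner_prod_on_extend[OF I] quad_form_on_extend[OF I]
      integral_lk_integrand_marginal[OF chi s I(1)])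
qed

lemma diff_integral_null: "diff_integral \<nu> (null_measure M) = (\<lambda>g. CLINT x|\<nu>. g x)"
  by (rule ext) simp

lemma levy_integrable_null: "levy_integrable T (null_measure (path_space T))"
  by (simp add: levy_integrable_def)

text \<open>A Levy measure counts as a difference with the null measure, so uniqueness for
  differences applies.\<close>

lemma levy_triplet_unique:
  assumes chi: "truncation_factor chi" and I: "finite I" and \<mu>: "levy_integrable I \<mu>" "levy_integrable I \<mu>'"
    and eq: "\<And>\<theta>. exp (lk_exponent chi I S (\<lambda>g. CLINT x|\<mu>. g x) b \<theta>) = exp (lk_exponent chi I S' (\<lambda>g. CLINT x|\<mu>'. g x) b' \<theta>)"
  shows "agree_off_origin I \<mu> \<mu>'"
    and "\<And>\<theta>. quad_form_on I \<theta> S = quad_form_on I \<theta> S'"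
    and "\<And>\<theta>. inner_prod_on I \<theta> b = inner_prod_on I \<theta> b'"
proof -
  note n = levy_integrable_null[of I]
  have "exp (lk_exponent chi I S (diff_integral \<mu> (null_measure (path_space I))) b \<theta>) =
      exp (lk_exponent chi I S' (diff_integral \<mu>' (null_measure (path_space I))) b' \<theta>)" for \<theta>
    unfolding diff_integral_null by (rule eq)
  note eq' = lk_exponent_eq_if_exp_eq[OF chi I subset_refl \<mu>(1) n \<mu>(2) n this]
  note u = lk_exponent_unique[OF chi I \<mu>(1) n \<mu>(2) n eq']
  have s: "sets \<mu> = sets (path_space I)" "sets \<mu>' = sets (path_space I)"
    using \<mu> by (simp_all add: levy_integrable_def)
  show "agree_off_origin I \<mu> \<mu>'"
    using u(1) s by (simp add: agree_off_origin_def emeasure_add_measure)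
  show "quad_form_on I \<theta> S = quad_form_on I \<theta> S'" "inner_prod_on I \<theta> b = inner_prod_on I \<theta> b'" for \<theta>
    by (fact u(2), fact u(3))
qed

definition unit_vec :: "'t \<Rightarrow> 't \<Rightarrow> real" where
  "unit_vec t = (\<lambda>s. if s = t then 1 else 0)"

lemma inner_prod_on_unit_vec: "finite I \<Longrightarrow> t \<in> I \<Longrightarrow> inner_prod_on I (unit_vec t) x = x t"
  by (simp add: inner_prod_on_def unit_vec_def if_distrib[of "\<lambda>u. u * _"] cong: if_cong)

lemma quad_form_on_polarization:
  assumes I: "finite I" "s \<in> I" "t \<in> I" and S: "symmetric_on I S"
  shows "quad_form_on I (\<lambda>u. unit_vec s u + unit_vec t u) S - quad_form_on I (\<lambda>u. unit_vec s u - unit_vec t u) S = 4 * S (s, t)"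
proof -
  have bil: "(\<Sum>u\<in>I. \<Sum>v\<in>I. unit_vec a u * S (u, v) * unit_vec b v) = S (a, b)" if "a \<in> I" "b \<in> I" for a b
  proof -
    have "(\<Sum>v\<in>I. unit_vec a u * S (u, v) * unit_vec b v) = unit_vec a u * S (u, b)" for u
      using that I(1) by (simp add: unit_vec_def if_distrib[of "\<lambda>x. _ * x"] cong: if_cong)
    then show ?thesis
      using that I(1) by (simp add: unit_vec_def if_distrib[of "\<lambda>x. x * _"] cong: if_cong)
  qed
  have "quad_form_on I (\<lambda>u. unit_vec s u + unit_vec t u) S - quad_form_on I (\<lambda>u. unit_vec s u - unit_vec t u) S =
      (\<Sum>u\<in>I. \<Sum>v\<in>I. (unit_vec s u + unit_vec t u) * S (u, v) * (unit_vec s v + unit_vec t v) -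
        (unit_vec s u - unit_vec t u) * S (u, v) * (unit_vec s v - unit_vec t v))"
    unfolding quad_form_on_def by (simp only: sum_subtractf)
  also have "\<dots> = (\<Sum>u\<in>I. \<Sum>v\<in>I. 2 * (unit_vec s u * S (u, v) * unit_vec t v) + 2 * (unit_vec t u * S (u, v) * unit_vec s v))"
    by (intro sum.cong refl) (simp add: algebra_simps)
  also have "\<dots> = 2 * S (s, t) + 2 * S (t, s)"
    using bil[OF I(2,3)] bil[OF I(3,2)] by (simp only: sum.distrib sum_distrib_left[symmetric])
  also have "S (t, s) = S (s, t)"
    using S I by (simp add: symmetric_on_def)
  finally show ?thesis by simp
qed

lemma symmetric_on_eq_if_quad_form_eq:
  assumes I: "finite I" "s \<in> I" "t \<in> I" and S: "symmetric_on I S" "symmetric_on I S'"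
    and eq: "\<And>\<theta>. quad_form_on I \<theta> S = quad_form_on I \<theta> S'"
  shows "S (s, t) = S' (s, t)"
  using quad_form_on_polarization[OF I S(1)] quad_form_on_polarization[OF I S(2)] eq by simp

lemma quad_form_on_cong:
  "(\<And>s t. s \<in> I \<Longrightarrow> t \<in> I \<Longrightarrow> S (s, t) = S' (s, t)) \<Longrightarrow> quad_form_on I \<theta> S = quad_form_on I \<theta> S'"
  unfolding quad_form_on_def by (intro sum.cong refl) simp

lemma inner_prod_on_cong: "(\<And>t. t \<in> I \<Longrightarrow> b t = b' t) \<Longrightarrow> inner_prod_on I \<theta> b = inner_prod_on I \<theta> b'"
  unfolding inner_prod_on_def by (intro sum.cong refl) simp

lemma symmetric_onD: "symmetric_on T S \<Longrightarrow> s \<in> T \<Longrightarrow> t \<in> T \<Longrightarrow> S (s, t) = S (t, s)"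
  by (simp add: symmetric_on_def)

lemma symmetric_on_subset: "symmetric_on T S \<Longrightarrow> I \<subseteq> T \<Longrightarrow> symmetric_on I S"
  by (auto simp: symmetric_on_def)

text \<open>The representations in the hypothesis are signed and unrelated for different
  \<open>I\<close>. Infinite divisibility makes them genuine Levy triplets, and uniqueness of
  triplets forces the consistency that the projective limit needs.\<close>

lemma ex_id_generating_triplet:
  assumes chi: "truncation_factor chi" and id: "id_process T M W"
    and repr: "\<And>I. finite I \<Longrightarrow> I \<noteq> {} \<Longrightarrow> I \<subseteq> T \<Longrightarrow> \<exists>b S \<nu>1 \<nu>2. symmetric_on I S \<and>
      levy_integrable I \<nu>1 \<and> levy_integrable I \<nu>2 \<and>
      (\<forall>\<theta>. (CLINT \<omega>|M. iexp (inner_prod_on I \<theta> (\<lambda>t. W t \<omega>))) = exp (lk_exponent chi I S (diff_integral \<nu>1 \<nu>2) b \<theta>))"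
  shows "\<exists>S \<nu> b. id_generating_triplet chi T M W S \<nu> b"
proof -
  have proc: "process T M W" and M: "prob_space M"
    using id by (auto simp: id_process_def process_def)
  let ?\<phi> = "\<lambda>I \<theta>. CLINT \<omega>|M. iexp (inner_prod_on I \<theta> (\<lambda>t. W t \<omega>))"
  \<comment> \<open>The data of each index set are packed into one tuple, so that a single use of
    choice serves all \<open>I\<close>.\<close>
  have "\<exists>q. finite I \<longrightarrow> I \<noteq> {} \<longrightarrow> I \<subseteq> T \<longrightarrow> (case q of (b, S, \<nu>) \<Rightarrow> symmetric_on I S \<and> (\<forall>\<theta>. 0 \<le> quad_form_on I \<theta> S) \<and>
      levy_integrable I \<nu> \<and> (\<forall>\<theta>. ?\<phi> I \<theta> = exp (lk_exponent chi I S (\<lambda>g. CLINT x|\<nu>. g x) b \<theta>)))" for I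
  proof (cases "finite I \<and> I \<noteq> {} \<and> I \<subseteq> T")
    case True
    then have I: "finite I" "I \<noteq> {}" "I \<subseteq> T" by auto
    from repr[OF I] obtain b S \<nu>1 \<nu>2 where S: "symmetric_on I S" and l: "levy_integrable I \<nu>1" "levy_integrable I \<nu>2"
      and ch: "\<forall>\<theta>. ?\<phi> I \<theta> = exp (lk_exponent chi I S (diff_integral \<nu>1 \<nu>2) b \<theta>)"
      by (elim exE conjE)
    have ch': "(CLINT x|fin_dim_distr M W I. iexp (inner_prod_on I \<theta> x)) = exp (lk_exponent chi I S (diff_integral \<nu>1 \<nu>2) b \<theta>)" for \<theta>
      unfolding char_fin_dim_distr[OF proc I(3)] using ch by simp
    have idI: "infinitely_divisible_on I (fin_dim_distr M W I)"
      using id I by (simp add: id_process_def)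
    obtain \<nu> where \<nu>: "levy_integrable I \<nu>"
      "\<And>\<theta>. lk_exponent chi I S (diff_integral \<nu>1 \<nu>2) b \<theta> = lk_exponent chi I S (\<lambda>g. CLINT x|\<nu>. g x) b \<theta>"
      using id_exponent_levy[OF chi l I(1) idI ch'] by blast
    have "0 \<le> quad_form_on I \<theta> S" for \<theta>
    proof (rule quad_form_on_nonneg_if_norm_exp_le_1[OF chi l I(1) subset_refl])
      show "norm (exp (lk_exponent chi I S (diff_integral \<nu>1 \<nu>2) b \<theta>)) \<le> 1" for \<theta>
        unfolding ch[THEN spec, symmetric] by (rule norm_integral_iexp_le_1[OF M])
    qed
    then show ?thesis
      using S \<nu> ch by (intro exI[of _ "(b, S, \<nu>)"]) simp
  qed auto
  then have "\<forall>I. \<exists>q. finite I \<longrightarrow> I \<noteq> {} \<longrightarrow> I \<subseteq> T \<longrightarrow> (case q of (b, S, \<nu>) \<Rightarrow> symmetric_on I S \<and> (\<forall>\<theta>. 0 \<le> quad_form_on I \<theta> S) \<and>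
      levy_integrable I \<nu> \<and> (\<forall>\<theta>. ?\<phi> I \<theta> = exp (lk_exponent chi I S (\<lambda>g. CLINT x|\<nu>. g x) b \<theta>)))" ..
  from choice[OF this] obtain q where q: "\<forall>I. finite I \<longrightarrow> I \<noteq> {} \<longrightarrow> I \<subseteq> T \<longrightarrow> (case q I of (b, S, \<nu>) \<Rightarrow>
      symmetric_on I S \<and> (\<forall>\<theta>. 0 \<le> quad_form_on I \<theta> S) \<and>
      levy_integrable I \<nu> \<and> (\<forall>\<theta>. ?\<phi> I \<theta> = exp (lk_exponent chi I S (\<lambda>g. CLINT x|\<nu>. g x) b \<theta>)))"
    by (elim exE)
  define b S nu where "b I = fst (q I)" and "S I = fst (snd (q I))" and "nu I = snd (snd (q I))" for I
  have sym: "symmetric_on I (S I)" and nonneg: "\<And>\<theta>. 0 \<le> quad_form_on I \<theta> (S I)" and lev: "levy_integrable I (nu I)"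
    and ch: "\<And>\<theta>. ?\<phi> I \<theta> = exp (lk_exponent chi I (S I) (\<lambda>g. CLINT x|nu I. g x) (b I) \<theta>)"
    if "finite I" "I \<noteq> {}" "I \<subseteq> T" for I
    using q that by (auto simp: b_def S_def nu_def case_prod_unfold)
  have con: "agree_off_origin I (nu I) (marginal I (nu J))" (is ?a)
    "quad_form_on I \<theta> (S I) = quad_form_on I \<theta> (S J)" (is ?b)
    "inner_prod_on I \<theta> (b I) = inner_prod_on I \<theta> (b J)" (is ?c)
    if J: "finite J" "J \<subseteq> T" and I: "I \<noteq> {}" "I \<subseteq> J" for I J \<theta>
  proof -
    have fI: "finite I" "I \<subseteq> T" "J \<noteq> {}" using J I finite_subset by auto
    note lI = lev[OF fI(1) I(1) fI(2)] and lJ = lev[OF J(1) fI(3) J(2)]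
    have "exp (lk_exponent chi I (S I) (\<lambda>g. CLINT x|nu I. g x) (b I) \<theta>) =
        exp (lk_exponent chi I (S J) (\<lambda>g. CLINT x|marginal I (nu J). g x) (b J) \<theta>)" for \<theta>
    proof -
      have "?\<phi> I \<theta> = ?\<phi> J (\<lambda>t. if t \<in> I then \<theta> t else 0)"
        by (simp add: inner_prod_on_extend[OF I(2) J(1)])
      then show ?thesis
        unfolding ch[OF fI(1) I(1) fI(2)] ch[OF J(1) fI(3) J(2)]
          lk_exponent_extend[OF chi I(2) J(1) levy_integrable_sets[OF lJ]] .
    qed
    note u = levy_triplet_unique[OF chi fI(1) lI levy_integrable_marginal[OF lJ I(2)] this]
    show ?a ?b ?c by (fact u(1), fact u(2), fact u(3))
  qed
  interpret levy_family T nu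
    by unfold_locales (auto intro: lev con)
  \<comment> \<open>The covariance at a pair is read off the index set of just these two points;
    consistency and polarization identify it with the entry of every larger \<open>S I\<close>. As
    \<open>{s, t} = {t, s}\<close>, symmetry is inherited.\<close>
  define \<Sigma> where "\<Sigma> st = S {fst st, snd st} st" for st
  define \<beta> where "\<beta> t = b {t} t" for t
  have \<Sigma>: "\<Sigma> (s, t) = S I (s, t)" if I: "finite I" "I \<subseteq> T" "s \<in> I" "t \<in> I" for I s t
  proof -
    have "S {s, t} (s, t) = S I (s, t)"
    proof (rule symmetric_on_eq_if_quad_form_eq[where I = "{s, t}"])
      show "symmetric_on {s, t} (S {s, t})" using I by (intro sym) auto
      show "symmetric_on {s, t} (S I)" using I sym[of I] by (auto intro: symmetric_on_subset)
      show "quad_form_on {s, t} \<theta> (S {s, t}) = quad_form_on {s, t} \<theta> (S I)" for \<theta>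
        using I by (intro con) auto
    qed auto
    then show ?thesis by (simp add: \<Sigma>_def)
  qed
  have \<beta>: "\<beta> t = b I t" if I: "finite I" "I \<subseteq> T" "t \<in> I" for I t
  proof -
    have u: "inner_prod_on {t} (unit_vec t) x = x t" for x
      by (rule inner_prod_on_unit_vec) simp_all
    have "\<beta> t = inner_prod_on {t} (unit_vec t) (b {t})"
      unfolding \<beta>_def u ..
    also have "\<dots> = inner_prod_on {t} (unit_vec t) (b I)"
      by (rule con(3)) (use I in auto)
    also have "\<dots> = b I t"
      by (rule u)
    finally show ?thesis .
  qed
  have "nonneg_definite_on T \<Sigma>"
    unfolding nonneg_definite_on_def
  proof (intro conjI allI impI)
    show "symmetric_on T \<Sigma>"
      unfolding symmetric_on_def
    proof (intro ballI)
      fix s t assume st: "s \<in> T" "t \<in> T"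
      have "symmetric_on {s, t} (S {s, t})"
        using st by (intro sym) auto
      then have "S {s, t} (s, t) = S {s, t} (t, s)"
        by (rule symmetric_onD) simp_all
      moreover have "{t, s} = {s, t}" by (rule insert_commute)
      ultimately show "\<Sigma> (s, t) = \<Sigma> (t, s)"
        by (simp only: \<Sigma>_def fst_conv snd_conv)
    qed
    fix I \<theta> assume I: "finite I" "I \<subseteq> T"
    show "0 \<le> quad_form_on I \<theta> \<Sigma>"
    proof (cases "I = {}")
      case False
      have "quad_form_on I \<theta> \<Sigma> = quad_form_on I \<theta> (S I)"
        by (intro quad_form_on_cong \<Sigma> I)
      then show ?thesis using nonneg[OF I(1) False I(2)] by simp
    qed (simp add: quad_form_on_def)
  qed
  moreover have "?\<phi> I \<theta> = exp (lk_exponent chi I \<Sigma> (\<lambda>g. CLINT x|proj_lim. g x) \<beta> \<theta>)"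
    if I: "finite I" "I \<noteq> {}" "I \<subseteq> T" for I \<theta>
  proof -
    have "(CLINT x|nu I. lk_integrand chi I \<theta> x) = (CLINT x|marginal I proj_lim. lk_integrand chi I \<theta> x)"
      by (rule integral_agree_off_origin[OF I(1) sets_nu[OF I] sets_marginal agree_marginal_proj_lim[OF I]
        lk_integrand_measurable[OF chi refl subset_refl] lk_integrand_origin])
    then have "(CLINT x|nu I. lk_integrand chi I \<theta> x) = (CLINT x|proj_lim. lk_integrand chi I \<theta> x)"
      by (simp add: integral_lk_integrand_marginal[OF chi sets_proj_lim I(3)])
    moreover have "quad_form_on I \<theta> \<Sigma> = quad_form_on I \<theta> (S I)"
      by (intro quad_form_on_cong \<Sigma> I)
    moreover have "inner_prod_on I \<theta> \<beta> = inner_prod_on I \<theta> (b I)"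
      by (intro inner_prod_on_cong \<beta> I)
    ultimately show ?thesis
      unfolding ch[OF I] by (simp add: lk_exponent_def)
  qed
  ultimately show ?thesis
    using levy_measure_proj_lim by (intro exI[of _ \<Sigma>] exI[of _ proj_lim] exI[of _ \<beta>]) (simp add: id_generating_triplet_def)
qed

text \<open>Independence of the whole paths passes to the exponentials, so the characteristic
  function of \<open>X + Y\<close> factorizes. \<open>Z\<close> may live on another space and enters
  only through its finite-dimensional laws.\<close>

lemma char_generate:
  assumes X: "process T M X" and g: "generate T M X Y N Z" and I: "finite I" "I \<noteq> {}" "I \<subseteq> T"
  shows "(CLINT \<omega>|N. iexp (inner_prod_on I \<theta> (\<lambda>t. Z t \<omega>))) =
    (CLINT \<omega>|M. iexp (inner_prod_on I \<theta> (\<lambda>t. X t \<omega>))) * (CLINT \<omega>|M. iexp (inner_prod_on I \<theta> (\<lambda>t. Y t \<omega>)))"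
proof -
  have Y: "process T M Y" and Z: "process T N Z"
    and ind: "prob_space.indep_var M (path_space T) (path_map T X) (path_space T) (path_map T Y)"
    and eq: "fin_dim_distr M (\<lambda>t \<omega>. X t \<omega> + Y t \<omega>) I = fin_dim_distr N Z I"
    using g I by (auto simp: generate_def id_process_def)
  interpret prob_space M using X by (simp add: process_def)
  have XY: "process T M (\<lambda>t \<omega>. X t \<omega> + Y t \<omega>)"
    using X Y unfolding process_def by (auto intro: borel_measurable_add)
  let ?e = "\<lambda>x. iexp (inner_prod_on I \<theta> x)"
  have ie: "integrable M (\<lambda>\<omega>. ?e (path_map T U \<omega>))" if "process T M U" for U
    using measurable_compose[OF path_map_measurable[OF that subset_refl] iexp_inner_prod_on_measurable[OF I(3)]]
    by (intro integrable_const_bound[where B = 1]) auto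
  have "indep_var borel (?e \<circ> path_map T X) borel (?e \<circ> path_map T Y)"
    by (rule indep_var_compose[OF ind]) (rule iexp_inner_prod_on_measurable[OF I(3)])+
  then have ind': "indep_var borel (\<lambda>\<omega>. ?e (path_map T X \<omega>)) borel (\<lambda>\<omega>. ?e (path_map T Y \<omega>))"
    by (simp only: comp_def)
  have "(CLINT \<omega>|N. ?e (\<lambda>t. Z t \<omega>)) = (CLINT \<omega>|M. ?e (\<lambda>t. X t \<omega> + Y t \<omega>))"
    using char_fin_dim_distr[OF Z I(3), of \<theta>] char_fin_dim_distr[OF XY I(3), of \<theta>] eq by simp
  also have "\<dots> = (CLINT \<omega>|M. ?e (path_map T X \<omega>) * ?e (path_map T Y \<omega>))"
  proof (intro Bochner_Integration.integral_cong refl)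
    fix \<omega>
    have "inner_prod_on I \<theta> (\<lambda>t. X t \<omega> + Y t \<omega>) = inner_prod_on I \<theta> (\<lambda>t. X t \<omega>) + inner_prod_on I \<theta> (\<lambda>t. Y t \<omega>)"
      by (simp add: inner_prod_on_def distrib_left sum.distrib)
    then show "?e (\<lambda>t. X t \<omega> + Y t \<omega>) = ?e (path_map T X \<omega>) * ?e (path_map T Y \<omega>)"
      by (simp add: inner_prod_on_path_map[OF I(3)] distrib_left exp_add)
  qed
  also have "\<dots> = (CLINT \<omega>|M. ?e (path_map T X \<omega>)) * (CLINT \<omega>|M. ?e (path_map T Y \<omega>))"
    by (rule indep_var_lebesgue_integral[OF ind' ie[OF X] ie[OF Y]])
  finally show ?thesis
    by (simp add: inner_prod_on_path_map[OF I(3)])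
qed

text \<open>The difference of two differences of measures is again one, formed from sums of
  measures: the subtracted negative part joins the positive slot and vice versa.\<close>

lemma lk_exponent_diff:
  assumes chi: "truncation_factor chi" and I: "finite I" "I \<subseteq> T"
    and l: "levy_integrable T p1" "levy_integrable T n1" "levy_integrable T p2" "levy_integrable T n2"
  shows "lk_exponent chi I S1 (diff_integral p1 n1) b1 \<theta> - lk_exponent chi I S2 (diff_integral p2 n2) b2 \<theta> =
    lk_exponent chi I (\<lambda>st. S1 st - S2 st) (diff_integral (add_measure p1 n2) (add_measure n1 p2)) (\<lambda>t. b1 t - b2 t) \<theta>"
proof -
  note i = integrable_lk_integrand[OF chi _ I, of _ \<theta>]
  note s = l[THEN levy_integrable_sets]
  have 1: "inner_prod_on I \<theta> (\<lambda>t. b1 t - b2 t) = inner_prod_on I \<theta> b1 - inner_prod_on I \<theta> b2"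
    by (simp add: inner_prod_on_def right_diff_distrib sum_subtractf)
  have 2: "quad_form_on I \<theta> (\<lambda>st. S1 st - S2 st) = quad_form_on I \<theta> S1 - quad_form_on I \<theta> S2"
    by (simp add: quad_form_on_def right_diff_distrib left_diff_distrib sum_subtractf)
  have 3: "diff_integral (add_measure p1 n2) (add_measure n1 p2) (lk_integrand chi I \<theta>) =
      diff_integral p1 n1 (lk_integrand chi I \<theta>) - diff_integral p2 n2 (lk_integrand chi I \<theta>)"
    using s by (simp add: integral_add_measure i l)
  show ?thesis
    unfolding lk_exponent_def 1 2 3 by (simp add: algebra_simps diff_divide_distrib)
qed

lemma symmetric_on_diff: "symmetric_on T S \<Longrightarrow> symmetric_on T S' \<Longrightarrow> symmetric_on T (\<lambda>st. S st - S' st)"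
  by (simp add: symmetric_on_def)

lemma levy_measure_fin_imp_levy_integrable:
  assumes I: "finite I" and \<nu>: "levy_measure_fin I \<nu>"
  shows "levy_integrable I \<nu>"
  unfolding levy_integrable_def
proof (intro conjI ballI)
  show "sets \<nu> = sets (path_space I)" using \<nu> by (simp add: levy_measure_fin_def)
  fix t assume t: "t \<in> I"
  have "(\<integral>\<^sup>+x. ennreal (min (\<bar>x t\<bar>\<^sup>2) 1) \<partial>\<nu>) \<le> (\<integral>\<^sup>+x. ennreal (min (\<Sum>t\<in>I. \<bar>x t\<bar>\<^sup>2) 1) \<partial>\<nu>)"
  proof (intro nn_integral_mono ennreal_leI min.mono order_refl)
    show "\<bar>x t\<bar>\<^sup>2 \<le> (\<Sum>t\<in>I. \<bar>x t\<bar>\<^sup>2)" for x :: "'a \<Rightarrow> real"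
      using I t by (intro member_le_sum) auto
  qed
  also have "\<dots> < \<infinity>" using \<nu> by (simp add: levy_measure_fin_def)
  finally show "(\<integral>\<^sup>+x. ennreal (min (\<bar>x t\<bar>\<^sup>2) 1) \<partial>\<nu>) < \<infinity>" .
qed

lemma qid_process_repr:
  assumes X: "qid_process chi T M X" and I: "finite I" "I \<noteq> {}" "I \<subseteq> T"
  obtains b S \<nu>1 \<nu>2 where "symmetric_on I S" "levy_integrable I \<nu>1" "levy_integrable I \<nu>2"
    "\<And>\<theta>. (CLINT \<omega>|M. iexp (inner_prod_on I \<theta> (\<lambda>t. X t \<omega>))) = exp (lk_exponent chi I S (diff_integral \<nu>1 \<nu>2) b \<theta>)"
proof -
  have proc: "process T M X" and "qid_on chi I (fin_dim_distr M X I)"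
    using X I by (auto simp: qid_process_def)
  then obtain b S \<nu>1 \<nu>2 where "symmetric_on I S" "levy_measure_fin I \<nu>1" "levy_measure_fin I \<nu>2"
    "\<forall>\<theta>. (CLINT x|fin_dim_distr M X I. iexp (inner_prod_on I \<theta> x)) = exp (lk_exponent chi I S (diff_integral \<nu>1 \<nu>2) b \<theta>)"
    unfolding qid_on_def by (elim exE conjE)
  then show ?thesis
    by (intro that[of S \<nu>1 \<nu>2 b] levy_measure_fin_imp_levy_integrable I(1)) (simp_all add: char_fin_dim_distr[OF proc I(3)])
qed

lemma id_generating_triplet_repr:
  assumes chi: "truncation_factor chi" and W: "id_generating_triplet chi T M W S \<nu> b" and I: "finite I" "I \<noteq> {}" "I \<subseteq> T"
  shows "symmetric_on I S" "levy_integrable I (marginal I \<nu>)"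
    "(CLINT \<omega>|M. iexp (inner_prod_on I \<theta> (\<lambda>t. W t \<omega>))) =
      exp (lk_exponent chi I S (diff_integral (marginal I \<nu>) (null_measure (path_space I))) b \<theta>)"
proof -
  have l: "levy_integrable T \<nu>"
    using W by (simp add: id_generating_triplet_def levy_measure_iff)
  show "symmetric_on I S"
    using W I(3) by (auto simp: id_generating_triplet_def nonneg_definite_on_def intro: symmetric_on_subset)
  show "levy_integrable I (marginal I \<nu>)"
    by (rule levy_integrable_marginal[OF l I(3)])
  show "(CLINT \<omega>|M. iexp (inner_prod_on I \<theta> (\<lambda>t. W t \<omega>))) =
      exp (lk_exponent chi I S (diff_integral (marginal I \<nu>) (null_measure (path_space I))) b \<theta>)"
    using W I by (simp add: id_generating_triplet_def lk_exponent_def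
      integral_lk_integrand_marginal[OF chi levy_integrable_sets[OF l] I(3)])
qed

section \<open>Uniqueness of signed triplets\<close>

lemma levy_measure_add_measure:
  assumes \<mu>: "levy_measure T \<mu>" and \<nu>: "levy_measure T \<nu>"
  shows "levy_measure T (add_measure \<mu> \<nu>)"
  unfolding levy_measure_iff
proof (intro conjI ballI)
  show "levy_integrable T (add_measure \<mu> \<nu>)"
    using \<mu> \<nu> by (intro levy_integrable_add_measure) (simp_all add: levy_measure_iff)
  have s: "sets \<mu> = sets (path_space T)" "sets \<nu> = sets (path_space T)" "sets \<nu> = sets \<mu>"
    using \<mu> \<nu> by (simp_all add: levy_measure_def)
  fix A assume A: "A \<in> sets (path_space T)"
  obtain C where C: "C \<subseteq> T" "countable C" "emeasure \<mu> (A \<inter> nonzero_set T C) = emeasure \<mu> A"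
    using \<mu> A by (auto simp: levy_measure_iff)
  obtain D where D: "D \<subseteq> T" "countable D" "emeasure \<nu> (A \<inter> nonzero_set T D) = emeasure \<nu> A"
    using \<nu> A by (auto simp: levy_measure_iff)
  have CD: "C \<union> D \<subseteq> T" "countable (C \<union> D)" using C D by auto
  let ?W = "A \<inter> nonzero_set T (C \<union> D)"
  have W: "?W \<in> sets (path_space T)" using A nonzero_set_measurable[OF CD] by auto
  have "emeasure \<mu> A \<le> emeasure \<mu> ?W"
    unfolding C(3)[symmetric] using W s nonzero_set_mono[of C "C \<union> D" T] by (intro emeasure_mono) auto
  moreover have "emeasure \<nu> A \<le> emeasure \<nu> ?W"
    unfolding D(3)[symmetric] using W s nonzero_set_mono[of D "C \<union> D" T] by (intro emeasure_mono) auto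
  ultimately have "emeasure (add_measure \<mu> \<nu>) A \<le> emeasure (add_measure \<mu> \<nu>) ?W"
    unfolding emeasure_add_measure[OF s(3)] by (rule add_mono)
  moreover have "emeasure (add_measure \<mu> \<nu>) ?W \<le> emeasure (add_measure \<mu> \<nu>) A"
    using A s by (intro emeasure_mono) auto
  ultimately show "\<exists>C\<subseteq>T. countable C \<and> emeasure (add_measure \<mu> \<nu>) (A \<inter> nonzero_set T C) = emeasure (add_measure \<mu> \<nu>) A"
    using CD by (intro exI[of _ "C \<union> D"]) auto
qed

lemma marginal_add_measure:
  assumes s: "sets \<mu> = sets (path_space T)" "sets \<nu> = sets (path_space T)" and I: "I \<subseteq> T"
  shows "marginal I (add_measure \<mu> \<nu>) = add_measure (marginal I \<mu>) (marginal I \<nu>)"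
proof (rule measure_eqI)
  fix A assume "A \<in> sets (marginal I (add_measure \<mu> \<nu>))"
  then have A: "A \<in> sets (path_space I)" by simp
  show "emeasure (marginal I (add_measure \<mu> \<nu>)) A = emeasure (add_measure (marginal I \<mu>) (marginal I \<nu>)) A"
    using s A I by (simp add: emeasure_marginal[where T = T] emeasure_add_measure)
qed simp

lemma signed_integral_eq:
  "jordan_decomposition M \<nu> p n \<Longrightarrow> signed_integral M \<nu> = (\<lambda>g. (CLINT x|p. g x) - (CLINT x|n. g x))"
  by (rule ext) (simp add: signed_integral_def jordan_decomposition_imp_eq)

lemma lk_exponent_marginal:
  assumes chi: "truncation_factor chi" and I: "I \<subseteq> T" and s: "sets p = sets (path_space T)" "sets n = sets (path_space T)"
  shows "lk_exponent chi I S (diff_integral (marginal I p) (marginal I n)) b \<theta> = lk_exponent chi I S (diff_integral p n) b \<theta>"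
  by (simp add: lk_exponent_def integral_lk_integrand_marginal[OF chi s(1) I] integral_lk_integrand_marginal[OF chi s(2) I])

text \<open>Returns from the additive form to signed values, which requires that neither difference
  is infinity minus infinity.\<close>

lemma enn2ereal_diff_eq:
  assumes "p \<noteq> \<infinity> \<or> n \<noteq> \<infinity>" "p' \<noteq> \<infinity> \<or> n' \<noteq> \<infinity>" "p + n' = p' + n"
  shows "enn2ereal p - enn2ereal n = enn2ereal p' - enn2ereal n'"
  using assms
  by (cases p; cases n; cases p'; cases n') (auto simp: ennreal.rep_eq max_def simp flip: ennreal_plus)

text \<open>The sums \<open>p + n'\<close> and \<open>p' + n\<close> are Levy measures whose
  marginals agree off the origin, hence they coincide on path space. In each Jordan pair one measure
  is finite, so the sums may be turned back into differences.\<close>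

lemma signed_triplet_unique:
  assumes chi: "truncation_factor chi"
    and Q: "quasi_levy_type_measure T \<nu>" "quasi_levy_type_measure T \<nu>'"
    and S: "symmetric_on T S" "symmetric_on T S'"
    and eq: "\<And>I \<theta>. finite I \<Longrightarrow> I \<noteq> {} \<Longrightarrow> I \<subseteq> T \<Longrightarrow>
      exp (lk_exponent chi I S (signed_integral (path_space T) \<nu>) b \<theta>) = exp (lk_exponent chi I S' (signed_integral (path_space T) \<nu>') b' \<theta>)"
  shows "\<nu> = \<nu>'" and "\<And>s t. s \<in> T \<Longrightarrow> t \<in> T \<Longrightarrow> S (s, t) = S' (s, t)" and "\<And>t. t \<in> T \<Longrightarrow> b t = b' t"
proof -
  obtain p n where J: "jordan_decomposition (path_space T) \<nu> p n"
    using Q(1) by (auto simp: quasi_levy_type_measure_def)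
  obtain p' n' where J': "jordan_decomposition (path_space T) \<nu>' p' n'"
    using Q(2) by (auto simp: quasi_levy_type_measure_def)
  note L = quasi_levy_type_measureD[OF Q(1) J] quasi_levy_type_measureD[OF Q(2) J']
  have l: "levy_integrable T p" "levy_integrable T n" "levy_integrable T p'" "levy_integrable T n'"
    using L by (simp_all add: levy_measure_iff)
  note s = l[THEN levy_integrable_sets]
  have u: "agree_off_origin I (marginal I (add_measure p n')) (marginal I (add_measure p' n))" (is ?a)
    "quad_form_on I \<theta> S = quad_form_on I \<theta> S'" (is ?b)
    "inner_prod_on I \<theta> b = inner_prod_on I \<theta> b'" (is ?c)
    if I: "finite I" "I \<noteq> {}" "I \<subseteq> T" for I \<theta>
  proof -
    have "exp (lk_exponent chi I S (diff_integral p n) b \<theta>) = exp (lk_exponent chi I S' (diff_integral p' n') b' \<theta>)" for \<theta>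
      using eq[OF I, of \<theta>] unfolding signed_integral_eq[OF J] signed_integral_eq[OF J'] .
    note e = lk_exponent_eq_if_exp_eq[OF chi I(1,3) l this]
    have e': "lk_exponent chi I S (diff_integral (marginal I p) (marginal I n)) b \<theta> =
        lk_exponent chi I S' (diff_integral (marginal I p') (marginal I n')) b' \<theta>" for \<theta>
      unfolding lk_exponent_marginal[OF chi I(3) s(1,2)] lk_exponent_marginal[OF chi I(3) s(3,4)] by (rule e)
    note u = lk_exponent_unique[OF chi I(1) levy_integrable_marginal[OF l(1) I(3)] levy_integrable_marginal[OF l(2) I(3)]
      levy_integrable_marginal[OF l(3) I(3)] levy_integrable_marginal[OF l(4) I(3)] e']
    show ?a
      unfolding marginal_add_measure[OF s(1,4) I(3)] marginal_add_measure[OF s(3,2) I(3)] by (rule u(1))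
    show ?b ?c by (fact u(2), fact u(3))
  qed
  have add: "add_measure p n' = add_measure p' n"
    by (rule levy_measure_eqI[OF levy_measure_add_measure[OF L(1,4)] levy_measure_add_measure[OF L(3,2)] u(1)])
  show "\<nu> = \<nu>'"
  proof
    fix A
    show "\<nu> A = \<nu>' A"
    proof (cases "A \<in> sets (path_space T)")
      case True
      have "emeasure p A + emeasure n' A = emeasure p' A + emeasure n A"
        using arg_cong[OF add, of "\<lambda>\<mu>. emeasure \<mu> A"] s by (simp add: emeasure_add_measure)
      moreover have "emeasure p A \<noteq> \<infinity> \<or> emeasure n A \<noteq> \<infinity>" "emeasure p' A \<noteq> \<infinity> \<or> emeasure n' A \<noteq> \<infinity>"
        using J J' by (auto simp: jordan_decomposition_def dest: finite_measure.emeasure_finite)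
      ultimately have "enn2ereal (emeasure p A) - enn2ereal (emeasure n A) = enn2ereal (emeasure p' A) - enn2ereal (emeasure n' A)"
        by (intro enn2ereal_diff_eq)
      then show ?thesis
        using J J' True by (simp add: jordan_decomposition_def)
    next
      case False
      then show ?thesis
        using Q by (simp add: quasi_levy_type_measure_def signed_measure_def)
    qed
  qed
  show "S (s, t) = S' (s, t)" if "s \<in> T" "t \<in> T" for s t
  proof (rule symmetric_on_eq_if_quad_form_eq[where I = "{s, t}"])
    show "symmetric_on {s, t} S" "symmetric_on {s, t} S'"
      using that by (auto intro: symmetric_on_subset[OF S(1)] symmetric_on_subset[OF S(2)])
    show "quad_form_on {s, t} \<theta> S = quad_form_on {s, t} \<theta> S'" for \<theta>
      by (rule u(2)) (use that in auto)
  qed simp_all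
  show "b t = b' t" if "t \<in> T" for t
  proof -
    have v: "inner_prod_on {t} (unit_vec t) x = x t" for x
      by (rule inner_prod_on_unit_vec) simp_all
    have "inner_prod_on {t} (unit_vec t) b = inner_prod_on {t} (unit_vec t) b'"
      by (rule u(3)) (use that in auto)
    then show ?thesis unfolding v .
  qed
qed

section \<open>Existence and the final assembly\<close>

text \<open>Only the process with finite Levy measure comes with a triplet. On finite index sets the
  exponent of the other one is the sum or the difference of known exponents, and its triplet is
  built from these.\<close>

lemma ex_generating_triplets:
  assumes chi: "truncation_factor chi" and X: "qid_process chi T M X" and g: "generate T M X Y N Z"
    and fin: "has_finite_levy_measure chi T M Y \<or> has_finite_levy_measure chi T N Z"
  obtains SY \<nu>Y bY SZ \<nu>Z bZ where "id_generating_triplet chi T M Y SY \<nu>Y bY" "id_generating_triplet chi T N Z SZ \<nu>Z bZ"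
    "emeasure \<nu>Y (space \<nu>Y) < \<infinity> \<or> emeasure \<nu>Z (space \<nu>Z) < \<infinity>"
proof -
  have proc: "process T M X" using X by (simp add: qid_process_def)
  note ch = char_generate[OF proc g]
  note null = levy_integrable_null
  show ?thesis
    using fin
  proof
    assume "has_finite_levy_measure chi T M Y"
    then obtain S \<nu> b where W: "id_generating_triplet chi T M Y S \<nu> b" and fin: "emeasure \<nu> (space \<nu>) < \<infinity>"
      by (auto simp: has_finite_levy_measure_def)
    have idZ: "id_process T N Z" using g by (simp add: generate_def)
    have "\<exists>S' \<nu>' b'. id_generating_triplet chi T N Z S' \<nu>' b'"
    proof (rule ex_id_generating_triplet[OF chi idZ])
      fix I assume I: "finite I" "I \<noteq> {}" "I \<subseteq> T"
      obtain c A \<nu>1 \<nu>2 where A: "symmetric_on I A" and l: "levy_integrable I \<nu>1" "levy_integrable I \<nu>2"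
        and e: "\<And>\<theta>. (CLINT \<omega>|M. iexp (inner_prod_on I \<theta> (\<lambda>t. X t \<omega>))) = exp (lk_exponent chi I A (diff_integral \<nu>1 \<nu>2) c \<theta>)"
        by (rule qid_process_repr[OF X I]) (rule that)
      note W' = id_generating_triplet_repr[OF chi W I]
      \<comment> \<open>The sum of the exponents of \<open>X\<close> and \<open>Y\<close> is written
        as a difference with the negated triplet of \<open>Y\<close>, whose Levy measure thereby
        sits in the negative slot; so \<open>lk_exponent_diff\<close> covers this case as
        well.\<close>
      have "(CLINT \<omega>|N. iexp (inner_prod_on I \<theta> (\<lambda>t. Z t \<omega>))) = exp (lk_exponent chi I (\<lambda>st. A st - - S st)
          (diff_integral (add_measure \<nu>1 (marginal I \<nu>)) (add_measure \<nu>2 (null_measure (path_space I)))) (\<lambda>t. c t - - b t) \<theta>)" for \<theta>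
      proof -
        have "lk_exponent chi I S (diff_integral (marginal I \<nu>) (null_measure (path_space I))) b \<theta> =
            - lk_exponent chi I (\<lambda>st. - S st) (diff_integral (null_measure (path_space I)) (marginal I \<nu>)) (\<lambda>t. - b t) \<theta>"
          by (simp add: lk_exponent_def inner_prod_on_def quad_form_on_def sum_negf)
        then show ?thesis
          unfolding ch[OF I] e W'(3) lk_exponent_diff[OF chi I(1) subset_refl l null W'(2), symmetric]
          by (simp flip: exp_add)
      qed
      moreover have "symmetric_on I (\<lambda>st. A st - - S st)"
        using A W'(1) by (simp add: symmetric_on_def)
      ultimately show "\<exists>b S \<nu>1 \<nu>2. symmetric_on I S \<and> levy_integrable I \<nu>1 \<and> levy_integrable I \<nu>2 \<and>
          (\<forall>\<theta>. (CLINT \<omega>|N. iexp (inner_prod_on I \<theta> (\<lambda>t. Z t \<omega>))) = exp (lk_exponent chi I S (diff_integral \<nu>1 \<nu>2) b \<theta>))"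
        using levy_integrable_add_measure[OF l(1) W'(2)] levy_integrable_add_measure[OF l(2) null]
        by (intro exI conjI allI)
    qed
    then obtain S' \<nu>' b' where W2: "id_generating_triplet chi T N Z S' \<nu>' b'" by (elim exE)
    show ?thesis
      by (rule that[OF W W2 disjI1[OF fin]])
  next
    assume "has_finite_levy_measure chi T N Z"
    then obtain S \<nu> b where W: "id_generating_triplet chi T N Z S \<nu> b" and fin: "emeasure \<nu> (space \<nu>) < \<infinity>"
      by (auto simp: has_finite_levy_measure_def)
    have idY: "id_process T M Y" using g by (simp add: generate_def)
    have "\<exists>S' \<nu>' b'. id_generating_triplet chi T M Y S' \<nu>' b'"
    proof (rule ex_id_generating_triplet[OF chi idY])
      fix I assume I: "finite I" "I \<noteq> {}" "I \<subseteq> T"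
      obtain c A \<nu>1 \<nu>2 where A: "symmetric_on I A" and l: "levy_integrable I \<nu>1" "levy_integrable I \<nu>2"
        and e: "\<And>\<theta>. (CLINT \<omega>|M. iexp (inner_prod_on I \<theta> (\<lambda>t. X t \<omega>))) = exp (lk_exponent chi I A (diff_integral \<nu>1 \<nu>2) c \<theta>)"
        by (rule qid_process_repr[OF X I]) (rule that)
      note W' = id_generating_triplet_repr[OF chi W I]
      have "(CLINT \<omega>|M. iexp (inner_prod_on I \<theta> (\<lambda>t. Y t \<omega>))) = exp (lk_exponent chi I (\<lambda>st. S st - A st)
          (diff_integral (add_measure (marginal I \<nu>) \<nu>2) (add_measure (null_measure (path_space I)) \<nu>1)) (\<lambda>t. b t - c t) \<theta>)" for \<theta>
      proof -
        \<comment> \<open>The characteristic function of \<open>X\<close> is an exponential and has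
          no zeros, so the factorization may be divided by it.\<close>
        have "(CLINT \<omega>|M. iexp (inner_prod_on I \<theta> (\<lambda>t. Y t \<omega>))) =
            (CLINT \<omega>|N. iexp (inner_prod_on I \<theta> (\<lambda>t. Z t \<omega>))) / (CLINT \<omega>|M. iexp (inner_prod_on I \<theta> (\<lambda>t. X t \<omega>)))"
          unfolding ch[OF I] e by simp
        then show ?thesis
          unfolding e W'(3) lk_exponent_diff[OF chi I(1) subset_refl W'(2) null l, symmetric] exp_diff .
      qed
      moreover have "symmetric_on I (\<lambda>st. S st - A st)"
        by (rule symmetric_on_diff[OF W'(1) A])
      ultimately show "\<exists>b S \<nu>1 \<nu>2. symmetric_on I S \<and> levy_integrable I \<nu>1 \<and> levy_integrable I \<nu>2 \<and>
          (\<forall>\<theta>. (CLINT \<omega>|M. iexp (inner_prod_on I \<theta> (\<lambda>t. Y t \<omega>))) = exp (lk_exponent chi I S (diff_integral \<nu>1 \<nu>2) b \<theta>))"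
        using levy_integrable_add_measure[OF W'(2) l(2)] levy_integrable_add_measure[OF null l(1)]
        by (intro exI conjI allI)
    qed
    then obtain S' \<nu>' b' where W2: "id_generating_triplet chi T M Y S' \<nu>' b'" by (elim exE)
    show ?thesis
      by (rule that[OF W2 W disjI2[OF fin]])
  qed
qed

text \<open>If the finite measure is the minuend, the decomposition is applied with the roles
  exchanged; then \<open>p\<close> and \<open>n\<close> swap and the Hahn set is replaced by its
  complement.\<close>

lemma levy_measures_difference:
  assumes \<mu>1: "levy_measure T \<mu>1" and \<mu>2: "levy_measure T \<mu>2"
    and fin: "emeasure \<mu>2 (space \<mu>2) < \<infinity> \<or> emeasure \<mu>1 (space \<mu>1) < \<infinity>"
  obtains p n where "levy_measure T p" "levy_measure T n"
    "jordan_decomposition (path_space T) (signed_diff T p n) p n"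
    "add_measure \<mu>1 n = add_measure \<mu>2 p"
proof -
  have key: "\<exists>p n. levy_measure T p \<and> levy_measure T n \<and>
      jordan_decomposition (path_space T) (signed_diff T p n) p n \<and>
      jordan_decomposition (path_space T) (signed_diff T n p) n p \<and> add_measure \<nu>1 n = add_measure \<nu>2 p"
    if \<nu>: "levy_measure T \<nu>1" "levy_measure T \<nu>2" "emeasure \<nu>2 (space \<nu>2) < \<infinity>" for \<nu>1 \<nu>2
  proof -
    obtain p n P where L: "levy_measure T p" "levy_measure T n" "finite_measure n"
      and P: "P \<in> sets (path_space T)" "emeasure n P = 0" "emeasure p (space (path_space T) - P) = 0"
      and add: "\<And>A. A \<in> sets (path_space T) \<Longrightarrow> emeasure \<nu>1 A + emeasure n A = emeasure \<nu>2 A + emeasure p A"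
      by (rule levy_measure_decomposition[OF \<nu>]) (assumption | rule that)+
    have s: "sets p = sets (path_space T)" "sets n = sets (path_space T)" "sets \<nu>1 = sets (path_space T)" "sets \<nu>2 = sets (path_space T)"
      using L \<nu> by (simp_all add: levy_measure_def)
    have "add_measure \<nu>1 n = add_measure \<nu>2 p"
      using s add by (intro measure_eqI) (simp_all add: emeasure_add_measure)
    moreover have "jordan_decomposition (path_space T) (signed_diff T p n) p n"
      using s L(3) P by (intro jordan_decomposition_signed_diff) auto
    moreover have "jordan_decomposition (path_space T) (signed_diff T n p) n p"
    proof (rule jordan_decomposition_signed_diff)
      show "emeasure n (space (path_space T) - (space (path_space T) - P)) = 0"
        using P sets.sets_into_space[OF P(1)] by (simp add: double_diff)
    qed (use s L(3) P in auto)
    ultimately show ?thesis using L by blast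
  qed
  show ?thesis
    using fin
  proof
    assume "emeasure \<mu>2 (space \<mu>2) < \<infinity>"
    from key[OF \<mu>1 \<mu>2 this] show ?thesis using that by blast
  next
    assume "emeasure \<mu>1 (space \<mu>1) < \<infinity>"
    from key[OF \<mu>2 \<mu>1 this] show ?thesis using that by metis
  qed
qed

lemma signed_diff_outside: "A \<notin> sets (path_space T) \<Longrightarrow> signed_diff T p n A = 0"
  by (simp add: signed_diff_def)

theorem theorem7p13:
  fixes T :: "'t set"
    and chi :: "real \<Rightarrow> real"
    and M :: "'w measure" and X Y :: "'t \<Rightarrow> 'w \<Rightarrow> real"
    and N :: "'v measure" and Z :: "'t \<Rightarrow> 'v \<Rightarrow> real"
  assumes "truncation_factor chi"
    and "qid_process chi T M X"
    and "generate T M X Y N Z"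
    and "has_finite_levy_measure chi T M Y \<or> has_finite_levy_measure chi T N Z"
  shows "\<exists>!p :: ('t \<times> 't \<Rightarrow> real) \<times> (('t \<Rightarrow> real) set \<Rightarrow> ereal) \<times> ('t \<Rightarrow> real).
    case p of (S, \<nu>, b) \<Rightarrow>
      S \<in> (\<Pi>\<^sub>E st \<in> T \<times> T. UNIV) \<and> nonneg_definite_on T S \<and>
      quasi_levy_type_measure T \<nu> \<and>
      b \<in> (\<Pi>\<^sub>E t \<in> T. UNIV) \<and>
      (\<forall>I \<theta>. finite I \<longrightarrow> I \<noteq> {} \<longrightarrow> I \<subseteq> T \<longrightarrow>
        (CLINT \<omega>|M. iexp (inner_prod_on I \<theta> (\<lambda>t. X t \<omega>))) =
          exp (lk_exponent chi I S (signed_integral (path_space T) \<nu>) b \<theta>))"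
proof -
  note chi = assms(1)
  have proc: "process T M X" and M: "prob_space M"
    using assms(2) by (auto simp: qid_process_def process_def)
  let ?\<phi> = "\<lambda>I \<theta>. CLINT \<omega>|M. iexp (inner_prod_on I \<theta> (\<lambda>t. X t \<omega>))"
  obtain SY \<nu>Y bY SZ \<nu>Z bZ where Y: "id_generating_triplet chi T M Y SY \<nu>Y bY"
    and Z: "id_generating_triplet chi T N Z SZ \<nu>Z bZ"
    and fin: "emeasure \<nu>Y (space \<nu>Y) < \<infinity> \<or> emeasure \<nu>Z (space \<nu>Z) < \<infinity>"
    by (rule ex_generating_triplets[OF assms])
  have LY: "levy_measure T \<nu>Y" and LZ: "levy_measure T \<nu>Z"
    and SY: "nonneg_definite_on T SY" and SZ: "nonneg_definite_on T SZ"
    using Y Z by (simp_all add: id_generating_triplet_def)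
  \<comment> \<open>Since \<open>X + Y\<close> has the law of \<open>Z\<close>, the Levy measure of
    \<open>Z\<close> enters positively and that of \<open>Y\<close> negatively.\<close>
  obtain p n where L: "levy_measure T p" "levy_measure T n"
    and J: "jordan_decomposition (path_space T) (signed_diff T p n) p n" and add: "add_measure \<nu>Z n = add_measure \<nu>Y p"
    by (rule levy_measures_difference[OF LZ LY fin])
  have l: "levy_integrable T p" "levy_integrable T n" "levy_integrable T \<nu>Y" "levy_integrable T \<nu>Z"
    using L LY LZ by (simp_all add: levy_measure_iff)
  note s = l[THEN levy_integrable_sets]
  \<comment> \<open>Restriction makes the functions extensional, which is the form in which
    uniqueness is claimed; the exponents only see values on \<open>T\<close>.\<close>
  define S where "S = restrict (\<lambda>st. SZ st - SY st) (T \<times> T)"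
  define b where "b = restrict (\<lambda>t. bZ t - bY t) T"
  have repr: "?\<phi> I \<theta> = exp (lk_exponent chi I S (diff_integral p n) b \<theta>)"
    if I: "finite I" "I \<noteq> {}" "I \<subseteq> T" for I \<theta>
  proof -
    note i = integrable_lk_integrand[OF chi _ I(1,3), of _ \<theta>]
    have "quad_form_on I \<theta> S = quad_form_on I \<theta> (\<lambda>st. SZ st - SY st)"
      unfolding S_def using I(3) by (intro quad_form_on_cong) auto
    then have q: "quad_form_on I \<theta> S = quad_form_on I \<theta> SZ - quad_form_on I \<theta> SY"
      by (simp add: quad_form_on_def right_diff_distrib left_diff_distrib sum_subtractf)
    have "inner_prod_on I \<theta> b = inner_prod_on I \<theta> (\<lambda>t. bZ t - bY t)"
      unfolding b_def using I(3) by (intro inner_prod_on_cong) auto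
    then have r: "inner_prod_on I \<theta> b = inner_prod_on I \<theta> bZ - inner_prod_on I \<theta> bY"
      by (simp add: inner_prod_on_def right_diff_distrib sum_subtractf)
    \<comment> \<open>The additive relation between the measures is integrated; all four integrals
      exist, so it can be rearranged into an equality of differences.\<close>
    have "(CLINT x|add_measure \<nu>Z n. lk_integrand chi I \<theta> x) = (CLINT x|add_measure \<nu>Y p. lk_integrand chi I \<theta> x)"
      by (simp only: add)
    then have d: "diff_integral p n (lk_integrand chi I \<theta>) =
        (CLINT x|\<nu>Z. lk_integrand chi I \<theta> x) - (CLINT x|\<nu>Y. lk_integrand chi I \<theta> x)"
      using s by (simp add: integral_add_measure i l algebra_simps)
    have "lk_exponent chi I S (diff_integral p n) b \<theta> =
        lk_exponent chi I SZ (\<lambda>g. CLINT x|\<nu>Z. g x) bZ \<theta> - lk_exponent chi I SY (\<lambda>g. CLINT x|\<nu>Y. g x) bY \<theta>"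
      unfolding lk_exponent_def q r d by (simp add: algebra_simps diff_divide_distrib)
    then show ?thesis
      using char_generate[OF proc assms(3) I, of \<theta>] Y Z I
      by (simp add: exp_diff id_generating_triplet_def)
  qed
  have nonneg: "nonneg_definite_on T S"
    unfolding nonneg_definite_on_def
  proof (intro conjI allI impI)
    show "symmetric_on T S"
      using SY SZ by (auto simp: nonneg_definite_on_def symmetric_on_def S_def)
    fix I \<theta> assume I: "finite I" "I \<subseteq> T"
    show "0 \<le> quad_form_on I \<theta> S"
    proof (cases "I = {}")
      case False
      \<comment> \<open>A difference of nonnegative definite functions need not be one; here the
        bound 1 on the characteristic function of \<open>X\<close> decides the sign.\<close>
      show ?thesis
      proof (rule quad_form_on_nonneg_if_norm_exp_le_1[OF chi l(1,2) I])
        show "norm (exp (lk_exponent chi I S (diff_integral p n) b \<theta>)) \<le> 1" for \<theta>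
          unfolding repr[OF I(1) False I(2), symmetric] by (rule norm_integral_iexp_le_1[OF M])
      qed
    qed (simp add: quad_form_on_def)
  qed
  let ?\<nu> = "signed_diff T p n"
  have Q: "quasi_levy_type_measure T ?\<nu>"
    by (rule quasi_levy_type_measureI[OF J signed_diff_outside L])
  have repr': "?\<phi> I \<theta> = exp (lk_exponent chi I S (signed_integral (path_space T) ?\<nu>) b \<theta>)"
    if "finite I" "I \<noteq> {}" "I \<subseteq> T" for I \<theta>
    unfolding signed_integral_eq[OF J] by (rule repr[OF that])
  show ?thesis
  proof (rule ex1I[of _ "(S, ?\<nu>, b)"])
    show "case (S, ?\<nu>, b) of (S, \<nu>, b) \<Rightarrow>
      S \<in> (\<Pi>\<^sub>E st \<in> T \<times> T. UNIV) \<and> nonneg_definite_on T S \<and>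
      quasi_levy_type_measure T \<nu> \<and>
      b \<in> (\<Pi>\<^sub>E t \<in> T. UNIV) \<and>
      (\<forall>I \<theta>. finite I \<longrightarrow> I \<noteq> {} \<longrightarrow> I \<subseteq> T \<longrightarrow>
        ?\<phi> I \<theta> = exp (lk_exponent chi I S (signed_integral (path_space T) \<nu>) b \<theta>))"
      using nonneg Q repr' by (simp add: S_def b_def)
    fix q :: "('t \<times> 't \<Rightarrow> real) \<times> (('t \<Rightarrow> real) set \<Rightarrow> ereal) \<times> ('t \<Rightarrow> real)"
    obtain S' \<nu>' b' where q: "q = (S', \<nu>', b')" by (cases q)
    assume "case q of (S, \<nu>, b) \<Rightarrow>
      S \<in> (\<Pi>\<^sub>E st \<in> T \<times> T. UNIV) \<and> nonneg_definite_on T S \<and>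
      quasi_levy_type_measure T \<nu> \<and>
      b \<in> (\<Pi>\<^sub>E t \<in> T. UNIV) \<and>
      (\<forall>I \<theta>. finite I \<longrightarrow> I \<noteq> {} \<longrightarrow> I \<subseteq> T \<longrightarrow>
        ?\<phi> I \<theta> = exp (lk_exponent chi I S (signed_integral (path_space T) \<nu>) b \<theta>))"
    then have S': "S' \<in> (\<Pi>\<^sub>E st \<in> T \<times> T. UNIV)" "symmetric_on T S'" and Q': "quasi_levy_type_measure T \<nu>'"
      and b': "b' \<in> (\<Pi>\<^sub>E t \<in> T. UNIV)"
      and e: "\<And>I \<theta>. finite I \<Longrightarrow> I \<noteq> {} \<Longrightarrow> I \<subseteq> T \<Longrightarrow>
        ?\<phi> I \<theta> = exp (lk_exponent chi I S' (signed_integral (path_space T) \<nu>') b' \<theta>)"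
      by (simp_all add: q nonneg_definite_on_def)
    have S: "symmetric_on T S" using nonneg by (simp add: nonneg_definite_on_def)
    have "exp (lk_exponent chi I S' (signed_integral (path_space T) \<nu>') b' \<theta>) =
        exp (lk_exponent chi I S (signed_integral (path_space T) ?\<nu>) b \<theta>)" if "finite I" "I \<noteq> {}" "I \<subseteq> T" for I \<theta>
      using e[OF that] repr'[OF that] by simp
    note u = signed_triplet_unique[OF chi Q' Q S'(2) S this]
    have "S' = S"
    proof (rule PiE_ext[OF S'(1)])
      show "S \<in> (\<Pi>\<^sub>E st \<in> T \<times> T. UNIV)" by (simp add: S_def)
      show "S' st = S st" if "st \<in> T \<times> T" for st
        using that u(2) by (cases st) auto
    qed
    moreover have "b' = b"
    proof (rule PiE_ext[OF b'])
      show "b \<in> (\<Pi>\<^sub>E t \<in> T. UNIV)" by (simp add: b_def)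
    qed (rule u(3))
    ultimately show "q = (S, ?\<nu>, b)"
      using u(1) q by simp
  qed
qed

end
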